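(* Let $A$ be a subalgebra of an octonion algebra $\mathbb{O}$ over a field $F$, with $1\in A$. If $\mathbb{O}$ is split, write $\mathbb{O}=\mathbb{H}+\mathbb{H}w$ with $\mathbb{H}=F^{2\times2}$ and $w^2=1$, and put $p_0=\begin{pmatrix}1&0\\0&0\end{pmatrix}$, $n_0=\begin{pmatrix}0&1\\0&0\end{pmatrix}\in\mathbb{H}$. (In every case below that involves $p_0$, $n_0$ or $w$, the algebra $\mathbb{O}$ is split.) (a) If $\dim A=1$ then $A=F$. (b) If $\dim A=2$ then one of the following holds: (i) $A$ is a separable quadratic extension field over $F$; (ii) $A$ is an inseparable quadratic extension field over $F$ (and $\mathrm{char}\,F=2$); (iii) $A\cong F[X]/(X^2-X)\cong F\times F$ is a split composition algebra; (iv) $A\cong F[X]/(X^2)$ is a local algebra. (c) If $\dim A=3$ then the radical $R:=A^\perp\cap A$ is not trivial, and one of the following occurs: (i) $\dim R=1$, and $A$ is in the $\mathrm{Aut}_F(\mathbb{O})$-orbit of the subalgebra $F+Fp_0+Fn_0$ of upper triangular matrices in $\mathbb{H}$; (ii) $\dim R\ge2$, and $A$ is in the orbit of the subalgebra $F+(Fp_0+Fn_0)w$. (d) If $\dim A=4$ then one of the following occurs: (i) $A$ is a quaternion algebra (split or not); (ii) $A$ is in the orbit of $B+(Fp_0+Fn_0)w$, where $B\subseteq\mathbb{H}$ is either a two-dimensional composition algebra, or an inseparable quadratic field extension of $F$; (iii) the radical $Q:=\{x\in A^\perp\cap A\mid N(x)=0\}$ of the restriction $N|_A$ of the quadratic form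 has dimension $3$; then $Q$ is isomorphic to the Heisenberg algebra, and $A$ is in the orbit of $F+(n_0\mathbb{O}\cap\mathbb{O}n_0)$; (iv) $A=A^\perp$ is a totally inseparable field extension of $F$ of degree $4$ and exponent $1$ (and $\mathrm{char}\,F=2$); two such subfields are in the same orbit under $\mathrm{Aut}_F(\mathbb{O})$ if, and only if, they are isomorphic as $F$-algebras. In each of these cases, subalgebras (containing $1$) are in the same orbit under $\mathrm{Aut}_F(\mathbb{O})$ precisely if they are isomorphic as $F$-algebras. Each subalgebra $A$ with $1\in A$ and $\dim A\le4$ is associative.
   Context: $F$ is an arbitrary field (any characteristic). A composition algebra over $F$ is a (not necessarily associative) $F$-algebra $C$ with neutral element $1$ and a quadratic form $N\colon C\to F$ (norm) with $N(xy)=N(x)N(y)$ whose polar form $(x|y)=N(x+y)-N(x)-N(y)$ is non-degenerate. $F$ is identified with $F1$. A composition algebra is split if some non-zero element has norm $0$. Octonion algebras are the composition algebras of dimension $8$, quaternion algebras those of dimension $4$ (split: isomorphic to $F^{2\times2}$; non-split: a skew field of dimension $4$ with center $F$). Orthogonality $\perp$ refers to the polar form. A subalgebra is an $F$-linear subspace closed under multiplication. $\mathrm{Aut}_F(\mathbb{O})$ is the group of $F$-linear algebra automorphisms; "orbit" means orbit under this group. The split octonion algebra is $\mathbb{O}=\mathbb{H}\oplus\mathbb{H}w$ with $\mathbb{H}=F^{2\times2}$, $\bar a$ the adjugate of $a\in\mathbb{H}$, multiplication $(a+xw)(b+yw)=(ab+\bar yx)+(ya+x\bar b)w$ and norm $N(a+xw)=\det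 a-\det x$. The Heisenberg algebra over $F$ is the $3$-dimensional algebra with basis $x,y,n$ such that $xy=n=-yx$ and all other products of basis elements are $0$. Exponent $1$ for a totally inseparable extension $K/F$ in characteristic $2$ means $x^2\in F$ for all $x\in K$. For $a\in\mathbb{O}$: $a\mathbb{O}=\{ax\mid x\in\mathbb{O}\}$, $\mathbb{O}a=\{xa\mid x\in\mathbb{O}\}$. *)

theory Defs
  imports "HOL-Analysis.Analysis" "HOL-Computational_Algebra.Polynomial"
begin

section \<open>Not necessarily associative algebras\<close>

text \<open>
  Addition is that of the ambient type. The operations are total functions on that type;
  predicates take the carrier as an additional set argument, so that subalgebras
  are handled with the operations of the surrounding algebra.
\<close>

record ('f, 'a) alg =
  scal :: "'f \<Rightarrow> 'a \<Rightarrow> 'a"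
  mul :: "'a \<Rightarrow> 'a \<Rightarrow> 'a"

record ('f, 'a) normed_alg = "('f, 'a) alg" +
  unity :: 'a
  nrm :: "'a \<Rightarrow> 'f"

definition subalgebra :: "('f::field, 'a::ab_group_add, 'm) alg_scheme \<Rightarrow> 'a set \<Rightarrow> bool" where
  "subalgebra C A \<longleftrightarrow>
     module.subspace (scal C) A \<and> (\<forall>x\<in>A. \<forall>y\<in>A. mul C x y \<in> A)"

definition algebra :: "('f::field, 'a::ab_group_add, 'm) alg_scheme \<Rightarrow> 'a set \<Rightarrow> bool" where
  "algebra C A \<longleftrightarrow>
     vector_space (scal C) \<and> subalgebra C A \<and>
     (\<forall>x\<in>A. \<forall>y\<in>A. \<forall>z\<in>A. mul C (x + y) z = mul C x z + mul C y z) \<and>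
     (\<forall>x\<in>A. \<forall>y\<in>A. \<forall>z\<in>A. mul C x (y + z) = mul C x y + mul C x z) \<and>
     (\<forall>c. \<forall>x\<in>A. \<forall>y\<in>A. mul C (scal C c x) y = scal C c (mul C x y)) \<and>
     (\<forall>c. \<forall>x\<in>A. \<forall>y\<in>A. mul C x (scal C c y) = scal C c (mul C x y))"

definition alg_dim :: "('f::field, 'a::ab_group_add, 'm) alg_scheme \<Rightarrow> 'a set \<Rightarrow> nat" where
  "alg_dim C A = vector_space.dim (scal C) A"

definition assoc_on :: "('f::field, 'a::ab_group_add, 'm) alg_scheme \<Rightarrow> 'a set \<Rightarrow> bool" where
  "assoc_on C A \<longleftrightarrow> (\<forall>x\<in>A. \<forall>y\<in>A. \<forall>z\<in>A. mul C (mul C x y) z = mul C x (mul C y z))"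

definition neutral_on :: "('f::field, 'a::ab_group_add) normed_alg \<Rightarrow> 'a set \<Rightarrow> bool" where
  "neutral_on C A \<longleftrightarrow>
     unity C \<in> A \<and> (\<forall>x\<in>A. mul C (unity C) x = x \<and> mul C x (unity C) = x)"

definition scalars :: "('f::field, 'a::ab_group_add) normed_alg \<Rightarrow> 'a set" where
  "scalars C = range (\<lambda>c. scal C c (unity C))"

definition alg_iso ::
  "('f::field, 'a::ab_group_add, 'm) alg_scheme \<Rightarrow> 'a set \<Rightarrow>
   ('f, 'b::ab_group_add, 'n) alg_scheme \<Rightarrow> 'b set \<Rightarrow> ('a \<Rightarrow> 'b) \<Rightarrow> bool" where
  "alg_iso C A D B f \<longleftrightarrow>
     algebra C A \<and> algebra D B \<and> bij_betw f A B \<and>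
     (\<forall>x\<in>A. \<forall>y\<in>A. f (x + y) = f x + f y) \<and>
     (\<forall>c. \<forall>x\<in>A. f (scal C c x) = scal D c (f x)) \<and>
     (\<forall>x\<in>A. \<forall>y\<in>A. f (mul C x y) = mul D (f x) (f y))"

definition alg_isomorphic ::
  "('f::field, 'a::ab_group_add, 'm) alg_scheme \<Rightarrow> 'a set \<Rightarrow>
   ('f, 'b::ab_group_add, 'n) alg_scheme \<Rightarrow> 'b set \<Rightarrow> bool" where
  "alg_isomorphic C A D B \<longleftrightarrow> (\<exists>f. alg_iso C A D B f)"

definition automorphisms :: "('f::field, 'a::ab_group_add, 'm) alg_scheme \<Rightarrow> ('a \<Rightarrow> 'a) set" where
  "automorphisms C = {f. alg_iso C UNIV C UNIV f}"

definition same_orbit ::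
  "('f::field, 'a::ab_group_add, 'm) alg_scheme \<Rightarrow> 'a set \<Rightarrow> 'a set \<Rightarrow> bool" where
  "same_orbit C A B \<longleftrightarrow> (\<exists>f\<in>automorphisms C. f ` A = B)"


section \<open>Composition algebras\<close>

definition polar :: "('f::field, 'a::ab_group_add) normed_alg \<Rightarrow> 'a \<Rightarrow> 'a \<Rightarrow> 'f" where
  "polar C x y = nrm C (x + y) - nrm C x - nrm C y"

text \<open>The polar form is symmetric by definition, so linearity in the first argument suffices.\<close>

definition quadratic_form_on :: "('f::field, 'a::ab_group_add) normed_alg \<Rightarrow> 'a set \<Rightarrow> bool" where
  "quadratic_form_on C A \<longleftrightarrow>
     (\<forall>c. \<forall>x\<in>A. nrm C (scal C c x) = c\<^sup>2 * nrm C x) \<and>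
     (\<forall>x\<in>A. \<forall>y\<in>A. \<forall>z\<in>A. polar C (x + y) z = polar C x z + polar C y z) \<and>
     (\<forall>c. \<forall>x\<in>A. \<forall>y\<in>A. polar C (scal C c x) y = c * polar C x y)"

definition composition_algebra :: "('f::field, 'a::ab_group_add) normed_alg \<Rightarrow> 'a set \<Rightarrow> bool" where
  "composition_algebra C A \<longleftrightarrow>
     algebra C A \<and> neutral_on C A \<and> quadratic_form_on C A \<and>
     (\<forall>x\<in>A. \<forall>y\<in>A. nrm C (mul C x y) = nrm C x * nrm C y) \<and>
     (\<forall>x\<in>A. (\<forall>y\<in>A. polar C x y = 0) \<longrightarrow> x = 0)"

definition split :: "('f::field, 'a::ab_group_add) normed_alg \<Rightarrow> 'a set \<Rightarrow> bool" where
  "split C A \<longleftrightarrow> (\<exists>x\<in>A. x \<noteq> 0 \<and> nrm C x = 0)"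

definition quaternion_algebra :: "('f::field, 'a::ab_group_add) normed_alg \<Rightarrow> 'a set \<Rightarrow> bool" where
  "quaternion_algebra C A \<longleftrightarrow> composition_algebra C A \<and> alg_dim C A = 4"

definition octonion_algebra :: "('f::field, 'a::ab_group_add) normed_alg \<Rightarrow> bool" where
  "octonion_algebra C \<longleftrightarrow> composition_algebra C UNIV \<and> alg_dim C UNIV = 8"

definition perp :: "('f::field, 'a::ab_group_add) normed_alg \<Rightarrow> 'a set \<Rightarrow> 'a set" where
  "perp C A = {x. \<forall>y\<in>A. polar C x y = 0}"

definition bilinear_radical :: "('f::field, 'a::ab_group_add) normed_alg \<Rightarrow> 'a set \<Rightarrow> 'a set" where
  "bilinear_radical C A = perp C A \<inter> A"

definition quadratic_radical :: "('f::field, 'a::ab_group_add) normed_alg \<Rightarrow> 'a set \<Rightarrow> 'a set" where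
  "quadratic_radical C A = {x \<in> perp C A \<inter> A. nrm C x = 0}"


section \<open>Field extensions and local algebras inside an algebra\<close>

definition field_extension :: "('f::field, 'a::ab_group_add) normed_alg \<Rightarrow> 'a set \<Rightarrow> bool" where
  "field_extension C K \<longleftrightarrow>
     algebra C K \<and> neutral_on C K \<and> unity C \<noteq> 0 \<and> assoc_on C K \<and>
     (\<forall>x\<in>K. \<forall>y\<in>K. mul C x y = mul C y x) \<and>
     (\<forall>x\<in>K. x \<noteq> 0 \<longrightarrow> (\<exists>y\<in>K. mul C x y = unity C))"

definition alg_pow :: "('f::field, 'a::ab_group_add) normed_alg \<Rightarrow> 'a \<Rightarrow> nat \<Rightarrow> 'a" where
  "alg_pow C x n = (mul C x ^^ n) (unity C)"

definition alg_eval :: "('f::field, 'a::ab_group_add) normed_alg \<Rightarrow> 'f poly \<Rightarrow> 'a \<Rightarrow> 'a" where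
  "alg_eval C p x = (\<Sum>i\<le>degree p. scal C (coeff p i) (alg_pow C x i))"

definition minimal_polynomial ::
  "('f::field, 'a::ab_group_add) normed_alg \<Rightarrow> 'a \<Rightarrow> 'f poly \<Rightarrow> bool" where
  "minimal_polynomial C x p \<longleftrightarrow>
     lead_coeff p = 1 \<and> alg_eval C p x = 0 \<and>
     (\<forall>q. q \<noteq> 0 \<and> alg_eval C q x = 0 \<longrightarrow> degree p \<le> degree q)"

definition separable_element :: "('f::field, 'a::ab_group_add) normed_alg \<Rightarrow> 'a \<Rightarrow> bool" where
  "separable_element C x \<longleftrightarrow> (\<exists>p. minimal_polynomial C x p \<and> coprime p (pderiv p))"

definition separable_extension :: "('f::field, 'a::ab_group_add) normed_alg \<Rightarrow> 'a set \<Rightarrow> bool" where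
  "separable_extension C K \<longleftrightarrow> field_extension C K \<and> (\<forall>x\<in>K. separable_element C x)"

definition inseparable_extension :: "('f::field, 'a::ab_group_add) normed_alg \<Rightarrow> 'a set \<Rightarrow> bool" where
  "inseparable_extension C K \<longleftrightarrow> field_extension C K \<and> \<not> (\<forall>x\<in>K. separable_element C x)"

definition totally_inseparable_extension ::
  "('f::field, 'a::ab_group_add) normed_alg \<Rightarrow> 'a set \<Rightarrow> bool" where
  "totally_inseparable_extension C K \<longleftrightarrow>
     field_extension C K \<and> (\<forall>x\<in>K - scalars C. \<not> separable_element C x)"

text \<open>Exponent at most 1, in characteristic 2.\<close>

definition exponent_one :: "('f::field, 'a::ab_group_add) normed_alg \<Rightarrow> 'a set \<Rightarrow> bool" where
  "exponent_one C K \<longleftrightarrow> (\<forall>x\<in>K. mul C x x \<in> scalars C)"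

definition left_ideal ::
  "('f::field, 'a::ab_group_add) normed_alg \<Rightarrow> 'a set \<Rightarrow> 'a set \<Rightarrow> bool" where
  "left_ideal C A I \<longleftrightarrow>
     I \<subseteq> A \<and> module.subspace (scal C) I \<and> (\<forall>a\<in>A. \<forall>x\<in>I. mul C a x \<in> I)"

definition maximal_left_ideal ::
  "('f::field, 'a::ab_group_add) normed_alg \<Rightarrow> 'a set \<Rightarrow> 'a set \<Rightarrow> bool" where
  "maximal_left_ideal C A M \<longleftrightarrow>
     left_ideal C A M \<and> M \<noteq> A \<and>
     (\<forall>I. left_ideal C A I \<and> M \<subseteq> I \<longrightarrow> I = M \<or> I = A)"

definition local_algebra :: "('f::field, 'a::ab_group_add) normed_alg \<Rightarrow> 'a set \<Rightarrow> bool" where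
  "local_algebra C A \<longleftrightarrow>
     algebra C A \<and> neutral_on C A \<and> assoc_on C A \<and> (\<exists>!M. maximal_left_ideal C A M)"


section \<open>Concrete algebras\<close>

text \<open>The quotient \<open>F[X]/(g)\<close> is realized on the canonical remainders modulo \<open>g\<close>.\<close>

definition quotient_alg :: "'f::field poly \<Rightarrow> ('f, 'f poly) alg" where
  "quotient_alg g = \<lparr>scal = smult, mul = (\<lambda>p q. (p * q) mod g)\<rparr>"

definition remainders :: "'f::field poly \<Rightarrow> 'f poly set" where
  "remainders g = range (\<lambda>p. p mod g)"

definition product_alg :: "('f::field, 'f \<times> 'f) alg" where
  "product_alg =
     \<lparr>scal = (\<lambda>c (a, b). (c * a, c * b)), mul = (\<lambda>(a, b) (a', b'). (a * a', b * b'))\<rparr>"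

text \<open>The triple \<open>(a, b, c)\<close> stands for \<open>a x + b y + c n\<close>, where \<open>x y = n = - y x\<close>.\<close>

definition heisenberg_alg :: "('f::field, 'f \<times> 'f \<times> 'f) alg" where
  "heisenberg_alg =
     \<lparr>scal = (\<lambda>c (x, y, z). (c * x, c * y, c * z)),
      mul = (\<lambda>(x, y, z) (x', y', z'). (0, 0, x * y' - y * x'))\<rparr>"

type_synonym 'f mat2 = "'f^2^2"

definition mat_scal :: "'f::field \<Rightarrow> 'f mat2 \<Rightarrow> 'f mat2" where
  "mat_scal c a = (\<chi> i j. c * a $ i $ j)"

definition adjugate :: "('f::field) mat2 \<Rightarrow> 'f mat2" where
  "adjugate a = vector [vector [a $ 2 $ 2, - a $ 1 $ 2], vector [- a $ 2 $ 1, a $ 1 $ 1]]"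

definition mat_alg :: "('f::field, 'f mat2) normed_alg" where
  "mat_alg = \<lparr>scal = mat_scal, mul = (**), unity = mat 1, nrm = det\<rparr>"

text \<open>The pair \<open>(a, x)\<close> stands for \<open>a + x w\<close>.\<close>

definition split_octonions :: "('f::field, 'f mat2 \<times> 'f mat2) normed_alg" where
  "split_octonions =
     \<lparr>scal = (\<lambda>c (a, x). (mat_scal c a, mat_scal c x)),
      mul = (\<lambda>(a, x) (b, y). (a ** b + adjugate y ** x, y ** a + x ** adjugate b)),
      unity = (mat 1, 0),
      nrm = (\<lambda>(a, x). det a - det x)\<rparr>"

definition p\<^sub>0 :: "('f::field) mat2" where
  "p\<^sub>0 = vector [vector [1, 0], vector [0, 0]]"

definition n\<^sub>0 :: "('f::field) mat2" where
  "n\<^sub>0 = vector [vector [0, 1], vector [0, 0]]"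

text \<open>\<open>F p\<^sub>0 + F n\<^sub>0\<close>\<close>

definition p0_n0_plane :: "(('f::field) mat2) set" where
  "p0_n0_plane = {mat_scal a p\<^sub>0 + mat_scal b n\<^sub>0 | a b. True}"

text \<open>\<open>F + F p\<^sub>0 + F n\<^sub>0\<close>\<close>

definition upper_triangular_model :: "(('f::field) mat2 \<times> 'f mat2) set" where
  "upper_triangular_model = {(mat c + x, 0) | c x. x \<in> p0_n0_plane}"

text \<open>\<open>B + (F p\<^sub>0 + F n\<^sub>0) w\<close>\<close>

definition plane_extension_model :: "(('f::field) mat2) set \<Rightarrow> ('f mat2 \<times> 'f mat2) set" where
  "plane_extension_model B = B \<times> p0_n0_plane"

text \<open>\<open>F + (n\<^sub>0 \<O> \<inter> \<O> n\<^sub>0)\<close>\<close>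

definition heisenberg_model :: "(('f::field) mat2 \<times> 'f mat2) set" where
  "heisenberg_model =
     {s + z | s z. s \<in> scalars split_octonions \<and>
        z \<in> range (\<lambda>u. mul split_octonions (n\<^sub>0, 0) u) \<inter> range (\<lambda>u. mul split_octonions u (n\<^sub>0, 0))}"

text \<open>An identification of the algebra with \<open>\<H> + \<H> w\<close>.\<close>

definition split_identification ::
  "('f::field, 'a::ab_group_add) normed_alg \<Rightarrow> ('f mat2 \<times> 'f mat2 \<Rightarrow> 'a) \<Rightarrow> bool" where
  "split_identification C \<phi> \<longleftrightarrow>
     alg_iso split_octonions UNIV C UNIV \<phi> \<and> (\<forall>u. nrm C (\<phi> u) = nrm split_octonions u)"

text \<open>The orbit does not depend on the identification, since any two of them differ by an
  automorphism; hence the universal quantifier.\<close>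

definition in_orbit_of_model ::
  "('f::field, 'a::ab_group_add) normed_alg \<Rightarrow> 'a set \<Rightarrow> ('f mat2 \<times> 'f mat2) set \<Rightarrow> bool" where
  "in_orbit_of_model C A S \<longleftrightarrow>
     split C UNIV \<and> (\<forall>\<phi>. split_identification C \<phi> \<longrightarrow> same_orbit C (\<phi> ` S) A)"

definition self_perp_inseparable_subfield ::
  "('f::field, 'a::ab_group_add) normed_alg \<Rightarrow> 'a set \<Rightarrow> bool" where
  "self_perp_inseparable_subfield C A \<longleftrightarrow>
     A = perp C A \<and> totally_inseparable_extension C A \<and> alg_dim C A = 4 \<and>
     exponent_one C A \<and> CHAR('f) = 2"

end

theory Submission
  imports Defs
begin

text \<open>
  An octonion algebra arises from a two-dimensional composition algebra \<open>F + F p\<close> by two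
  Cayley--Dickson doublings, with elements \<open>q\<close> and \<open>r\<close>; the multiplication depends only on the
  trace of \<open>p\<close> and the norms of \<open>p, q, r\<close>. So two such triples with the same invariants are
  related by an automorphism; if \<open>p\<close> is an idempotent and \<open>q, r\<close> have norm \<open>-1\<close>, then there
  is an isomorphism from the split model.
  For a subalgebra that contains non-zero elements of norm zero, generators can be written as products
  of the members of a triple with these special invariants, so that the subalgebra is the image of a
  fixed subalgebra of the model. For the others (composition algebras and inseparable fields) a
  triple is adapted to the subalgebra, and Witt's extension theorem, valid in every
  characteristic because the polar form is non-degenerate, provides a second triple with the same
  norms. An algebra isomorphism between unital subalgebras preserves trace and norm, since
  every element satisfies \<open>x\<^sup>2 - T(x) x + N(x) = 0\<close>, hence it carries adapted generators to
  adapted generators.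
\<close>

section \<open>Identities in octonion algebras\<close>

text \<open>In characteristic 2 the algebra is not the orthogonal sum of \<open>F\<close> and the
  trace-zero elements, since \<open>T e = 2\<close> vanishes. Hence the doublings cannot start from
  \<open>F\<close>: they start from a plane \<open>F + F p\<close> whose Gram determinant
  \<open>4 * N p - (T p)\<^sup>2\<close> is non-zero. The same obstacle recurs for subalgebras: a
  totally inseparable field is orthogonal to itself, so it contains no plane of this kind. The first
  member of its triple has to lie outside the field, with trace one and orthogonal to the other
  generators, and Witt's theorem must carry it along with the field. Nilpotent generators are
  treated without Witt's theorem. An idempotent \<open>p\<close> splits the orthogonal space of
  \<open>F + F p\<close> into two totally singular Peirce spaces that are dual under the polar form,
  so a generator in one of them has a partner in the other such that their sum has norm
  \<open>-1\<close>. The special invariants are those of \<open>p\<^sub>0\<close>, of the matrix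
  interchanging the two basis vectors, and of \<open>w\<close>.\<close>

locale octonion =
  fixes C :: "('f::field, 'a::ab_group_add) normed_alg"
  assumes octonion: "octonion_algebra C"
begin

abbreviation octonion_mul (infixl "\<cdot>" 70) where "x \<cdot> y \<equiv> mul C x y"
abbreviation octonion_scal (infixr "\<star>" 75) where "c \<star> x \<equiv> scal C c x"
abbreviation e where "e \<equiv> unity C"
abbreviation N where "N \<equiv> nrm C"
abbreviation b where "b \<equiv> polar C"
abbreviation T where "T x \<equiv> polar C x (unity C)"
abbreviation cj where "cj x \<equiv> scal C (polar C x (unity C)) (unity C) - x"

lemma vector_space_scal: "vector_space (scal C)"
  using octonion by (simp add: octonion_algebra_def composition_algebra_def algebra_def)

sublocale vs: vector_space "scal C" by (rule vector_space_scal)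

lemma dim_UNIV: "vs.dim UNIV = 8"
  using octonion by (simp add: octonion_algebra_def alg_dim_def)

lemma
  shows mul_add_left: "(x + y) \<cdot> z = x \<cdot> z + y \<cdot> z"
    and mul_add_right: "x \<cdot> (y + z) = x \<cdot> y + x \<cdot> z"
    and mul_scal_left: "(c \<star> x) \<cdot> y = c \<star> (x \<cdot> y)"
    and mul_scal_right: "x \<cdot> (c \<star> y) = c \<star> (x \<cdot> y)"
    and one_mul [simp]: "e \<cdot> x = x"
    and mul_one [simp]: "x \<cdot> e = x"
    and N_scal: "N (c \<star> x) = c\<^sup>2 * N x"
    and polar_add_left: "b (x + y) z = b x z + b y z"
    and polar_scal_left: "b (c \<star> x) y = c * b x y"
    and N_mul: "N (x \<cdot> y) = N x * N y"
    and nondegenerate: "(\<And>y. b x y = 0) \<Longrightarrow> x = 0"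
  using octonion by (simp_all add: octonion_algebra_def composition_algebra_def algebra_def
      neutral_on_def quadratic_form_on_def)

lemma polar_commute: "b x y = b y x"
  by (simp add: polar_def add.commute)

lemma polar_add_right: "b z (x + y) = b z x + b z y"
  by (metis polar_add_left polar_commute)

lemma polar_scal_right: "b x (c \<star> y) = c * b x y"
  by (metis polar_scal_left polar_commute)

lemma N_add: "N (x + y) = N x + N y + b x y"
  by (simp add: polar_def)

lemma polar_zero [simp]: "b 0 x = 0" "b x 0 = 0"
  using polar_scal_left[of 0 0 x] polar_scal_right[of x 0 0] by simp_all

lemma N_zero [simp]: "N 0 = 0"
  using N_scal[of 0 0] by simp

lemma mul_zero [simp]: "0 \<cdot> x = 0" "x \<cdot> 0 = 0"
  using mul_scal_left[of 0 0 x] mul_scal_right[of x 0 0] by simp_all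

lemma polar_minus [simp]: "b (- x) y = - b x y" "b x (- y) = - b x y"
  using polar_scal_left[of "-1" x y] polar_scal_right[of x "-1" y] by simp_all

lemma mul_minus [simp]: "(- x) \<cdot> y = - (x \<cdot> y)" "x \<cdot> (- y) = - (x \<cdot> y)"
  using mul_scal_left[of "-1" x y] mul_scal_right[of x "-1" y] by simp_all

lemma N_minus [simp]: "N (- x) = N x"
  using N_scal[of "-1" x] by simp

lemma polar_diff: "b (x - y) z = b x z - b y z" "b z (x - y) = b z x - b z y"
  using polar_add_left[of x "-y" z] polar_add_right[of z x "-y"] by simp_all

lemma mul_diff: "(x - y) \<cdot> z = x \<cdot> z - y \<cdot> z" "z \<cdot> (x - y) = z \<cdot> x - z \<cdot> y"
  using mul_add_left[of x "-y" z] mul_add_right[of z x "-y"] by simp_all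

lemma N_diff: "N (x - y) = N x + N y - b x y"
  using N_add[of x "-y"] by simp

lemmas mul_lin = mul_add_left mul_add_right mul_diff mul_scal_left mul_scal_right
lemmas polar_lin = polar_add_left polar_add_right polar_diff polar_scal_left polar_scal_right
lemmas vs_lin = vs.scale_left_distrib vs.scale_right_distrib
  vs.scale_left_diff_distrib vs.scale_right_diff_distrib

lemma N_add_scal: "N (x + c \<star> y) = N x + c\<^sup>2 * N y + c * b x y"
  by (simp add: N_add N_scal polar_lin)

lemma polar_self: "b x x = 2 * N x"
proof -
  have "N (2 \<star> x) = 4 * N x" by (simp add: N_scal)
  moreover have "2 \<star> x = x + x"
    using vs.scale_left_distrib[of 1 1 x] by simp
  ultimately show ?thesis by (simp add: N_add)
qed

lemma one_nonzero: "e \<noteq> 0"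
proof
  assume "e = 0"
  then have "x = 0" for x :: 'a using one_mul[of x] by simp
  then have "(UNIV::'a set) \<subseteq> vs.span {}" by auto
  then have "vs.dim UNIV \<le> card ({}::'a set)" by (intro vs.dim_le_card) auto
  then show False using dim_UNIV by simp
qed

text \<open>Multiplicativity gives \<open>N x = N e * N x\<close>, so the alternative would make the
  norm, hence the polar form, vanish identically.\<close>

lemma N_one [simp]: "N e = 1"
proof (rule ccontr)
  assume "N e \<noteq> 1"
  then have "N x = 0" for x using N_mul[of e x] by simp
  then have "b e y = 0" for y by (simp add: polar_def)
  then show False using nondegenerate[of e] one_nonzero by blast
qed

lemma T_one: "T e = 2"
  by (simp add: polar_self)

lemma nondegenerate_eq: "(\<And>z. b x z = b y z) \<Longrightarrow> x = y"
  using nondegenerate[of "x - y"] by (simp add: polar_diff)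

lemma polar_mul_left: "b (x \<cdot> y) (x \<cdot> z) = N x * b y z"
  using N_mul[of x "y + z"] by (simp add: mul_lin N_add N_mul algebra_simps)

lemma polar_mul_right: "b (x \<cdot> z) (y \<cdot> z) = b x y * N z"
  using N_mul[of "x + y" z] by (simp add: mul_lin N_add N_mul algebra_simps)

text \<open>The composition law linearized in both factors. Replacing one argument by
  \<open>e\<close> turns it into the adjoint formulas, from which the alternative laws
  follow.\<close>

lemma polar_mul_mul: "b (x \<cdot> y) (z \<cdot> w) + b (x \<cdot> w) (z \<cdot> y) = b x z * b y w"
  using polar_mul_left[of "x + z" y w]
  by (simp add: mul_lin polar_lin polar_mul_left N_add algebra_simps polar_commute)

lemma adjoint_left: "b (x \<cdot> y) z = b y (cj x \<cdot> z)"
  using polar_mul_mul[of x y e z]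
  by (simp add: mul_lin polar_lin algebra_simps polar_commute)

lemma adjoint_right: "b (y \<cdot> x) z = b y (z \<cdot> cj x)"
  using polar_mul_mul[of y x z e]
  by (simp add: mul_lin polar_lin algebra_simps polar_commute)

lemma adjoint_left': "b (cj x \<cdot> y) z = b y (x \<cdot> z)"
  using adjoint_left[of x y z] by (simp add: mul_lin polar_lin)

lemma adjoint_right': "b (y \<cdot> cj x) z = b y (z \<cdot> x)"
  using adjoint_right[of y x z] by (simp add: mul_lin polar_lin)

lemma cj_cj [simp]: "cj (cj x) = x"
  by (simp add: polar_lin polar_self vs_lin algebra_simps flip: vs.scale_scale)

text \<open>Moving \<open>cj x\<close> across the polar form reduces the claim to
  \<open>polar_mul_left\<close>; non-degeneracy then removes the test vector. This and its mirror
  image are the source of the alternative laws.\<close>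

lemma cj_mul_mul: "cj x \<cdot> (x \<cdot> y) = N x \<star> y"
proof (rule nondegenerate_eq)
  fix z show "b (cj x \<cdot> (x \<cdot> y)) z = b (N x \<star> y) z"
    unfolding adjoint_left' by (simp add: polar_mul_left polar_scal_left)
qed

lemma mul_mul_cj: "(y \<cdot> x) \<cdot> cj x = N x \<star> y"
proof (rule nondegenerate_eq)
  fix z show "b ((y \<cdot> x) \<cdot> cj x) z = b (N x \<star> y) z"
    unfolding adjoint_right' by (simp add: polar_mul_right polar_scal_left)
qed

lemma quadratic: "x \<cdot> x = T x \<star> x - N x \<star> e"
  using cj_mul_mul[of x e] by (simp add: mul_lin algebra_simps)

lemma left_alternative: "x \<cdot> (x \<cdot> y) = T x \<star> (x \<cdot> y) - N x \<star> y"
  using cj_mul_mul[of x y] by (simp add: mul_lin algebra_simps)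

lemma right_alternative: "(y \<cdot> x) \<cdot> x = T x \<star> (y \<cdot> x) - N x \<star> y"
  using mul_mul_cj[of y x] by (simp add: mul_lin algebra_simps)

lemma anticommutator: "x \<cdot> y + y \<cdot> x = T x \<star> y + T y \<star> x - b x y \<star> e"
  using quadratic[of "x + y"] quadratic[of x] quadratic[of y]
  by (simp add: mul_lin polar_lin vs_lin N_add algebra_simps)

lemma left_linearized: "x \<cdot> (y \<cdot> z) + y \<cdot> (x \<cdot> z) = (x \<cdot> y + y \<cdot> x) \<cdot> z"
proof -
  have "x \<cdot> (y \<cdot> z) + y \<cdot> (x \<cdot> z) = T x \<star> (y \<cdot> z) + T y \<star> (x \<cdot> z) - b x y \<star> z"
    using left_alternative[of "x + y" z] left_alternative[of x z] left_alternative[of y z]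
    by (simp add: mul_lin polar_lin vs_lin N_add algebra_simps)
  then show ?thesis by (simp add: anticommutator mul_lin)
qed

lemma right_linearized: "(z \<cdot> x) \<cdot> y + (z \<cdot> y) \<cdot> x = z \<cdot> (x \<cdot> y + y \<cdot> x)"
proof -
  have "(z \<cdot> x) \<cdot> y + (z \<cdot> y) \<cdot> x = T x \<star> (z \<cdot> y) + T y \<star> (z \<cdot> x) - b x y \<star> z"
    using right_alternative[of z "x + y"] right_alternative[of z x] right_alternative[of z y]
    by (simp add: mul_lin polar_lin vs_lin N_add algebra_simps)
  then show ?thesis by (simp add: anticommutator mul_lin)
qed

lemma mul_commute: "y \<cdot> x = T x \<star> y + T y \<star> x - b x y \<star> e - x \<cdot> y"
  using anticommutator[of x y] by (simp add: algebra_simps)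

lemma flexible: "(x \<cdot> y) \<cdot> x = x \<cdot> (y \<cdot> x)"
  using right_linearized[of x y x] left_alternative[of x y]
  by (simp add: quadratic mul_lin algebra_simps)

lemma T_mul: "T (x \<cdot> y) = T x * T y - b x y"
  using adjoint_left[of x y e] by (simp add: polar_lin algebra_simps polar_commute)

lemma cj_mul: "cj (x \<cdot> y) = cj y \<cdot> cj x"
  using anticommutator[of x y] unfolding T_mul
  by (simp add: mul_lin vs_lin algebra_simps)

lemma N_cj [simp]: "N (cj x) = N x"
  by (simp add: N_diff N_scal polar_lin polar_commute algebra_simps power2_eq_square)

text \<open>By \<open>mul_mul_cj\<close>, \<open>(x \<cdot> y) \<cdot> cj y = N y \<star> x\<close>.
  The typical use is to see that \<open>y - k \<star> e\<close> is singular when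
  \<open>x \<cdot> y = k \<star> x\<close>.\<close>

lemma mul_eq_0_N: assumes "x \<cdot> y = 0" "x \<noteq> 0" shows "N y = 0"
  using mul_mul_cj[of x y] assms by simp

text \<open>The instance of Artin's theorem that concerns \<open>x\<close>, \<open>y\<close> and
  their product; the remaining ones follow from the alternation of the associator.\<close>

lemma artin: "x \<cdot> (y \<cdot> (x \<cdot> y)) = (x \<cdot> y) \<cdot> (x \<cdot> y)"
proof -
  \<comment> \<open>The right-hand side is
    \<open>T (x \<cdot> y) \<star> y - N y \<star> cj x\<close>; multiplied by \<open>x\<close> it
    gives the quadratic equation of \<open>x \<cdot> y\<close>.\<close>
  have 1: "y \<cdot> (x \<cdot> y) = (T x * T y - b x y) \<star> y - N y \<star> cj x"
    using left_alternative[of y x]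
    by (simp add: mul_commute[of y x] mul_lin quadratic vs_lin algebra_simps polar_commute)
  show ?thesis
    unfolding 1 quadratic[of "x \<cdot> y"]
    by (simp add: mul_lin T_mul N_mul quadratic vs_lin algebra_simps)
qed

end

section \<open>Witt's extension theorem\<close>

context octonion
begin

text \<open>The locale of finite-dimensional vector spaces takes a basis as a parameter, so one has
  to be fixed as a term.\<close>

definition some_basis :: "'a set" where
  "some_basis = (SOME B. finite B \<and> vs.independent B \<and> vs.span B = UNIV)"

lemma some_basis: "finite some_basis \<and> vs.independent some_basis \<and> vs.span some_basis = UNIV"
proof -
  obtain B where B: "vs.independent B" "UNIV \<subseteq> vs.span B" "card B = vs.dim UNIV"
    by (rule vs.basis_exists[of UNIV])
  then have "finite B" using dim_UNIV by (auto intro: card_ge_0_finite)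
  with B have "\<exists>B. finite B \<and> vs.independent B \<and> vs.span B = UNIV" by blast
  then show ?thesis unfolding some_basis_def by (rule someI_ex)
qed

sublocale fd: finite_dimensional_vector_space "scal C" some_basis
proof unfold_locales
  show "finite some_basis" "vs.independent some_basis" "vs.span some_basis = UNIV"
    using some_basis by blast+
qed

lemma extend_to_basis:
  assumes "vs.independent S"
  obtains E where "S \<subseteq> E" "finite E" "vs.independent E" "vs.span E = UNIV"
proof -
  obtain E where E: "S \<subseteq> E" "vs.independent E" "UNIV \<subseteq> vs.span E"
    by (rule vs.maximal_independent_subset_extend[OF subset_UNIV assms])
  then show ?thesis using fd.finiteI_independent[of E] by (intro that[of E]) auto
qed

lemma linearI:
  assumes "\<And>x y. f (x + y) = f x + f y" "\<And>c x. f (c \<star> x) = c \<star> f x"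
  shows "Vector_Spaces.linear (scal C) (scal C) f"
  using assms by (intro Vector_Spaces.linear.intro module_hom.intro module_hom_axioms.intro
      vs.vector_space_axioms vs.module_axioms)

text \<open>Evaluation of the polar form on \<open>E\<close>, with the values stored as coefficients
  of \<open>E\<close> itself. For a basis \<open>E\<close> this presents the map from the space to
  its dual as an endomorphism, so that injectivity yields surjectivity.\<close>

definition coords :: "'a set \<Rightarrow> 'a \<Rightarrow> 'a" where
  "coords E y = (\<Sum>x\<in>E. b x y \<star> x)"

lemma linear_coords: "Vector_Spaces.linear (scal C) (scal C) (coords E)"
  by (rule linearI) (simp_all add: coords_def polar_lin vs_lin sum.distrib vs.scale_sum_right)

lemma perp_span: "x \<in> vs.span E \<Longrightarrow> (\<And>z. z \<in> E \<Longrightarrow> b z y = 0) \<Longrightarrow> b x y = 0"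
  by (induction rule: vs.span_induct_alt) (auto simp: polar_lin)

lemma inj_coords:
  assumes "vs.independent E" "vs.span E = UNIV"
  shows "inj (coords E)"
proof -
  interpret l: Vector_Spaces.linear "scal C" "scal C" "coords E" by (rule linear_coords)
  show ?thesis unfolding l.inj_iff_eq_0
  proof (intro allI impI)
    fix y assume y: "coords E y = 0"
    have "b x y = 0" if "x \<in> E" for x
      using vs.independentD[OF assms(1) fd.finiteI_independent[OF assms(1)] subset_refl _ that,
          of "\<lambda>x. b x y"] y unfolding coords_def by simp
    then have "b x y = 0" for x using perp_span[of x E y] assms(2) by auto
    then show "y = 0" using nondegenerate[of y] polar_commute by metis
  qed
qed

lemma subspace_perp: "vs.subspace (perp C A)"
  by (auto simp: vs.subspace_def perp_def polar_lin)

text \<open>Extend \<open>w\<close> and a basis of \<open>W\<close> to a basis of the space. By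
  surjectivity of \<open>coords\<close> the functional that is 1 at \<open>w\<close> and 0 at the
  other basis vectors is represented by some \<open>y\<close>.\<close>

lemma separation:
  assumes W: "vs.subspace W" and w: "w \<notin> W"
  obtains y where "b y w = 1" "\<And>x. x \<in> W \<Longrightarrow> b y x = 0"
proof -
  obtain S where S: "S \<subseteq> W" "vs.independent S" "W \<subseteq> vs.span S"
    by (rule vs.basis_exists[of W])
  have spS: "vs.span S = W" using vs.span_minimal[OF S(1) W] S(3) by blast
  have "vs.independent (insert w S)" using S w spS by (simp add: vs.independent_insertI)
  then obtain E where E: "insert w S \<subseteq> E" "vs.independent E" "vs.span E = UNIV" and fin: "finite E"
    by (metis extend_to_basis)
  have "surj (coords E)" using fd.linear_inj_imp_surj[OF linear_coords inj_coords] E by auto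
  then obtain y where y: "coords E y = w" by (metis surjD)
  have "(\<Sum>x\<in>E. (b x y - (if x = w then 1 else 0)) \<star> x) = coords E y - (\<Sum>x\<in>E. (if x = w then 1 else 0) \<star> x)"
    by (simp add: coords_def vs_lin sum_subtractf)
  also have "(\<Sum>x\<in>E. (if x = w then 1 else 0) \<star> x) = (\<Sum>x\<in>E. if x = w then x else 0)"
    by (intro sum.cong) auto
  also have "\<dots> = w" using fin E by simp
  finally have "(\<Sum>x\<in>E. (b x y - (if x = w then 1 else 0)) \<star> x) = 0" using y by simp
  then have 1: "b x y - (if x = w then 1 else 0) = 0" if "x \<in> E" for x
    using vs.independentD[OF E(2) fin subset_refl _ that, of "\<lambda>x. b x y - (if x = w then 1 else 0)"]
    by blast
  show ?thesis
  proof
    show "b y w = 1" using 1[of w] E(1) unfolding polar_commute[of y w] by simp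
    have wS: "w \<notin> S" using S(1) w by auto
    have "b z y = 0" if "z \<in> S" for z
      using 1[of z] E(1) wS that by (simp add: subset_eq split: if_splits)
    then show "b y x = 0" if "x \<in> W" for x
      using perp_span[of x S y] spS that unfolding polar_commute[of y x] by simp
  qed
qed

text \<open>For \<open>y\<close> orthogonal to \<open>A\<close>, the coefficients of
  \<open>coords E y\<close> on the basis \<open>S\<close> of \<open>A\<close> vanish, so the
  injective map \<open>coords E\<close> sends \<open>perp C A\<close> into the span of
  \<open>E - S\<close>.\<close>

lemma dim_perp_le:
  shows "vs.dim (perp C A) + vs.dim A \<le> 8"
proof -
  obtain S where S: "S \<subseteq> A" "vs.independent S" "A \<subseteq> vs.span S" "card S = vs.dim A"
    by (rule vs.basis_exists[of A])
  obtain E where E: "S \<subseteq> E" "vs.independent E" "vs.span E = UNIV" and fin: "finite E"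
    using S(2) by (metis extend_to_basis)
  interpret fp: finite_dimensional_vector_space_pair_1 "scal C" some_basis "scal C" by unfold_locales
  have "coords E y \<in> vs.span (E - S)" if "y \<in> perp C A" for y
  proof -
    have "coords E y = (\<Sum>x\<in>E - S. b x y \<star> x)"
      unfolding coords_def using fin that S
      by (intro sum.mono_neutral_right) (auto simp: perp_def polar_commute)
    also have "\<dots> \<in> vs.span (E - S)" by (intro vs.span_sum vs.span_scale vs.span_base)
    finally show ?thesis .
  qed
  then have "vs.dim (coords E ` perp C A) \<le> card (E - S)"
    using fin by (intro vs.dim_le_card) auto
  moreover have "vs.dim (coords E ` perp C A) = vs.dim (perp C A)"
    by (rule fp.dim_image_eq[OF linear_coords]) (use inj_coords[of E] E in \<open>auto intro: inj_on_subset\<close>)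
  moreover have "card E = 8"
    using vs.dim_eq_card[of E UNIV] E dim_UNIV by simp
  ultimately show ?thesis
    using card_Diff_subset[of S E] fin E S card_mono[of E S] finite_subset[of S E] by simp
qed

definition isometry :: "('a \<Rightarrow> 'a) \<Rightarrow> bool" where
  "isometry g \<longleftrightarrow> Vector_Spaces.linear (scal C) (scal C) g \<and> (\<forall>x. N (g x) = N x)"

lemma
  assumes "isometry g"
  shows isometry_add: "g (x + y) = g x + g y"
    and isometry_scal: "g (c \<star> x) = c \<star> g x"
    and isometry_N: "N (g x) = N x"
    and isometry_polar: "b (g x) (g y) = b x y"
proof -
  interpret l: Vector_Spaces.linear "scal C" "scal C" g using assms by (simp add: isometry_def)
  show "g (x + y) = g x + g y" "g (c \<star> x) = c \<star> g x" by (simp_all add: l.add l.scale)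
  show N: "N (g x) = N x" for x using assms by (simp add: isometry_def)
  show "b (g x) (g y) = b x y" using N[of "x + y"] N[of x] N[of y] by (simp add: l.add N_add)
qed

lemma isometryI:
  assumes "\<And>x y. g (x + y) = g x + g y" "\<And>c x. g (c \<star> x) = c \<star> g x" "\<And>x. N (g x) = N x"
  shows "isometry g"
  unfolding isometry_def using linearI[of g] assms by auto

lemma isometry_compose: "isometry g \<Longrightarrow> isometry h \<Longrightarrow> isometry (g \<circ> h)"
  by (intro isometryI) (simp_all add: isometry_add isometry_scal isometry_N)

lemma isometry_bij: assumes "isometry g" shows "bij g"
proof -
  interpret l: Vector_Spaces.linear "scal C" "scal C" g using assms by (simp add: isometry_def)
  have "inj g" unfolding l.inj_iff_eq_0
  proof (intro allI impI)
    fix x assume "g x = 0"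
    then have "b x y = 0" for y using isometry_polar[OF assms, of x y] by simp
    then show "x = 0" by (rule nondegenerate)
  qed
  then show ?thesis
    using fd.linear_inj_imp_surj[of g] assms by (auto simp: isometry_def bij_def)
qed

lemma isometry_inv: assumes g: "isometry g" shows "isometry (inv g)"
proof (rule isometryI)
  have [simp]: "g (inv g x) = x" for x using isometry_bij[OF g] by (simp add: bij_def surj_f_inv_f)
  have [simp]: "inv g (g x) = x" for x using isometry_bij[OF g] by (simp add: bij_def)
  show "inv g (x + y) = inv g x + inv g y" for x y
    using isometry_add[OF g, of "inv g x" "inv g y"] by (metis \<open>\<And>x. g (inv g x) = x\<close> \<open>\<And>x. inv g (g x) = x\<close>)
  show "inv g (c \<star> x) = c \<star> inv g x" for c x
    using isometry_scal[OF g, of c "inv g x"] by (metis \<open>\<And>x. g (inv g x) = x\<close> \<open>\<And>x. inv g (g x) = x\<close>)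
  show "N (inv g x) = N x" for x using isometry_N[OF g, of "inv g x"] by simp
qed

text \<open>The difference \<open>d = u' - u\<close> is orthogonal to \<open>W\<close>. If
  \<open>d\<close> is anisotropic, a reflection works in every characteristic; if it is singular,
  the shape of the isometry depends on whether \<open>u\<close> lies in
  \<open>W + F d\<close>.\<close>

lemma witt_step:
  assumes W: "vs.subspace W" and u: "u \<notin> W" and u': "u' \<notin> W"
    and N: "N u' = N u" and b: "\<And>w. w \<in> W \<Longrightarrow> b u' w = b u w"
  obtains s where "isometry s" "\<And>w. w \<in> W \<Longrightarrow> s w = w" "s u = u'"
proof -
  define d where "d = u' - u"
  have ud: "u' = u + d" by (simp add: d_def)
  have dW: "b d w = 0" "b w d = 0" if "w \<in> W" for w
    using b[OF that] polar_commute[of w d] by (simp_all add: d_def polar_lin)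
  \<comment> \<open>This is the equality of the norms of \<open>u\<close> and
    \<open>u + d\<close>.\<close>
  have bud: "b u d = - N d" using N unfolding eq_neg_iff_add_eq_0 by (simp add: ud N_add polar_commute[of d u] algebra_simps)
  consider "N d \<noteq> 0" | "N d = 0" "u \<notin> vs.span (insert d W)" | "N d = 0" "u \<in> vs.span (insert d W)"
    by blast
  then show ?thesis
  proof cases
    case 1
    \<comment> \<open>reflection in \<open>d\<close>\<close>
    define s where "s x = x - (b x d / N d) \<star> d" for x
    have "isometry s"
    proof (rule isometryI)
      show "N (s x) = N x" for x using 1
        by (simp add: s_def polar_lin N_diff N_scal field_simps power2_eq_square)
    qed (simp_all add: s_def polar_lin vs_lin add_divide_distrib)
    moreover have "s w = w" if "w \<in> W" for w using dW[OF that] by (simp add: s_def)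
    moreover have "s u = u'" using 1 bud by (simp add: s_def ud)
    ultimately show ?thesis by (rule that)
  next
    case 2
    obtain y where y: "b y u = 1" "\<And>x. x \<in> vs.span (insert d W) \<Longrightarrow> b y x = 0"
      using separation[OF vs.subspace_span 2(2)] by auto
    \<comment> \<open>Eichler (Siegel) transformation\<close>
    define s where "s x = x - b x d \<star> y + b x y \<star> d - (N y * b x d) \<star> d" for x
    have dy: "b d y = 0" "b y d = 0" using y(2)[of d] by (auto simp: vs.span_base polar_commute)
    have dd: "b d d = 0" using 2 by (simp add: polar_self)
    have "isometry s"
    proof (rule isometryI)
      fix x
      show "N (s x) = N x" unfolding s_def
        by (simp add: polar_lin vs_lin N_diff N_add N_scal 2 dy dd algebra_simps power2_eq_square
            polar_commute[of y x] polar_commute[of d x])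
    qed (simp_all add: s_def polar_lin vs_lin algebra_simps)
    moreover have "s w = w" if "w \<in> W" for w
      using dW[OF that] y(2)[of w] that by (simp add: s_def vs.span_base polar_commute[of w y])
    moreover have "s u = u'" using bud 2 y by (simp add: s_def ud polar_commute[of u y])
    ultimately show ?thesis by (rule that)
  next
    case 3
    \<comment> \<open>Here every vector orthogonal to \<open>W\<close> and \<open>d\<close> is
      orthogonal to \<open>u\<close> as well, which rules out a transformation as in the previous
      case; instead \<open>d\<close> itself gets rescaled.\<close>
    obtain t where t: "u - t \<star> d \<in> W"
      using 3(2) vs.span_eq_iff[THEN iffD2, OF W] unfolding vs.span_breakdown_eq by auto
    have t0: "t \<noteq> 0" using t u by auto
    have dW': "d \<notin> W"
    proof
      assume "d \<in> W"
      then have "(u - t \<star> d) + t \<star> d \<in> W" using t W by (intro vs.subspace_add vs.subspace_scale)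
      with u show False by simp
    qed
    \<comment> \<open>\<open>t = -1\<close> would put \<open>u + d = u'\<close> into
      \<open>W\<close>.\<close>
    have t1: "1 + t \<noteq> 0"
    proof
      assume "1 + t = 0"
      then have "t = -1" by (simp add: eq_neg_iff_add_eq_0 add.commute)
      then show False using t u' by (simp add: ud)
    qed
    obtain y0 where y0: "b y0 d = 1" "\<And>x. x \<in> W \<Longrightarrow> b y0 x = 0" using separation[OF W dW'] by auto
    \<comment> \<open>Since \<open>d\<close> is singular and \<open>b y0 d = 1\<close>, this
      correction makes \<open>y\<close> singular as well.\<close>
    define y where "y = y0 - N y0 \<star> d"
    have dd: "b d d = 0" using 3 by (simp add: polar_self)
    have yd: "b y d = 1" "b d y = 1" using y0 dd by (simp_all add: y_def polar_lin polar_commute[of d y0])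
    have Ny: "N y = 0" using y0 3 by (simp add: y_def N_diff N_scal polar_lin)
    have yW: "b w y = 0" if "w \<in> W" for w
      using y0(2)[OF that] dW[OF that] by (simp add: y_def polar_lin polar_commute[of w y0])
    \<comment> \<open>The factor is forced: the isometry is to fix \<open>u - t \<star> d\<close>
      and to multiply \<open>d\<close> by \<open>r\<close>, so it sends \<open>u\<close> to
      \<open>u + d\<close> exactly if \<open>t * r = t + 1\<close>.\<close>
    define r where "r = 1 + 1 / t"
    have r0: "r \<noteq> 0" and rt: "t * r = t + 1" using t0 t1 by (simp_all add: r_def field_simps)
    \<comment> \<open>multiplication by \<open>r\<close> and \<open>1 / r\<close> in the hyperbolic plane \<open>F d + F y\<close>\<close>
    define s where "s x = x + (b x y * (r - 1)) \<star> d + (b x d * (1 / r - 1)) \<star> y" for x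
    have "isometry s"
    proof (rule isometryI)
      fix x
      show "N (s x) = N x" unfolding s_def using r0
        by (simp add: polar_lin vs_lin N_diff N_add N_scal 3(1) Ny yd dd field_simps power2_eq_square
            polar_commute[of y x] polar_commute[of d x])
    qed (simp_all add: s_def polar_lin vs_lin algebra_simps)
    moreover have sW: "s w = w" if "w \<in> W" for w
      using dW[OF that] yW[OF that] by (simp add: s_def)
    moreover have "s u = u'"
    proof -
      have sd: "s d = r \<star> d" using yd dd by (simp add: s_def vs_lin)
      have "s u = s (u - t \<star> d) + t \<star> s d"
        using isometry_add[OF \<open>isometry s\<close>, of "u - t \<star> d" "t \<star> d"] isometry_scal[OF \<open>isometry s\<close>] by simp
      also have "\<dots> = u - t \<star> d + (t * r) \<star> d" using sW[OF t] sd by simp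
      also have "\<dots> = u'" by (simp add: rt ud vs_lin)
      finally show ?thesis .
    qed
    ultimately show ?thesis by (rule that)
  qed
qed

text \<open>Induction over the basis. The isometry \<open>g\<close> obtained for \<open>S\<close>
  replaces \<open>f u\<close> by \<open>inv g (f u)\<close>, so that \<open>witt_step\<close> only
  has to move \<open>u\<close> while fixing the span of \<open>S\<close> pointwise.\<close>

theorem witt_extension:
  assumes "finite S" "vs.independent S" "Vector_Spaces.linear (scal C) (scal C) f"
    "inj_on f (vs.span S)" "\<And>x. x \<in> vs.span S \<Longrightarrow> N (f x) = N x"
  shows "\<exists>g. isometry g \<and> (\<forall>x\<in>vs.span S. g x = f x)"
  using assms
proof (induction S rule: finite_induct)
  case empty
  interpret l: Vector_Spaces.linear "scal C" "scal C" f by fact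
  have "isometry (\<lambda>x. x)" by (rule isometryI) auto
  then show ?case by (auto simp: l.zero)
next
  case (insert u S)
  interpret l: Vector_Spaces.linear "scal C" "scal C" f by fact
  let ?W = "vs.span S"
  have sub: "?W \<subseteq> vs.span (insert u S)" by (rule vs.span_mono) auto
  have uin: "u \<in> vs.span (insert u S)" by (simp add: vs.span_base)
  have u: "u \<notin> ?W" and indS: "vs.independent S"
    using insert.prems(1) insert.hyps by (simp_all add: vs.independent_insert)
  obtain g where g: "isometry g" "\<And>x. x \<in> ?W \<Longrightarrow> g x = f x"
    using insert.IH[OF indS insert.prems(2)] insert.prems(3,4) sub by (meson inj_on_subset subsetD)
  have gi: "inv g (g x) = x" "g (inv g x) = x" for x
    using isometry_bij[OF g(1)] by (simp_all add: bij_def surj_f_inv_f)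
  note ig = isometry_inv[OF g(1)]
  have bf: "b (f x) (f y) = b x y" if "x \<in> vs.span (insert u S)" "y \<in> vs.span (insert u S)" for x y
    using insert.prems(4)[of "x + y"] insert.prems(4)[of x] insert.prems(4)[of y] that
    by (simp add: l.add N_add vs.span_add)
  define u' where "u' = inv g (f u)"
  have u': "u' \<notin> ?W"
  proof
    assume "u' \<in> ?W"
    then have "f u' = f u" using g(2)[of u'] by (simp add: u'_def gi)
    then have "u' = u" using insert.prems(3) \<open>u' \<in> ?W\<close> sub uin by (auto dest: inj_onD)
    then show False using u \<open>u' \<in> ?W\<close> by simp
  qed
  have "N u' = N u" using isometry_N[OF ig] insert.prems(4)[OF uin] by (simp add: u'_def)
  moreover have "b u' w = b u w" if "w \<in> ?W" for w
    using isometry_polar[OF g(1), of u' w] g(2)[OF that] bf[OF uin, of w] that sub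
    by (auto simp: u'_def gi)
  ultimately obtain s where s: "isometry s" "\<And>w. w \<in> ?W \<Longrightarrow> s w = w" "s u = u'"
    using witt_step[OF vs.subspace_span u u'] by metis
  have "(g \<circ> s) x = f x" if "x \<in> vs.span (insert u S)" for x
  proof -
    obtain k where k: "x - k \<star> u \<in> ?W" using \<open>x \<in> _\<close> vs.span_breakdown_eq by auto
    have "(g \<circ> s) x = g (s (x - k \<star> u)) + k \<star> g (s u)"
      using isometry_add[OF isometry_compose[OF g(1) s(1)], of "x - k \<star> u" "k \<star> u"]
      by (simp add: isometry_scal[OF s(1)] isometry_scal[OF g(1)])
    also have "\<dots> = f (x - k \<star> u) + k \<star> f u" using s k g(2) by (simp add: u'_def gi)
    also have "\<dots> = f x" using l.add[of "x - k \<star> u" "k \<star> u"] by (simp add: l.scale)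
    finally show ?thesis .
  qed
  then show ?case using isometry_compose[OF g(1) s(1)] by blast
qed

end

section \<open>Cayley--Dickson doubling\<close>

definition double :: "('f::field, 'a::ab_group_add) normed_alg \<Rightarrow> 'a set \<Rightarrow> 'a \<Rightarrow> 'a set" where
  "double C B v = {x + mul C y v | x y. x \<in> B \<and> y \<in> B}"

definition generated_line :: "('f::field, 'a::ab_group_add) normed_alg \<Rightarrow> 'a \<Rightarrow> 'a set" where
  "generated_line C a = {scal C s (unity C) + scal C t a | s t. True}"

definition nonsingular_subalgebra :: "('f::field, 'a::ab_group_add) normed_alg \<Rightarrow> 'a set \<Rightarrow> bool" where
  "nonsingular_subalgebra C B \<longleftrightarrow>
     subalgebra C B \<and> unity C \<in> B \<and> (\<forall>x\<in>B. (\<forall>y\<in>B. polar C x y = 0) \<longrightarrow> x = 0)"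

text \<open>The first condition says that the Gram matrix of \<open>1, p\<close> for the polar form
  is invertible, in any characteristic; \<open>q\<close> and \<open>r\<close> drive the two
  doublings.\<close>

definition cayley_triple :: "('f::field, 'a::ab_group_add) normed_alg \<Rightarrow> 'a \<Rightarrow> 'a \<Rightarrow> 'a \<Rightarrow> bool" where
  "cayley_triple C p q r \<longleftrightarrow>
     4 * nrm C p \<noteq> (polar C p (unity C))\<^sup>2 \<and>
     q \<in> perp C (generated_line C p) \<and> nrm C q \<noteq> 0 \<and>
     r \<in> perp C (double C (generated_line C p) q) \<and> nrm C r \<noteq> 0"

context octonion
begin

lemma cj_linearized: "cj x \<cdot> (y \<cdot> z) + cj y \<cdot> (x \<cdot> z) = b x y \<star> z"
  using cj_mul_mul[of "x + y" z] cj_mul_mul[of x z] cj_mul_mul[of y z]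
  by (simp add: mul_lin polar_lin vs_lin N_add algebra_simps)

lemma cj_linearized': "(z \<cdot> y) \<cdot> cj x + (z \<cdot> x) \<cdot> cj y = b x y \<star> z"
  using mul_mul_cj[of z "x + y"] mul_mul_cj[of z x] mul_mul_cj[of z y]
  by (simp add: mul_lin polar_lin vs_lin N_add algebra_simps)

section \<open>Multiplication with a vector orthogonal to a unital subalgebra\<close>

lemma perp_commute: assumes "T v = 0" "b v y = 0" shows "v \<cdot> y = cj y \<cdot> v"
  using mul_commute[of v y] assms by (simp add: mul_lin polar_commute)

text \<open>Trace zero means \<open>cj v = - v\<close>, so \<open>cj_linearized\<close> with
  vanishing polar form becomes a commutation rule.\<close>

lemma perp_left_swap: assumes "T v = 0" "b v a = 0" shows "a \<cdot> (v \<cdot> z) = v \<cdot> (cj a \<cdot> z)"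
proof -
  have "b (cj a) v = 0" using assms by (simp add: polar_lin polar_commute)
  then show ?thesis
    using cj_linearized[of "cj a" v z] assms(1) unfolding cj_cj by simp
qed

text \<open>\<open>v\<close> is moved to the left, past \<open>a\<close>, and back; each passage
  conjugates, and the conjugates recombine in reversed order by \<open>cj_mul\<close>. Together with
  the next two lemmas this gives the Cayley--Dickson product.\<close>

lemma double_left:
  assumes "T v = 0" "b v a = 0" "b v y = 0" "b v (y \<cdot> a) = 0"
  shows "a \<cdot> (y \<cdot> v) = (y \<cdot> a) \<cdot> v"
proof -
  have "b v (cj y) = 0" "b v (cj a) = 0" using assms by (simp_all add: polar_lin)
  then have "y \<cdot> v = v \<cdot> cj y" using perp_commute[OF assms(1), of "cj y"] by (simp only: cj_cj)
  then have "a \<cdot> (y \<cdot> v) = v \<cdot> (cj a \<cdot> cj y)"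
    using perp_left_swap[of v a "cj y"] assms by simp
  also have "\<dots> = v \<cdot> cj (y \<cdot> a)" by (simp only: cj_mul)
  also have "\<dots> = cj (cj (y \<cdot> a)) \<cdot> v"
    using assms by (intro perp_commute) (simp_all add: polar_lin)
  finally show ?thesis by (simp only: cj_cj)
qed

lemma double_right:
  assumes "T v = 0" "b v a = 0" shows "(x \<cdot> v) \<cdot> a = (x \<cdot> cj a) \<cdot> v"
proof -
  have "b (cj a) v = 0" using assms by (simp add: polar_lin polar_commute)
  then show ?thesis
    using cj_linearized'[of x v "cj a"] assms(1) unfolding cj_cj by simp
qed

lemma double_both:
  assumes "T v = 0" "b v x = 0" "b v (cj x \<cdot> y) = 0"
  shows "(x \<cdot> v) \<cdot> (y \<cdot> v) = - (N v \<star> (cj y \<cdot> x))"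
proof -
  have 1: "T (x \<cdot> v) = 0" using T_mul[of x v] assms polar_commute[of x v] by simp
  have 2: "b (x \<cdot> v) y = 0" using assms by (simp add: adjoint_left)
  have "b (x \<cdot> v) (cj y) = 0" using 1 2 by (simp add: polar_lin)
  then have "cj y \<cdot> ((x \<cdot> v) \<cdot> v) = (x \<cdot> v) \<cdot> (cj (cj y) \<cdot> v)"
    by (rule perp_left_swap[OF 1])
  then show ?thesis using right_alternative[of x v] assms unfolding cj_cj by (simp add: mul_lin)
qed

lemma subalgebraD:
  assumes "subalgebra C A"
  shows "\<And>x y. x \<in> A \<Longrightarrow> y \<in> A \<Longrightarrow> x \<cdot> y \<in> A" "0 \<in> A"
    "\<And>x y. x \<in> A \<Longrightarrow> y \<in> A \<Longrightarrow> x + y \<in> A" "\<And>x y. x \<in> A \<Longrightarrow> y \<in> A \<Longrightarrow> x - y \<in> A"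
    "\<And>c x. x \<in> A \<Longrightarrow> c \<star> x \<in> A" "\<And>x. x \<in> A \<Longrightarrow> - x \<in> A" "vs.subspace A"
  using assms by (auto simp: subalgebra_def vs.subspace_0 vs.subspace_add vs.subspace_diff
      vs.subspace_scale vs.subspace_neg)

lemma cj_closed: "subalgebra C A \<Longrightarrow> e \<in> A \<Longrightarrow> x \<in> A \<Longrightarrow> cj x \<in> A"
  by (simp add: subalgebraD)

context
  fixes B v
  assumes B: "subalgebra C B" "e \<in> B" and v: "v \<in> perp C B"
begin

lemma v_perp: "x \<in> B \<Longrightarrow> b v x = 0" "x \<in> B \<Longrightarrow> b x v = 0"
  using v by (auto simp: perp_def polar_commute)

text \<open>For \<open>N v = - 1\<close> this is the multiplication rule of
  \<open>split_octonions\<close>.\<close>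

lemma double_mul:
  assumes "x \<in> B" "y \<in> B" "x' \<in> B" "y' \<in> B"
  shows "(x + y \<cdot> v) \<cdot> (x' + y' \<cdot> v) =
    (x \<cdot> x' - N v \<star> (cj y' \<cdot> y)) + (y' \<cdot> x + y \<cdot> cj x') \<cdot> v"
proof -
  have [simp]: "x \<cdot> (y' \<cdot> v) = (y' \<cdot> x) \<cdot> v"
    using assms B by (intro double_left v_perp subalgebraD(1))
  have [simp]: "(y \<cdot> v) \<cdot> x' = (y \<cdot> cj x') \<cdot> v"
    using assms B by (intro double_right v_perp subalgebraD(1))
  have "(y \<cdot> v) \<cdot> (y' \<cdot> v) = - (N v \<star> (cj y' \<cdot> y))"
    using assms B by (intro double_both v_perp subalgebraD(1) cj_closed)
  then show ?thesis by (simp add: mul_add_left mul_add_right)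
qed

lemma double_polar: assumes "x \<in> B" "y \<in> B" shows "b x (y \<cdot> v) = 0" "b (y \<cdot> v) x = 0"
proof -
  have "b (y \<cdot> v) x = b v (cj y \<cdot> x)" by (rule adjoint_left)
  also have "\<dots> = 0" using assms B by (intro v_perp subalgebraD(1) cj_closed)
  finally show "b (y \<cdot> v) x = 0" .
  then show "b x (y \<cdot> v) = 0" by (simp only: polar_commute)
qed

lemma double_N: assumes "x \<in> B" "y \<in> B" shows "N (x + y \<cdot> v) = N x + N y * N v"
  using double_polar[OF assms] by (simp add: N_add N_mul)

lemma subset_double: "B \<subseteq> double C B v" and gen_in_double: "v \<in> double C B v"
proof -
  have "\<exists>y z. x = y + z \<cdot> v \<and> y \<in> B \<and> z \<in> B" if "x \<in> B" for x
    using that subalgebraD(2)[OF B(1)] by (intro exI[of _ x] exI[of _ 0]) simp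
  then show "B \<subseteq> double C B v" by (auto simp: double_def)
  have "\<exists>y z. v = y + z \<cdot> v \<and> y \<in> B \<and> z \<in> B"
    using B subalgebraD(2)[OF B(1)] by (intro exI[of _ 0] exI[of _ e]) simp
  then show "v \<in> double C B v" by (auto simp: double_def)
qed

lemma subalgebra_double: "subalgebra C (double C B v)"
proof -
  have "vs.subspace (double C B v)"
  proof (rule vs.subspaceI)
    show "0 \<in> double C B v"
      using subset_double subalgebraD(2)[OF B(1)] by blast
    fix z assume "z \<in> double C B v"
    then obtain x y where z: "z = x + y \<cdot> v" "x \<in> B" "y \<in> B" by (auto simp: double_def)
    have "c \<star> z = c \<star> x + (c \<star> y) \<cdot> v" for c by (simp add: z mul_lin vs_lin)
    then show "c \<star> z \<in> double C B v" for c
      using z subalgebraD(5)[OF B(1)] unfolding double_def by blast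
    fix z' assume "z' \<in> double C B v"
    then obtain x' y' where z': "z' = x' + y' \<cdot> v" "x' \<in> B" "y' \<in> B" by (auto simp: double_def)
    have "z + z' = (x + x') + (y + y') \<cdot> v" by (simp add: z z' mul_lin)
    then show "z + z' \<in> double C B v"
      using z z' subalgebraD(3)[OF B(1)] unfolding double_def by blast
  qed
  moreover have "z \<cdot> z' \<in> double C B v" if zs: "z \<in> double C B v" "z' \<in> double C B v" for z z'
  proof -
    obtain x y x' y' where "z = x + y \<cdot> v" "z' = x' + y' \<cdot> v"
      and m: "x \<in> B" "y \<in> B" "x' \<in> B" "y' \<in> B" using zs unfolding double_def by blast
    then have "z \<cdot> z' = (x \<cdot> x' - N v \<star> (cj y' \<cdot> y)) + (y' \<cdot> x + y \<cdot> cj x') \<cdot> v"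
      using double_mul by simp
    moreover have "x \<cdot> x' - N v \<star> (cj y' \<cdot> y) \<in> B" "y' \<cdot> x + y \<cdot> cj x' \<in> B"
      using m B by (intro subalgebraD(1,3-5) cj_closed; simp)+
    ultimately show ?thesis unfolding double_def by blast
  qed
  ultimately show ?thesis by (simp add: subalgebra_def)
qed

end

context
  fixes B v
  assumes B: "nonsingular_subalgebra C B" and v: "v \<in> perp C B" "N v \<noteq> 0"
begin

lemma nsubD: "subalgebra C B" "e \<in> B" "\<And>x. x \<in> B \<Longrightarrow> (\<And>y. y \<in> B \<Longrightarrow> b x y = 0) \<Longrightarrow> x = 0"
  using B by (auto simp: nonsingular_subalgebra_def)

lemma mul_v_eq_0: "y \<cdot> v = 0 \<Longrightarrow> y = 0"
  using mul_mul_cj[of y v] v(2) by simp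

text \<open>\<open>B v\<close> is orthogonal to \<open>B\<close>, so a common vector lies in the
  radical of \<open>B\<close>, which is zero; and right multiplication by \<open>v\<close> is
  injective because \<open>N v\<close> is non-zero.\<close>

lemma double_inter: assumes "y \<in> B" "y \<cdot> v \<in> B" shows "y = 0"
proof -
  have "y \<cdot> v = 0" using double_polar(2)[OF nsubD(1,2) v(1)] assms nsubD(3) by blast
  then show ?thesis by (rule mul_v_eq_0)
qed

lemma double_unique:
  assumes "x \<in> B" "y \<in> B" "x' \<in> B" "y' \<in> B" "x + y \<cdot> v = x' + y' \<cdot> v"
  shows "x = x'" "y = y'"
proof -
  have "(y - y') \<cdot> v = x' - x" using assms(5) by (simp add: mul_lin algebra_simps)
  then have "y - y' = 0" using double_inter[of "y - y'"] assms nsubD(1) by (simp add: subalgebraD)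
  then show "y = y'" by simp
  with assms(5) show "x = x'" by simp
qed

text \<open>The sum \<open>B + B v\<close> is orthogonal, and right multiplication by
  \<open>v\<close> multiplies the polar form by \<open>N v\<close>, so both summands are
  non-degenerate.\<close>

lemma nonsingular_double: "nonsingular_subalgebra C (double C B v)"
proof -
  have "z = 0" if z: "z \<in> double C B v" "\<And>w. w \<in> double C B v \<Longrightarrow> b z w = 0" for z
  proof -
    obtain x y where xy: "z = x + y \<cdot> v" "x \<in> B" "y \<in> B" using z(1) by (auto simp: double_def)
    have "b x w = 0" if "w \<in> B" for w
      using z(2)[of w] subset_double[OF nsubD(1,2) v(1)] double_polar[OF nsubD(1,2) v(1) that xy(3)] that
      by (auto simp: xy polar_lin)
    then have x: "x = 0" using nsubD(3) xy by blast
    have "b y w = 0" if "w \<in> B" for w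
    proof -
      have "w \<cdot> v \<in> double C B v"
        using subset_double[OF nsubD(1,2) v(1)] gen_in_double[OF nsubD(1,2) v(1)] that
          subalgebraD(1)[OF subalgebra_double[OF nsubD(1,2) v(1)]] by blast
      then have "b y w * N v = 0" using z(2)[of "w \<cdot> v"] by (simp add: xy x polar_mul_right)
      then show ?thesis using v by simp
    qed
    then have "y = 0" using nsubD(3) xy by blast
    then show ?thesis by (simp add: xy x)
  qed
  then show ?thesis
    using subalgebra_double[OF nsubD(1,2) v(1)] subset_double[OF nsubD(1,2) v(1)] nsubD(2)
    by (auto simp: nonsingular_subalgebra_def)
qed

lemma dim_double: "vs.dim (double C B v) = 2 * vs.dim B"
proof -
  interpret fp: finite_dimensional_vector_space_pair_1 "scal C" some_basis "scal C" by unfold_locales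
  have lin: "Vector_Spaces.linear (scal C) (scal C) (\<lambda>y. y \<cdot> v)"
    by (rule linearI) (simp_all add: mul_lin)
  interpret l: Vector_Spaces.linear "scal C" "scal C" "\<lambda>y. y \<cdot> v" by (rule lin)
  have inj: "inj (\<lambda>y. y \<cdot> v)" using mul_v_eq_0 by (simp add: l.inj_iff_eq_0)
  let ?Bv = "(\<lambda>y. y \<cdot> v) ` B"
  have sB: "vs.subspace B" using nsubD(1) by (rule subalgebraD(7))
  have "vs.dim {x + y | x y. x \<in> B \<and> y \<in> ?Bv} + vs.dim (B \<inter> ?Bv) = vs.dim B + vs.dim ?Bv"
    by (intro fd.dim_sums_Int sB l.subspace_image)
  moreover have "{x + y | x y. x \<in> B \<and> y \<in> ?Bv} = double C B v" by (auto simp: double_def)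
  moreover have "B \<inter> ?Bv \<subseteq> {0}" using double_inter by (auto dest!: double_inter[rotated])
  then have "vs.dim (B \<inter> ?Bv) = 0" by (simp add: fd.dim_eq_0)
  moreover have "vs.dim ?Bv = vs.dim B"
    by (rule fp.dim_image_eq[OF lin]) (use inj in \<open>auto intro: inj_on_subset\<close>)
  ultimately show ?thesis by simp
qed

end

lemma generated_line_eq_span: "generated_line C a = vs.span {e, a}"
proof -
  have "x \<in> vs.span {e, a} \<longleftrightarrow> x \<in> generated_line C a" for x
    unfolding vs.span_breakdown_eq generated_line_def by (auto simp: algebra_simps)
  then show ?thesis by auto
qed

lemma mem_generated_line: "e \<in> generated_line C a" "a \<in> generated_line C a"
  by (simp_all add: generated_line_eq_span vs.span_base)

lemma subalgebra_generated_line: "subalgebra C (generated_line C a)"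
proof -
  have "x \<cdot> y \<in> generated_line C a" if xy: "x \<in> generated_line C a" "y \<in> generated_line C a" for x y
  proof -
    obtain s t s' t' where "x = s \<star> e + t \<star> a" "y = s' \<star> e + t' \<star> a"
      using xy by (auto simp: generated_line_def)
    then have "x \<cdot> y = (s * s') \<star> e + (s * t' + t * s') \<star> a + (t * t') \<star> (T a \<star> a - N a \<star> e)"
      by (simp add: mul_lin vs_lin quadratic algebra_simps)
    then show ?thesis unfolding generated_line_eq_span
      by (simp add: vs.span_add vs.span_scale vs.span_diff vs.span_base)
  qed
  then show ?thesis by (simp add: subalgebra_def generated_line_eq_span)
qed

lemma generated_line_unique:
  assumes "4 * N a \<noteq> (T a)\<^sup>2" "s \<star> e + t \<star> a = s' \<star> e + t' \<star> a"
  shows "s = s'" "t = t'"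
proof -
  show t: "t = t'"
  proof (rule ccontr)
    assume "t \<noteq> t'"
    have "(t - t') \<star> a = (s' - s) \<star> e" using assms(2) by (simp add: vs_lin algebra_simps)
    then have "(1 / (t - t')) \<star> (t - t') \<star> a = (1 / (t - t')) \<star> (s' - s) \<star> e" by simp
    moreover define k where "k = (s' - s) / (t - t')"
    ultimately have "a = k \<star> e" using \<open>t \<noteq> t'\<close> by simp
    then have "4 * N a = (T a)\<^sup>2" by (simp add: N_scal polar_lin T_one power2_eq_square)
    then show False using assms by simp
  qed
  show "s = s'" using assms(2) one_nonzero by (simp add: t)
qed

lemma nonsingular_generated_line:
  assumes "4 * N a \<noteq> (T a)\<^sup>2" shows "nonsingular_subalgebra C (generated_line C a)"
proof -
  have "x = 0" if xs: "x \<in> generated_line C a" "\<And>y. y \<in> generated_line C a \<Longrightarrow> b x y = 0" for x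
  proof -
    obtain s t where x: "x = s \<star> e + t \<star> a" using xs(1) unfolding generated_line_def by blast
    have 1: "2 * s + t * T a = 0" "s * T a + t * (2 * N a) = 0"
      using xs(2)[OF mem_generated_line(1)] xs(2)[OF mem_generated_line(2)]
      by (simp_all add: x polar_lin T_one polar_self polar_commute[of e a] algebra_simps)
    \<comment> \<open>Elimination of \<open>s\<close> from the two equations; the factor of
      \<open>t\<close> is the Gram determinant.\<close>
    have "t * (4 * N a - (T a)\<^sup>2) = 2 * (s * T a + t * (2 * N a)) - T a * (2 * s + t * T a)"
      by (simp add: algebra_simps power2_eq_square)
    then have t: "t = 0" using assms 1 by simp
    \<comment> \<open>With \<open>t = 0\<close>, a non-zero \<open>s\<close> would force
      \<open>2 = 0\<close> and \<open>T a = 0\<close>, so that the Gram determinant would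
      vanish.\<close>
    have "s = 0"
    proof (rule ccontr)
      assume "s \<noteq> 0"
      then have "T a = 0" "(2::'f) = 0" using 1 t by auto
      moreover have "(4::'f) = 2 * 2" by simp
      ultimately show False using assms by (simp only:) simp
    qed
    then show ?thesis by (simp add: x t)
  qed
  then show ?thesis
    using subalgebra_generated_line mem_generated_line by (auto simp: nonsingular_subalgebra_def)
qed

lemma dim_generated_line: assumes "4 * N a \<noteq> (T a)\<^sup>2" shows "vs.dim (generated_line C a) = 2"
proof -
  have "a \<notin> vs.span {e}"
  proof
    assume "a \<in> vs.span {e}"
    then obtain k where "a = k \<star> e" by (auto simp: vs.span_singleton)
    then show False using assms by (simp add: N_scal polar_lin T_one power2_eq_square)
  qed
  then have "vs.independent {a, e}" "a \<noteq> e"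
    using one_nonzero by (auto simp: vs.independent_insert vs.span_base)
  then have "vs.dim {a, e} = 2" by (simp add: vs.dim_eq_card_independent)
  then show ?thesis by (simp add: generated_line_eq_span insert_commute)
qed

context
  fixes p q r
  assumes triple: "cayley_triple C p q r"
begin

lemma cayley_tripleD:
  "4 * N p \<noteq> (T p)\<^sup>2" "q \<in> perp C (generated_line C p)" "N q \<noteq> 0"
  "r \<in> perp C (double C (generated_line C p) q)" "N r \<noteq> 0"
  using triple by (auto simp: cayley_triple_def)

lemma cayley_nonsingular: "nonsingular_subalgebra C (double C (generated_line C p) q)"
  by (intro nonsingular_double nonsingular_generated_line cayley_tripleD)

text \<open>The dimensions along the chain are 2, 4 and 8.\<close>

lemma cayley_UNIV: "double C (double C (generated_line C p) q) r = UNIV"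
proof -
  have "vs.dim (double C (double C (generated_line C p) q) r) = 8"
    using dim_double[OF cayley_nonsingular cayley_tripleD(4,5)]
      dim_double[OF nonsingular_generated_line[OF cayley_tripleD(1)] cayley_tripleD(2,3)]
      dim_generated_line[OF cayley_tripleD(1)] by simp
  moreover have "vs.subspace (double C (double C (generated_line C p) q) r)"
    using nonsingular_double[OF cayley_nonsingular cayley_tripleD(4,5)]
    by (auto simp: nonsingular_subalgebra_def subalgebra_def)
  ultimately show ?thesis
    using fd.subspace_dim_equal[of _ UNIV] dim_UNIV by (metis vs.subspace_UNIV subset_UNIV order_refl)
qed

end

end

text \<open>A homomorphism with conditions on \<open>B\<close> only. Preservation of the norm
  carries the polar form along, which makes the map injective on non-degenerate subalgebras.\<close>

definition embedding :: "('f::field, 'a::ab_group_add) normed_alg \<Rightarrow>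
    ('f, 'b::ab_group_add) normed_alg \<Rightarrow> 'a set \<Rightarrow> ('a \<Rightarrow> 'b) \<Rightarrow> bool" where
  "embedding C D B f \<longleftrightarrow>
     (\<forall>x\<in>B. \<forall>y\<in>B. f (x + y) = f x + f y) \<and> (\<forall>c. \<forall>x\<in>B. f (scal C c x) = scal D c (f x)) \<and>
     (\<forall>x\<in>B. \<forall>y\<in>B. f (mul C x y) = mul D (f x) (f y)) \<and> f (unity C) = unity D \<and>
     (\<forall>x\<in>B. nrm D (f x) = nrm C x)"

section \<open>Isomorphisms built up along the doublings\<close>

locale octonion_pair = A: octonion C + B: octonion D
  for C :: "('f::field, 'a::ab_group_add) normed_alg"
  and D :: "('f, 'b::ab_group_add) normed_alg"
begin

lemma embedding_polar:
  assumes "embedding C D B f" "A.vs.subspace B" "x \<in> B" "y \<in> B"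
  shows "polar D (f x) (f y) = polar C x y"
proof -
  have "x + y \<in> B" using assms by (simp add: A.vs.subspace_add)
  then show ?thesis using assms unfolding embedding_def polar_def by metis
qed

text \<open>By \<open>quadratic\<close>, product and norm on \<open>F + F a\<close> are determined
  by \<open>T a\<close> and \<open>N a\<close>.\<close>

lemma embedding_generated_line:
  assumes disc: "4 * nrm C a \<noteq> (polar C a (unity C))\<^sup>2"
    and T: "polar D a' (unity D) = polar C a (unity C)" and N: "nrm D a' = nrm C a"
  obtains f where "embedding C D (generated_line C a) f" "f a = a'"
    "f ` generated_line C a = generated_line D a'"
proof -
  define f where "f x = (THE w. \<exists>s t. x = scal C s (unity C) + scal C t a \<and>
     w = scal D s (unity D) + scal D t a')" for x
  have f: "f (scal C s (unity C) + scal C t a) = scal D s (unity D) + scal D t a'" for s t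
    unfolding f_def by (rule the_equality) (use A.generated_line_unique[OF disc] in blast)+
  have "embedding C D (generated_line C a) f"
    unfolding embedding_def
  proof (intro conjI ballI allI)
    show "f (unity C) = unity D" using f[of 1 0] by simp
    fix x assume "x \<in> generated_line C a"
    then obtain s t where x: "x = scal C s (unity C) + scal C t a" by (auto simp: generated_line_def)
    have "scal C c x = scal C (c * s) (unity C) + scal C (c * t) a" for c by (simp add: x A.vs_lin)
    then show "f (scal C c x) = scal D c (f x)" for c using f by (simp add: x B.vs_lin)
    show "nrm D (f x) = nrm C x"
      by (simp add: x f A.N_add_scal B.N_add_scal A.N_scal B.N_scal A.polar_lin B.polar_lin N T
          A.polar_commute[of "unity C" a] B.polar_commute[of "unity D" a'])
    fix y assume "y \<in> generated_line C a"
    then obtain s' t' where y: "y = scal C s' (unity C) + scal C t' a" by (auto simp: generated_line_def)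
    have "x + y = scal C (s + s') (unity C) + scal C (t + t') a"
      by (simp add: x y A.vs_lin)
    then show "f (x + y) = f x + f y" using f by (simp add: x y B.vs_lin)
    have "mul C x y = scal C (s * s' - t * t' * nrm C a) (unity C) +
        scal C (s * t' + t * s' + t * t' * polar C a (unity C)) a"
      by (simp add: x y A.mul_lin A.vs_lin A.quadratic algebra_simps)
    then have "f (mul C x y) = scal D (s * s' - t * t' * nrm C a) (unity D) +
        scal D (s * t' + t * s' + t * t' * polar C a (unity C)) a'"
      using f by simp
    also have "\<dots> = mul D (f x) (f y)"
      unfolding x y f by (simp add: B.mul_lin B.vs_lin B.quadratic N T algebra_simps)
    finally show "f (mul C x y) = mul D (f x) (f y)" .
  qed
  moreover have "f a = a'" using f[of 0 1] by simp
  moreover have "f ` generated_line C a = generated_line D a'"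
  proof
    show "f ` generated_line C a \<subseteq> generated_line D a'"
      using f by (auto simp: generated_line_def)
    show "generated_line D a' \<subseteq> f ` generated_line C a"
    proof
      fix w assume "w \<in> generated_line D a'"
      then obtain s t where "w = scal D s (unity D) + scal D t a'" by (auto simp: generated_line_def)
      then have "w = f (scal C s (unity C) + scal C t a)" by (simp add: f)
      then show "w \<in> f ` generated_line C a" unfolding generated_line_def by blast
    qed
  qed
  ultimately show ?thesis by (rule that)
qed

text \<open>\<open>double_mul\<close> and \<open>double_N\<close> express product and norm through
  those of \<open>B\<close>, the conjugation and \<open>N v\<close>; and an embedding commutes with
  conjugation because it preserves the trace.\<close>

lemma embedding_double:
  assumes B: "nonsingular_subalgebra C B" and f: "embedding C D B f"
    and v: "v \<in> perp C B" "nrm C v \<noteq> 0"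
    and v': "v' \<in> perp D (f ` B)" "nrm D v' = nrm C v"
  obtains g where "embedding C D (double C B v) g" "\<And>x. x \<in> B \<Longrightarrow> g x = f x" "g v = v'"
    "g ` double C B v = double D (f ` B) v'"
proof -
  define g where "g z = (THE w. \<exists>x\<in>B. \<exists>y\<in>B. z = x + mul C y v \<and> w = f x + mul D (f y) v')" for z
  have g: "g (x + mul C y v) = f x + mul D (f y) v'" if "x \<in> B" "y \<in> B" for x y
    unfolding g_def
    by (rule the_equality) (use A.double_unique[OF B v] that in blast)+
  have sub: "subalgebra C B" and eB: "unity C \<in> B" using B by (auto simp: nonsingular_subalgebra_def)
  note cl = A.subalgebraD[OF sub]
  have fD: "f (x + y) = f x + f y" "f (mul C x y) = mul D (f x) (f y)" "f (scal C c x) = scal D c (f x)"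
    "nrm D (f x) = nrm C x" if "x \<in> B" "y \<in> B" for x y c
    using f that by (auto simp: embedding_def)
  have f1: "f (unity C) = unity D" using f by (auto simp: embedding_def)
  have f0: "f 0 = 0" using fD(3)[OF eB eB, of 0] by simp
  have fneg: "f (- x) = - f x" if "x \<in> B" for x
    using fD(3)[OF that eB, of "-1"] by simp
  have fdiff: "f (x - y) = f x - f y" if "x \<in> B" "y \<in> B" for x y
    using fD(1)[of x "- y"] that fneg cl by simp
  have fcj: "f (A.cj x) = B.cj (f x)" if "x \<in> B" for x
    using embedding_polar[OF f cl(7) that eB] that eB cl fD f1 by (simp add: fdiff)
  have fB: "subalgebra D (f ` B)"
    unfolding subalgebra_def B.vs.subspace_def
    using cl fD eB f0 by (auto simp: image_iff) metis+
  have efB: "unity D \<in> f ` B" using f1 eB by (metis imageI)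
  have N: "nrm D (f x + mul D (f y) v') = nrm C (x + mul C y v)" if "x \<in> B" "y \<in> B" for x y
    using A.double_N[OF sub eB v(1) that] B.double_N[OF fB efB v'(1), of "f x" "f y"] that fD v' by auto
  have "embedding C D (double C B v) g"
    unfolding embedding_def
  proof (intro conjI ballI allI)
    show "g (unity C) = unity D" using g[OF eB cl(2)] f0 f1 by simp
    fix z assume "z \<in> double C B v"
    then obtain x y where z: "z = x + mul C y v" and xy: "x \<in> B" "y \<in> B" by (auto simp: double_def)
    have "scal C c z = scal C c x + mul C (scal C c y) v" for c by (simp add: z A.vs_lin A.mul_lin)
    then show "g (scal C c z) = scal D c (g z)" for c
      using g cl fD xy by (simp add: z B.vs_lin B.mul_lin)
    show "nrm D (g z) = nrm C z" using N xy by (simp add: z g)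
    fix z' assume "z' \<in> double C B v"
    then obtain x' y' where z': "z' = x' + mul C y' v" and xy': "x' \<in> B" "y' \<in> B"
      by (auto simp: double_def)
    have zz: "z + z' = (x + x') + mul C (y + y') v" by (simp add: z z' A.mul_lin)
    show "g (z + z') = g z + g z'" unfolding zz
      using g cl fD xy xy' by (simp add: z z' B.mul_lin)
    have cjB: "A.cj x' \<in> B" "A.cj y' \<in> B" using A.cj_closed[OF sub eB] xy' by blast+
    have "g (mul C z z') = f (mul C x x' - scal C (nrm C v) (mul C (A.cj y') y)) +
        mul D (f (mul C y' x + mul C y (A.cj x'))) v'"
      unfolding z z' A.double_mul[OF sub eB v(1) xy xy']
      by (rule g) (use xy xy' cjB cl in metis)+
    also have "\<dots> = (mul D (f x) (f x') - scal D (nrm D v') (mul D (B.cj (f y')) (f y))) +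
        mul D (mul D (f y') (f x) + mul D (f y) (B.cj (f x'))) v'"
      using xy xy' cjB cl fD fdiff fcj v'(2) by metis
    also have "\<dots> = mul D (g z) (g z')"
      unfolding z z' g[OF xy] g[OF xy']
      by (rule B.double_mul[OF fB efB v'(1), symmetric]) (use xy xy' in auto)
    finally show "g (mul C z z') = mul D (g z) (g z')" .
  qed
  moreover have gB: "g x = f x" if "x \<in> B" for x using g[OF that cl(2)] f0 by simp
  moreover have "g v = v'" using g[OF cl(2) eB] f0 f1 by simp
  moreover have "g ` double C B v = double D (f ` B) v'"
  proof
    show "g ` double C B v \<subseteq> double D (f ` B) v'"
      using g by (auto simp: double_def)
    show "double D (f ` B) v' \<subseteq> g ` double C B v"
    proof
      fix w assume "w \<in> double D (f ` B) v'"
      then obtain x y where "w = f x + mul D (f y) v'" "x \<in> B" "y \<in> B" by (auto simp: double_def)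
      then have "w = g (x + mul C y v)" "x + mul C y v \<in> double C B v"
        using g[of x y] by (auto simp: double_def)
      then show "w \<in> g ` double C B v" by blast
    qed
  qed
  ultimately show ?thesis by (rule that)
qed

text \<open>The isomorphism grows along the two doublings. At the end \<open>cayley_UNIV\<close>
  makes it total and onto, and non-degeneracy of the polar form makes it injective.\<close>

theorem cayley_triple_iso:
  assumes t: "cayley_triple C p q r" and t': "cayley_triple D p' q' r'"
    and T: "polar D p' (unity D) = polar C p (unity C)"
    and N: "nrm D p' = nrm C p" "nrm D q' = nrm C q" "nrm D r' = nrm C r"
  obtains g where "alg_iso C UNIV D UNIV g" "\<And>x. nrm D (g x) = nrm C x"
    "g (unity C) = unity D" "g p = p'" "g q = q'" "g r = r'"
proof -
  note D = A.cayley_tripleD[OF t] and D' = B.cayley_tripleD[OF t']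
  let ?L = "generated_line C p" and ?L' = "generated_line D p'"
  obtain f where f: "embedding C D ?L f" "f p = p'" "f ` ?L = ?L'"
    using embedding_generated_line[OF D(1) T N(1)] by blast
  note L = A.nonsingular_generated_line[OF D(1)]
  then have sL: "subalgebra C ?L" "unity C \<in> ?L" by (auto simp: nonsingular_subalgebra_def)
  obtain g where g: "embedding C D (double C ?L q) g" "\<And>x. x \<in> ?L \<Longrightarrow> g x = f x" "g q = q'"
    "g ` double C ?L q = double D ?L' q'"
    using embedding_double[OF L f(1) D(2,3), of q'] D'(2) N(2) f(3) by metis
  note H = A.cayley_nonsingular[OF t]
  then have sH: "subalgebra C (double C ?L q)" "unity C \<in> double C ?L q"
    by (auto simp: nonsingular_subalgebra_def)
  obtain h where h: "embedding C D (double C (double C ?L q) r) h"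
    "\<And>x. x \<in> double C ?L q \<Longrightarrow> h x = g x" "h r = r'"
    "h ` double C (double C ?L q) r = double D (double D ?L' q') r'"
    using embedding_double[OF H g(1) D(4,5), of r'] D'(4) N(3) g(4) by metis
  have h': "embedding C D UNIV h" "surj h"
    using h(1,4) by (simp_all add: A.cayley_UNIV[OF t] B.cayley_UNIV[OF t'])
  have "inj h"
  proof (rule injI)
    fix x y assume "h x = h y"
    moreover have "h (x + (- y)) = h x + h (- y)" "h (y + (- y)) = h y + h (- y)"
      using h'(1) by (metis embedding_def UNIV_I)+
    ultimately have "h (x - y) = h 0" by simp
    moreover have "h (scal C 0 0) = scal D 0 (h 0)" using h'(1) by (metis embedding_def UNIV_I)
    ultimately have 0: "h (x - y) = 0" by simp
    have "polar C (x - y) z = 0" for z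
      using embedding_polar[OF h'(1), of "x - y" z] 0 by simp
    then have "x - y = 0" by (rule A.nondegenerate)
    then show "x = y" by simp
  qed
  moreover have "algebra C UNIV" "algebra D UNIV"
    using A.octonion B.octonion by (simp_all add: octonion_algebra_def composition_algebra_def)
  ultimately have "alg_iso C UNIV D UNIV h"
    using h' by (simp add: alg_iso_def embedding_def bij_def)
  moreover have "h (unity C) = unity D" "nrm D (h x) = nrm C x" for x
    using h'(1) by (simp_all add: embedding_def)
  moreover have "h p = p'"
    using h(2)[of p] g(2)[of p] f(2) A.subset_double[OF sL D(2)] A.mem_generated_line[of p] by auto
  moreover have "h q = q'"
    using h(2)[of q] g(3) A.gen_in_double[OF sL D(2)] by simp
  ultimately show ?thesis using that h(3) by blast
qed

end

section \<open>The split octonions\<close>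

lemmas mat2_simps = vec_eq_iff forall_2 matrix_matrix_mult_def sum_2 adjugate_def mat_scal_def
  det_2 mat_def p\<^sub>0_def n\<^sub>0_def

lemma split_octonions_sel [simp]:
  "scal split_octonions c (a, x) = (mat_scal c a, mat_scal c x)"
  "mul split_octonions (a, x) (b, y) = (a ** b + adjugate y ** x, y ** a + x ** adjugate b)"
  "unity split_octonions = (mat 1, 0)"
  "nrm split_octonions (a, x) = det a - det x"
  by (simp_all add: split_octonions_def)

lemma polar_split_octonions [simp]:
  "polar split_octonions (a, x) (b, y) =
     a $ 1 $ 1 * b $ 2 $ 2 + b $ 1 $ 1 * a $ 2 $ 2 - a $ 1 $ 2 * b $ 2 $ 1 - b $ 1 $ 2 * a $ 2 $ 1 -
     (x $ 1 $ 1 * y $ 2 $ 2 + y $ 1 $ 1 * x $ 2 $ 2 - x $ 1 $ 2 * y $ 2 $ 1 - y $ 1 $ 2 * x $ 2 $ 1)"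
  by (simp add: polar_def det_2 algebra_simps)

lemma vector_space_split_octonions:
  "vector_space (scal (split_octonions :: ('f::field, 'f mat2 \<times> 'f mat2) normed_alg))"
  by unfold_locales (auto simp: split_octonions_def mat2_simps algebra_simps)

text \<open>The eight matrix entries are indexed by \<open>bool \<times> 2 \<times> 2\<close>, which
  transfers the dimension of a coordinate space.\<close>

lemma dim_split_octonions:
  "alg_dim (split_octonions :: ('f::field, 'f mat2 \<times> 'f mat2) normed_alg) UNIV = 8"
proof -
  interpret v: vector_space "scal (split_octonions :: ('f, 'f mat2 \<times> 'f mat2) normed_alg)"
    by (rule vector_space_split_octonions)
  interpret fp: finite_dimensional_vector_space_pair_1 "(*s)" "cart_basis :: ('f^(bool \<times> 2 \<times> 2)) set"
    "scal (split_octonions :: ('f, 'f mat2 \<times> 'f mat2) normed_alg)" by unfold_locales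
  define h :: "'f^(bool \<times> 2 \<times> 2) \<Rightarrow> 'f mat2 \<times> 'f mat2" where
    "h u = (\<chi> i j. u $ (False, i, j), \<chi> i j. u $ (True, i, j))" for u
  have "Vector_Spaces.linear (*s) (scal split_octonions) h"
    by (intro Vector_Spaces.linear.intro module_hom.intro module_hom_axioms.intro
        v.vector_space_axioms v.module_axioms vec.vector_space_axioms vec.module_axioms)
      (auto simp: h_def mat_scal_def vec_eq_iff)
  moreover have "inj h"
    by (rule injI) (auto simp: h_def vec_eq_iff all_bool_eq)
  ultimately have "v.dim (range h) = vec.dim (UNIV :: ('f^(bool \<times> 2 \<times> 2)) set)"
    by (intro fp.dim_image_eq) (auto intro: inj_on_subset)
  moreover have "surj h"
  proof (rule surjI)
    show "h (\<chi> k. (if fst k then snd z else fst z) $ fst (snd k) $ snd (snd k)) = z" for z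
      by (cases z) (simp add: h_def)
  qed
  ultimately show ?thesis unfolding alg_dim_def vec_dim_card by simp
qed

lemma octonion_split_octonions:
  "octonion_algebra (split_octonions :: ('f::field, 'f mat2 \<times> 'f mat2) normed_alg)"
proof -
  let ?C = "split_octonions :: ('f, 'f mat2 \<times> 'f mat2) normed_alg"
  interpret v: vector_space "scal ?C" by (rule vector_space_split_octonions)
  have "algebra ?C UNIV"
    unfolding algebra_def subalgebra_def
    by (auto simp: v.vector_space_axioms mat2_simps algebra_simps)
  moreover have "neutral_on ?C UNIV" by (auto simp: neutral_on_def mat2_simps)
  moreover have "quadratic_form_on ?C UNIV"
    by (auto simp: quadratic_form_on_def mat2_simps algebra_simps power2_eq_square)
  moreover have "nrm ?C (mul ?C u v) = nrm ?C u * nrm ?C v" for u v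
    by (cases u; cases v) (simp add: mat2_simps algebra_simps)
  moreover have "u = 0" if "\<And>v. polar ?C u v = 0" for u
  proof -
    obtain a x where u: "u = (a, x)" by fastforce
    \<comment> \<open>Matrix units: pairing with them reads off the entries of \<open>u\<close> up
      to order and sign.\<close>
    define E :: "2 \<Rightarrow> 2 \<Rightarrow> 'f mat2" where "E i j = (\<chi> k l. if k = i \<and> l = j then 1 else 0)" for i j
    have "polar ?C u (E i j, 0) = 0" "polar ?C u (0, E i j) = 0" for i j using that by auto
    from this[of 1 1] this[of 1 2] this[of 2 1] this[of 2 2] show ?thesis
      by (simp add: u E_def vec_eq_iff forall_2 zero_prod_def)
  qed
  ultimately show ?thesis
    unfolding octonion_algebra_def composition_algebra_def using dim_split_octonions by blast
qed

text \<open>By \<open>quadratic\<close>, trace one and norm zero make \<open>p\<close> idempotent.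
  The invariants are those of the triple in \<open>split_triple_model\<close>.\<close>

definition split_triple :: "('f::field, 'a::ab_group_add) normed_alg \<Rightarrow> 'a \<Rightarrow> 'a \<Rightarrow> 'a \<Rightarrow> bool" where
  "split_triple C p q r \<longleftrightarrow> cayley_triple C p q r \<and>
     polar C p (unity C) = 1 \<and> nrm C p = 0 \<and> nrm C q = - 1 \<and> nrm C r = - 1"

context octonion
begin

lemma perp_generated_line: "x \<in> perp C (generated_line C p) \<longleftrightarrow> T x = 0 \<and> b x p = 0"
proof
  assume x: "x \<in> perp C (generated_line C p)"
  then show "T x = 0 \<and> b x p = 0"
    using mem_generated_line[of p] by (auto simp: perp_def)
qed (auto simp: perp_def generated_line_def polar_lin)

lemma perp_double_generated_line:
  "x \<in> perp C (double C (generated_line C p) q) \<longleftrightarrow>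
     T x = 0 \<and> b x p = 0 \<and> b x q = 0 \<and> b x (p \<cdot> q) = 0"
proof
  assume x: "x \<in> perp C (double C (generated_line C p) q)"
  have 0: "0 \<in> generated_line C p" by (simp add: generated_line_eq_span vs.span_zero)
  have "e + 0 \<cdot> q \<in> double C (generated_line C p) q" "p + 0 \<cdot> q \<in> double C (generated_line C p) q"
    "0 + e \<cdot> q \<in> double C (generated_line C p) q" "0 + p \<cdot> q \<in> double C (generated_line C p) q"
    unfolding double_def using 0 mem_generated_line[of p] by blast+
  then show "T x = 0 \<and> b x p = 0 \<and> b x q = 0 \<and> b x (p \<cdot> q) = 0"
    using x by (auto simp: perp_def)
qed (auto simp: perp_def double_def generated_line_def polar_lin mul_lin)

lemma split_tripleI:
  assumes "T p = 1" "N p = 0" "T q = 0" "b q p = 0" "N q = - 1"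
    "T r = 0" "b r p = 0" "b r q = 0" "b r (p \<cdot> q) = 0" "N r = - 1"
  shows "split_triple C p q r"
  using assms by (simp add: split_triple_def cayley_triple_def perp_generated_line
      perp_double_generated_line)

text \<open>A non-zero vector of \<open>B\<^sup>\<bottom>\<close> has a non-zero component in one of the two Peirce spaces
  of \<open>p\<close>, and these are totally singular; a hyperbolic pair there yields every norm.\<close>

lemma norm_minus_one_perp:
  assumes B: "nonsingular_subalgebra C B" "vs.dim B < 8" and p: "p \<in> B" "T p = 1" "N p = 0"
  obtains r where "r \<in> perp C B" "N r = - 1"
proof -
  have sub: "subalgebra C B" and eB: "e \<in> B" using B by (auto simp: nonsingular_subalgebra_def)
  note cl = subalgebraD[OF sub]
  have "B \<noteq> UNIV" using B(2) dim_UNIV by auto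
  then obtain w where "w \<notin> B" by auto
  then obtain u0 where u0: "b u0 w = 1" "\<And>x. x \<in> B \<Longrightarrow> b u0 x = 0"
    using separation[OF cl(7)] by metis
  then have "u0 \<noteq> 0" by auto
  have "\<exists>p'\<in>B. T p' = 1 \<and> N p' = 0 \<and> p' \<cdot> u0 \<noteq> 0"
  proof (cases "p \<cdot> u0 = 0")
    case True
    then have "(e - p) \<cdot> u0 \<noteq> 0" using \<open>u0 \<noteq> 0\<close> by (simp add: mul_lin)
    moreover have "e - p \<in> B" using eB p cl by blast
    ultimately show ?thesis
      using p by (intro bexI[of _ "e - p"]) (simp_all add: polar_lin T_one N_diff polar_commute)
  qed (use p in blast)
  then obtain p' where p': "p' \<in> B" "T p' = 1" "N p' = 0" "p' \<cdot> u0 \<noteq> 0" by blast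
  define u where "u = p' \<cdot> u0"
  have perp: "b (p' \<cdot> z) x = 0" "b (cj p' \<cdot> z) x = 0"
    if "x \<in> B" "\<And>x. x \<in> B \<Longrightarrow> b z x = 0" for x z
  proof -
    show "b (p' \<cdot> z) x = 0"
      unfolding adjoint_left using that cj_closed[OF sub eB p'(1)] cl by blast
    show "b (cj p' \<cdot> z) x = 0" unfolding adjoint_left' using that p'(1) cl by blast
  qed
  have uB: "b u x = 0" if "x \<in> B" for x using perp(1)[OF that u0(2)] by (simp add: u_def)
  have "u \<notin> B" using uB B(1) p'(4) unfolding nonsingular_subalgebra_def u_def by blast
  then obtain s where s: "b s u = 1" "\<And>x. x \<in> B \<Longrightarrow> b s x = 0"
    using separation[OF cl(7)] by metis
  have Nu: "N u = 0" by (simp add: u_def N_mul p')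
  have Ns: "N (cj p' \<cdot> s) = 0" by (simp add: N_mul p'(3))
  have "p' \<cdot> u = u" using left_alternative[of p' u0] by (simp add: u_def p')
  then have us: "b (cj p' \<cdot> s) u = 1" unfolding adjoint_left' using s by simp
  show ?thesis
  proof
    show "u - cj p' \<cdot> s \<in> perp C B"
      using uB perp(2)[OF _ s(2)] by (simp add: perp_def polar_lin(3))
    show "N (u - cj p' \<cdot> s) = - 1" using us by (simp add: N_diff Nu Ns polar_commute)
  qed
qed

lemma idempotent_disc: "T p = 1 \<Longrightarrow> N p = 0 \<Longrightarrow> 4 * N p \<noteq> (T p)\<^sup>2"
  by simp

lemma complete_split_triple:
  assumes p: "T p = 1" "N p = 0" and q: "T q = 0" "b q p = 0" "N q = - 1"
  obtains r where "split_triple C p q r"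
proof -
  let ?L = "generated_line C p"
  have L: "nonsingular_subalgebra C ?L" using nonsingular_generated_line idempotent_disc[OF p] by blast
  have q': "q \<in> perp C ?L" "N q \<noteq> 0" using q by (auto simp: perp_generated_line)
  have "vs.dim (double C ?L q) = 4"
    using dim_double[OF L q'] dim_generated_line[OF idempotent_disc[OF p]] by simp
  moreover have "p \<in> double C ?L q"
    using subset_double[of ?L q] L q' mem_generated_line[of p] by (auto simp: nonsingular_subalgebra_def)
  ultimately obtain r where "r \<in> perp C (double C ?L q)" "N r = - 1"
    using norm_minus_one_perp[OF nonsingular_double[OF L q']] p by auto
  then have "split_triple C p q r"
    using p q by (simp add: split_triple_def cayley_triple_def perp_generated_line)
  then show ?thesis by (rule that)
qed

text \<open>Every multiple \<open>x \<cdot> t\<close> has norm zero; its trace is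
  \<open>b x (cj t)\<close>, and non-degeneracy allows this to be made 1.\<close>

lemma idempotent_exists:
  assumes "x \<noteq> 0" "N x = 0"
  obtains p where "T p = 1" "N p = 0"
proof -
  obtain y where y: "b x y \<noteq> 0" using nondegenerate[of x] assms by blast
  define t where "t = (1 / b x y) \<star> cj y"
  have "b x (cj t) = 1" using y by (simp add: t_def polar_lin T_one vs_lin)
  then have "T (x \<cdot> t) = 1" by (simp add: T_mul polar_lin mult.commute)
  moreover have "N (x \<cdot> t) = 0" by (simp add: N_mul assms)
  ultimately show ?thesis by (rule that)
qed

lemma split_triple_exists:
  assumes "x \<noteq> 0" "N x = 0"
  obtains p q r where "split_triple C p q r"
proof -
  obtain p where p: "T p = 1" "N p = 0" using idempotent_exists[OF assms] .
  have L: "nonsingular_subalgebra C (generated_line C p)"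
    using nonsingular_generated_line idempotent_disc[OF p] by blast
  obtain q where "q \<in> perp C (generated_line C p)" "N q = - 1"
    using norm_minus_one_perp[OF L] p mem_generated_line[of p]
      dim_generated_line[OF idempotent_disc[OF p]] by auto
  then show ?thesis using complete_split_triple[OF p, of q] that by (auto simp: perp_generated_line)
qed

end

lemma alg_iso_compose:
  assumes "alg_iso C A D B f" "alg_iso D B E G g" shows "alg_iso C A E G (g \<circ> f)"
proof -
  have "f x \<in> B" if "x \<in> A" for x using assms that by (auto simp: alg_iso_def bij_betw_def)
  then show ?thesis using assms by (auto simp: alg_iso_def intro: bij_betw_trans)
qed

lemma alg_iso_inv:
  assumes "alg_iso C A D B f" shows "alg_iso D B C A (inv_into A f)"
proof -
  let ?g = "inv_into A f"
  have A: "subalgebra C A" and bij: "bij_betw f A B" using assms by (auto simp: alg_iso_def algebra_def)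
  interpret v: vector_space "scal C" using assms by (auto simp: alg_iso_def algebra_def)
  have g: "?g y \<in> A" "f (?g y) = y" if "y \<in> B" for y
    using bij that by (auto simp: bij_betw_def inv_into_into f_inv_into_f)
  have gf: "?g (f x) = x" if "x \<in> A" for x using bij that by (auto simp: bij_betw_def)
  have cl: "x + y \<in> A" "mul C x y \<in> A" "scal C c x \<in> A" if "x \<in> A" "y \<in> A" for x y c
    using A that by (auto simp: subalgebra_def v.subspace_def)
  have "?g (x + y) = ?g x + ?g y" "?g (mul D x y) = mul C (?g x) (?g y)" "?g (scal D c x) = scal C c (?g x)"
    if "x \<in> B" "y \<in> B" for x y c
  proof -
    have "f (?g x + ?g y) = x + y" "f (mul C (?g x) (?g y)) = mul D x y" "f (scal C c (?g x)) = scal D c x"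
      using assms g that unfolding alg_iso_def by metis+
    then show "?g (x + y) = ?g x + ?g y" "?g (mul D x y) = mul C (?g x) (?g y)"
      "?g (scal D c x) = scal C c (?g x)"
      using gf cl g that by metis+
  qed
  then show ?thesis using assms bij_betw_inv_into[OF bij] by (auto simp: alg_iso_def)
qed

interpretation split_octonions:
  octonion "split_octonions :: ('f::field, 'f mat2 \<times> 'f mat2) normed_alg"
  by unfold_locales (rule octonion_split_octonions)

text \<open>Chosen for trace zero, determinant \<open>-1\<close>, orthogonality to
  \<open>p\<^sub>0\<close>, and \<open>p\<^sub>0 ** swap_mat = n\<^sub>0\<close>.\<close>

definition swap_mat :: "('f::field) mat2" where
  "swap_mat = vector [vector [0, 1], vector [1, 0]]"

lemma split_triple_model:
  "split_triple (split_octonions :: ('f::field, 'f mat2 \<times> 'f mat2) normed_alg)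
     (p\<^sub>0, 0) (swap_mat, 0) (0, mat 1)"
  by (intro split_octonions.split_tripleI) (simp_all add: mat2_simps swap_mat_def)

section \<open>Peirce spaces of an idempotent, and triples adapted to given generators\<close>

context octonion
begin

text \<open>Tracked are the images of those elements of the model that later serve as generators;
  each is a member of the standard triple or a product of its members.\<close>

lemma split_triple_identification:
  assumes "split_triple C p q r"
  obtains \<phi> where "split_identification C \<phi>" "\<phi> (p\<^sub>0, 0) = p" "\<phi> (n\<^sub>0, 0) = p \<cdot> q"
    "\<phi> (0, p\<^sub>0) = p \<cdot> r" "\<phi> (0, n\<^sub>0) = (p \<cdot> q) \<cdot> r"
proof -
  interpret pr: octonion_pair "split_octonions :: ('f, 'f mat2 \<times> 'f mat2) normed_alg" C
    by unfold_locales
  obtain \<phi> where \<phi>: "alg_iso split_octonions UNIV C UNIV \<phi>" "\<And>x. N (\<phi> x) = nrm split_octonions x"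
    "\<phi> (p\<^sub>0, 0) = p" "\<phi> (swap_mat, 0) = q" "\<phi> (0, mat 1) = r"
    using pr.cayley_triple_iso[of "(p\<^sub>0, 0)" "(swap_mat, 0)" "(0, mat 1)" p q r]
      split_triple_model assms unfolding split_triple_def by metis
  have m: "\<phi> (mul split_octonions x y) = \<phi> x \<cdot> \<phi> y" for x y
    using \<phi>(1) unfolding alg_iso_def by blast
  have products: "mul split_octonions (p\<^sub>0, 0) (swap_mat, 0) = (n\<^sub>0, 0 :: 'f mat2)"
    "mul split_octonions (p\<^sub>0, 0) (0, mat 1) = (0 :: 'f mat2, p\<^sub>0)"
    "mul split_octonions (n\<^sub>0, 0) (0, mat 1) = (0 :: 'f mat2, n\<^sub>0)"
    by (simp_all add: mat2_simps swap_mat_def)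
  have 1: "\<phi> (n\<^sub>0, 0) = p \<cdot> q"
    using m[of "(p\<^sub>0, 0)" "(swap_mat, 0)"] \<phi> by (simp only: products)
  have "split_identification C \<phi>" using \<phi> by (simp add: split_identification_def)
  moreover have "\<phi> (0, p\<^sub>0) = p \<cdot> r" "\<phi> (0, n\<^sub>0) = (p \<cdot> q) \<cdot> r"
    using m[of "(p\<^sub>0, 0)" "(0, mat 1)"] m[of "(n\<^sub>0, 0)" "(0, mat 1)"] \<phi> 1
    by (simp_all only: products)
  ultimately show ?thesis using that \<phi> 1 by blast
qed

lemma split_identification_exists:
  assumes "split C UNIV" obtains \<phi> where "split_identification C \<phi>"
  using assms split_triple_exists split_triple_identification by (metis split_def)

text \<open>On the orthogonal space of \<open>F + F p\<close>, left multiplication by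
  \<open>p\<close> has eigenvalues 0 and 1, and the polar form puts the two eigenspaces in duality.
  A vector \<open>y\<close> that pairs with \<open>n\<close> but not with \<open>X\<close> is found
  by \<open>separation\<close>, and multiplication by \<open>- cj p\<close> moves it to the
  0-eigenspace.\<close>

lemma peirce_partner:
  assumes p: "T p = 1" "N p = 0"
    and X: "\<And>x. x \<in> X \<Longrightarrow> T x = 0 \<and> b x p = 0 \<and> p \<cdot> x = x"
    and n: "T n = 0" "b n p = 0" "p \<cdot> n = n" "n \<notin> vs.span X"
  obtains m where "T m = 0" "b m p = 0" "p \<cdot> m = 0" "N m = 0" "b m n = - 1"
    "\<And>x. x \<in> X \<Longrightarrow> b m x = 0"
proof -
  \<comment> \<open>The polar form is non-degenerate on \<open>F + F p\<close>, and \<open>X\<close>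
    and \<open>n\<close> are orthogonal to this plane, so adjoining \<open>e, p\<close> to
    \<open>X\<close> does not capture \<open>n\<close>.\<close>
  have "n \<notin> vs.span ({e, p} \<union> X)"
  proof
    assume "n \<in> vs.span ({e, p} \<union> X)"
    then obtain d x where dx: "d \<in> vs.span {e, p}" "x \<in> vs.span X" "n = d + x"
      unfolding vs.span_Un by blast
    have x: "b x e = 0 \<and> b x p = 0"
      using dx(2) X by (induction rule: vs.span_induct_alt) (auto simp: polar_lin)
    have "d \<in> generated_line C p" using dx(1) by (simp add: generated_line_eq_span)
    moreover have "b d y = 0" if "y \<in> generated_line C p" for y
    proof -
      have d: "d = n - x" using dx(3) by simp
      have "T d = 0" "b d p = 0" using n x unfolding d by (simp_all add: polar_lin)
      then show ?thesis using that by (auto simp: generated_line_def polar_lin)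
    qed
    ultimately have "d = 0"
      using nonsingular_generated_line[OF idempotent_disc[OF p]]
      unfolding nonsingular_subalgebra_def by blast
    then show False using dx n(4) by simp
  qed
  then obtain y where y: "b y n = 1" "\<And>x. x \<in> vs.span ({e, p} \<union> X) \<Longrightarrow> b y x = 0"
    using separation[OF vs.subspace_span] by metis
  have yp: "T y = 0" "b y p = 0" and yX: "\<And>x. x \<in> X \<Longrightarrow> b y x = 0"
    using y(2) by (auto simp: vs.span_base)
  define m where "m = p \<cdot> y - y"
  have bpy: "b (p \<cdot> y) x = b y x - b y (p \<cdot> x)" for x
    using adjoint_left[of p y x] p by (simp add: mul_lin polar_lin)
  have pp: "p \<cdot> p = p" using quadratic[of p] p by simp
  have m: "b m x = - b y (p \<cdot> x)" for x by (simp add: m_def polar_lin bpy)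
  show ?thesis
  proof
    show "T m = 0" "b m p = 0" using yp pp by (simp_all add: m)
    show "p \<cdot> m = 0" using left_alternative[of p y] p by (simp add: m_def mul_lin)
    have "m = - (cj p \<cdot> y)" using p by (simp add: m_def mul_lin)
    then show "N m = 0" using p by (simp add: N_mul N_diff polar_commute)
    show "b m n = - 1" using n y by (simp add: m)
    show "b m x = 0" if "x \<in> X" for x using X[OF that] yX[OF that] by (simp add: m)
  qed
qed

lemma peirce_mul_right:
  assumes "T p = 1" "T x = 0" "b x p = 0" shows "x \<cdot> p = x - p \<cdot> x"
  using mul_commute[of x p] assms by (simp add: polar_commute)

text \<open>Left multiplication by \<open>p\<close> multiplies the polar form by
  \<open>N p = 0\<close>, yet it fixes \<open>x\<close> and \<open>y\<close>. The next lemma is the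
  same argument for \<open>e - p\<close>.\<close>

lemma peirce_isotropic:
  assumes "T p = 1" "N p = 0" "p \<cdot> x = x" "p \<cdot> y = y"
  shows "b x y = 0"
  using polar_mul_left[of p x y] assms by simp

lemma peirce_isotropic':
  assumes "T p = 1" "N p = 0" "p \<cdot> x = 0" "p \<cdot> y = 0"
  shows "b x y = 0"
proof -
  have "N (e - p) = 0" using assms by (simp add: N_diff polar_commute)
  then show ?thesis
    using polar_mul_left[of "e - p" x y] assms by (simp add: mul_lin)
qed

text \<open>With a partner \<open>m\<close> of \<open>n\<close>, the element
  \<open>q = n + m\<close> has norm \<open>- 1\<close> and satisfies
  \<open>p \<cdot> q = n\<close>.\<close>

lemma peirce_pair_identification:
  assumes p: "T p = 1" "N p = 0" and n: "T n = 0" "b n p = 0" "p \<cdot> n = n" "n \<noteq> 0"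
  obtains \<phi> where "split_identification C \<phi>" "\<phi> (p\<^sub>0, 0) = p" "\<phi> (n\<^sub>0, 0) = n"
proof -
  obtain m where m: "T m = 0" "b m p = 0" "p \<cdot> m = 0" "N m = 0" "b m n = - 1"
    using peirce_partner[OF p, of "{}" n] n by auto
  have Nn: "N n = 0" using N_mul[of p n] n p by simp
  obtain r where r: "split_triple C p (n + m) r"
  proof (rule complete_split_triple[OF p, of "n + m"])
    show "T (n + m) = 0" "b (n + m) p = 0" using n m by (simp_all add: polar_lin)
    show "N (n + m) = - 1" using n m Nn by (simp add: N_add polar_commute)
  qed
  show ?thesis
    by (rule split_triple_identification[OF r]) (use n m that in \<open>simp add: mul_lin\<close>)
qed

lemma right_swap: "(z \<cdot> x) \<cdot> y = z \<cdot> (T x \<star> y + T y \<star> x - b x y \<star> e) - (z \<cdot> y) \<cdot> x"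
  using right_linearized[of z x y] unfolding anticommutator by (simp add: algebra_simps)

text \<open>\<open>x \<cdot> t\<close> is an idempotent that fixes \<open>x\<close> from the left,
  so \<open>x\<close> lies in the 1-eigenspace of a suitable \<open>p\<close>.\<close>

lemma nilpotent_peirce:
  assumes x: "T x = 0" "N x = 0" and t: "b x t = - 1"
  shows "T (x \<cdot> t) = 1" "N (x \<cdot> t) = 0" "(x \<cdot> t) \<cdot> x = x" "b x (x \<cdot> t) = 0"
proof -
  show "T (x \<cdot> t) = 1" "N (x \<cdot> t) = 0" using x t by (simp_all add: T_mul N_mul)
  show "b x (x \<cdot> t) = 0" using polar_mul_left[of x e t] x by simp
  have xx: "x \<cdot> x = 0" using x by (simp add: quadratic)
  show "(x \<cdot> t) \<cdot> x = x"
    using right_swap[of x t x] x t xx by (simp add: mul_lin polar_commute)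
qed

lemma nilpotent_identification:
  assumes x: "T x = 0" "N x = 0" "x \<noteq> 0"
  obtains \<phi> where "split_identification C \<phi>" "\<phi> (n\<^sub>0, 0) = x"
proof -
  obtain y where y: "b x y \<noteq> 0" using nondegenerate[of x] x by blast
  define t where "t = (- 1 / b x y) \<star> y"
  have "b x t = - 1" using y by (simp add: t_def polar_lin)
  note n = nilpotent_peirce[OF x(1,2) this]
  show ?thesis
    using peirce_pair_identification[OF n(1,2) x(1) n(4,3) x(3)] that by blast
qed

text \<open>In the model, \<open>p\<^sub>0\<close> fixes \<open>(0, p\<^sub>0)\<close> and
  annihilates \<open>(0, n\<^sub>0)\<close> from the left. Accordingly an idempotent
  \<open>p\<close> with \<open>p \<cdot> x = x\<close> and \<open>p \<cdot> y = 0\<close> is needed,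
  together with \<open>r\<close> and \<open>u = p \<cdot> q\<close> such that
  \<open>p \<cdot> r = x\<close> and \<open>u \<cdot> r = y\<close>.\<close>

lemma null_pair_identification:
  assumes x: "T x = 0" "N x = 0" "x \<notin> vs.span {y}" and y: "T y = 0" "N y = 0" "y \<noteq> 0"
    and xy: "x \<cdot> y = 0"
  obtains \<phi> where "split_identification C \<phi>" "\<phi> (0, p\<^sub>0) = x" "\<phi> (0, n\<^sub>0) = y"
proof -
  have bxy: "b x y = 0" using T_mul[of x y] x y xy by simp
  obtain s where s: "b s x = 1" "\<And>z. z \<in> vs.span {y} \<Longrightarrow> b s z = 0"
    using separation[OF vs.subspace_span x(3)] by metis
  have sy: "b s y = 0" using s(2) by (simp add: vs.span_base)
  \<comment> \<open>The factor \<open>- s\<close> pairs to \<open>- 1\<close> with \<open>x\<close>,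
    so \<open>p\<close> fixes \<open>x\<close>; as \<open>s\<close> is orthogonal to
    \<open>y\<close> and \<open>x \<cdot> y = 0\<close>, it annihilates \<open>y\<close>.\<close>
  define p where "p = x \<cdot> (- s)"
  have "b x (- s) = - 1" using s by (simp add: polar_commute)
  note n = nilpotent_peirce[OF x(1,2) this, folded p_def]
  have x0: "x \<noteq> 0" using x(3) vs.span_zero by auto
  have py: "p \<cdot> y = 0"
    using right_swap[of x s y] xy y sy by (simp add: p_def mul_lin)
  have byp: "b y p = 0"
    using adjoint_left[of x "- s" y] xy x by (simp add: p_def polar_commute mul_lin)
  obtain t where t: "T t = 0" "b t p = 0" "p \<cdot> t = 0" "N t = 0" "b t x = - 1"
    using peirce_partner[OF n(1,2), of "{}" x] x x0 n by auto
  have bty: "b t y = 0" by (rule peirce_isotropic'[OF n(1,2) t(3) py])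
  \<comment> \<open>Solution of \<open>u \<cdot> (x + t) = y\<close>: the element
    \<open>x + t\<close> has trace zero and norm \<open>- 1\<close>, so it squares to
    \<open>e\<close>, and \<open>u\<close> must be
    \<open>y \<cdot> (x + t) = y \<cdot> t = - (t \<cdot> y)\<close>.\<close>
  define u where "u = - (t \<cdot> y)"
  have pu: "p \<cdot> u = u"
    using perp_left_swap[OF t(1,2), of y] py n(1) by (simp add: u_def mul_lin)
  have Tu: "T u = 0" using T_mul[of t y] t y bty by (simp add: u_def)
  have bup: "b u p = 0"
    using adjoint_left[of t y p] peirce_mul_right[OF n(1) t(1,2)] t bty
    by (simp add: u_def polar_commute mul_lin)
  have ux: "u \<cdot> x = y"
  proof -
    have "(t \<cdot> y) \<cdot> x = - ((t \<cdot> x) \<cdot> y)"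
      using right_swap[of t y x] x y bxy by (simp add: polar_commute)
    also have "t \<cdot> x = e - x \<cdot> t" using mul_commute[of t x] t x by (simp add: polar_commute)
    also have "(x \<cdot> t) \<cdot> y = 0"
      using right_swap[of x t y] xy t y bty by (simp add: mul_lin)
    then have "(e - x \<cdot> t) \<cdot> y = y" by (simp add: mul_lin)
    finally show ?thesis by (simp add: u_def)
  qed
  have ut: "u \<cdot> t = 0"
  proof -
    have "(t \<cdot> y) \<cdot> t = t \<cdot> (y \<cdot> t)" by (rule flexible)
    also have "y \<cdot> t = - (t \<cdot> y)" using mul_commute[of y t] t y bty by (simp add: polar_commute)
    finally show ?thesis using left_alternative[of t y] t by (simp add: u_def)
  qed
  have but: "b u t = 0" using T_mul[of u t] ut Tu by simp
  have uspan: "u \<notin> vs.span {x}"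
  proof
    assume "u \<in> vs.span {x}"
    then obtain k where "u = k \<star> x" by (auto simp: vs.span_singleton)
    then have "u \<cdot> x = 0" using x by (simp add: mul_lin quadratic)
    then show False using ux y by simp
  qed
  obtain m where m: "T m = 0" "b m p = 0" "p \<cdot> m = 0" "N m = 0" "b m u = - 1" "b m x = 0"
    using peirce_partner[OF n(1,2), of "{x}" u] uspan Tu bup pu n x by auto
  have bxu: "b x u = 0" by (rule peirce_isotropic[OF n(1,2,3) pu])
  have btm: "b t m = 0" by (rule peirce_isotropic'[OF n(1,2) t(3) m(3)])
  have Nu: "N u = 0" using N_mul[of p u] pu n by simp
  have pq: "p \<cdot> (u + m) = u" using pu m by (simp add: mul_lin)
  have "split_triple C p (u + m) (x + t)"
  proof (rule split_tripleI)
    show "T p = 1" "N p = 0" by fact+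
    show "T (u + m) = 0" "b (u + m) p = 0" "T (x + t) = 0" "b (x + t) p = 0"
      using Tu m bup n x t by (simp_all add: polar_lin)
    show "N (u + m) = - 1" using Nu m by (simp add: N_add polar_commute)
    show "N (x + t) = - 1" using x t by (simp add: N_add polar_commute)
    show "b (x + t) (u + m) = 0" using bxu btm but m by (simp add: polar_lin polar_commute)
    show "b (x + t) (p \<cdot> (u + m)) = 0" using bxu but by (simp add: pq polar_lin polar_commute)
  qed
  then show ?thesis
  proof (rule split_triple_identification)
    fix \<phi> assume "split_identification C \<phi>" "\<phi> (0, p\<^sub>0) = p \<cdot> (x + t)"
      "\<phi> (0, n\<^sub>0) = (p \<cdot> (u + m)) \<cdot> (x + t)"
    then show ?thesis using that ux ut t n unfolding pq by (simp add: mul_add_right)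
  qed
qed

lemma heisenberg_pair_facts:
  assumes x: "T x = 0" "N x = 0" and y: "T y = 0" "N y = 0"
    and xy: "b x y = 0" "x \<cdot> y \<noteq> 0"
  shows "y \<cdot> x = - (x \<cdot> y)" "x \<cdot> (x \<cdot> y) = 0" "(x \<cdot> y) \<cdot> x = 0" "(x \<cdot> y) \<cdot> y = 0"
    "y \<cdot> (x \<cdot> y) = 0" "(x \<cdot> y) \<cdot> (x \<cdot> y) = 0" "T (x \<cdot> y) = 0" "x \<cdot> y \<notin> vs.span {x, y}"
    "x \<notin> vs.span {y}" "y \<notin> vs.span {x}"
proof -
  let ?n = "x \<cdot> y"
  show yx: "y \<cdot> x = - ?n" using mul_commute[of y x] x y xy by simp
  show xn: "x \<cdot> ?n = 0" using left_alternative[of x y] x by simp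
  show nx: "?n \<cdot> x = 0" using flexible[of x y] yx xn by simp
  show ny: "?n \<cdot> y = 0" using right_alternative[of x y] y by simp
  show "y \<cdot> ?n = 0" using flexible[of y x] right_alternative[of x y] y yx ny
    by simp
  show "T ?n = 0" using x xy by (simp add: T_mul)
  then show "?n \<cdot> ?n = 0" using quadratic[of ?n] x by (simp add: N_mul)
  have xx: "x \<cdot> x = 0" "y \<cdot> y = 0" using x y by (simp_all add: quadratic)
  \<comment> \<open>Multiplying by \<open>x\<close> from the left and by \<open>y\<close> from the
    right isolates the two coefficients.\<close>
  show "?n \<notin> vs.span {x, y}"
  proof
    assume "?n \<in> vs.span {x, y}"
    then obtain \<alpha> \<beta> where n: "?n = \<alpha> \<star> x + \<beta> \<star> y"
      unfolding vs.span_breakdown_eq by (auto simp: algebra_simps)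
    have "\<beta> \<star> ?n = 0" using xn[unfolded n] xx by (simp add: mul_lin)
    moreover have "\<alpha> \<star> ?n = 0" using ny[unfolded n] xx by (simp add: mul_lin)
    ultimately show False using n xy by simp
  qed
  show "x \<notin> vs.span {y}" "y \<notin> vs.span {x}"
    using xy xx by (auto simp: vs.span_singleton mul_lin)
qed

text \<open>Both \<open>x\<close> and \<open>y\<close> must lie in the 1-eigenspace of
  \<open>p\<close>, as \<open>(n\<^sub>0, 0)\<close> and \<open>(0, p\<^sub>0)\<close> do in the
  model; partners \<open>m\<close> and \<open>k\<close> then complete them to \<open>q\<close> and
  \<open>r\<close>.\<close>

lemma heisenberg_pair_identification:
  assumes x: "T x = 0" "N x = 0" and y: "T y = 0" "N y = 0"
    and xy: "b x y = 0" "x \<cdot> y \<noteq> 0"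
  obtains \<phi> where "split_identification C \<phi>" "\<phi> (n\<^sub>0, 0) = x" "\<phi> (0, p\<^sub>0) = y"
proof -
  let ?n = "x \<cdot> y"
  note h = heisenberg_pair_facts[OF assms]
  obtain s where s: "b s ?n = 1" "\<And>z. z \<in> vs.span {x, y} \<Longrightarrow> b s z = 0"
    using separation[OF vs.subspace_span h(8)] by metis
  have sxy: "b s x = 0" "b s y = 0" using s(2) by (auto simp: vs.span_base)
  \<comment> \<open>\<open>?n \<cdot> s\<close> annihilates \<open>x\<close> and \<open>y\<close>
    and has trace \<open>- 1\<close> and norm zero, so \<open>p\<close> is the complement of the
    idempotent \<open>- (?n \<cdot> s)\<close>.\<close>
  define p where "p = e + ?n \<cdot> s"
  have T: "T (?n \<cdot> s) = - 1" using T_mul[of ?n s] s(1) h(7) polar_commute[of ?n s] by simp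
  have N: "N (?n \<cdot> s) = 0" using x by (simp add: N_mul)
  have p: "T p = 1" "N p = 0" using T N by (simp_all add: p_def polar_lin T_one N_add polar_commute)
  have zero: "(?n \<cdot> s) \<cdot> z = 0 \<and> b z (?n \<cdot> s) = 0" if "T z = 0" "b s z = 0" "?n \<cdot> z = 0" for z
  proof
    show "(?n \<cdot> s) \<cdot> z = 0"
      using right_swap[of ?n s z] that by (simp add: mul_lin)
    show "b z (?n \<cdot> s) = 0"
      using adjoint_left[of ?n s z] h(7) that by (simp add: mul_lin polar_commute)
  qed
  have px: "p \<cdot> x = x" "b x p = 0" using zero[OF x(1) sxy(1) h(3)] x by (simp_all add: p_def mul_lin polar_lin)
  have py: "p \<cdot> y = y" "b y p = 0" using zero[OF y(1) sxy(2) h(4)] y by (simp_all add: p_def mul_lin polar_lin)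
  obtain m where m: "T m = 0" "b m p = 0" "p \<cdot> m = 0" "N m = 0" "b m x = - 1" "b m y = 0"
    using peirce_partner[OF p, of "{y}" x] px py x y h(9) by auto
  obtain k where k: "T k = 0" "b k p = 0" "p \<cdot> k = 0" "N k = 0" "b k y = - 1" "b k x = 0"
    using peirce_partner[OF p, of "{x}" y] px py x y h(10) by auto
  have bkm: "b k m = 0" by (rule peirce_isotropic'[OF p k(3) m(3)])
  have pq: "p \<cdot> (x + m) = x" "p \<cdot> (y + k) = y" using px py m k by (simp_all add: mul_lin)
  have "split_triple C p (x + m) (y + k)"
  proof (rule split_tripleI)
    show "T p = 1" "N p = 0" by fact+
    show "T (x + m) = 0" "b (x + m) p = 0" "T (y + k) = 0" "b (y + k) p = 0"
      using x y m k px py by (simp_all add: polar_lin)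
    show "N (x + m) = - 1" "N (y + k) = - 1" using x y m k by (simp_all add: N_add polar_commute)
    show "b (y + k) (x + m) = 0" using xy bkm m k by (simp add: polar_lin polar_commute)
    show "b (y + k) (p \<cdot> (x + m)) = 0" using xy k by (simp add: pq polar_lin polar_commute)
  qed
  then show ?thesis
    by (rule split_triple_identification) (use that pq in simp)
qed

end

section \<open>Extending partial isomorphisms to automorphisms\<close>

context octonion
begin

lemma automorphismD:
  assumes "g \<in> automorphisms C"
  shows "g (x + y) = g x + g y" "g (c \<star> x) = c \<star> g x" "g (x \<cdot> y) = g x \<cdot> g y" "bij g"
  using assms by (simp_all add: automorphisms_def alg_iso_def)

lemma identification_automorphism:
  assumes "split_identification C \<phi>" "split_identification C \<psi>"
  shows "\<psi> \<circ> inv \<phi> \<in> automorphisms C" "(\<psi> \<circ> inv \<phi>) (\<phi> u) = \<psi> u"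
proof -
  show "\<psi> \<circ> inv \<phi> \<in> automorphisms C"
    using assms alg_iso_compose alg_iso_inv unfolding split_identification_def automorphisms_def by blast
  have "bij \<phi>" using assms by (simp add: split_identification_def alg_iso_def)
  then show "(\<psi> \<circ> inv \<phi>) (\<phi> u) = \<psi> u" by (simp add: bij_def)
qed

lemma in_orbit_of_modelI:
  assumes "split C UNIV" "split_identification C \<psi>" "\<psi> ` S = A"
  shows "in_orbit_of_model C A S"
proof -
  have "same_orbit C (\<phi> ` S) A" if "split_identification C \<phi>" for \<phi>
  proof -
    have "(\<psi> \<circ> inv \<phi>) ` \<phi> ` S = \<psi> ` S"
      unfolding image_image
      by (rule image_cong[OF refl]) (rule identification_automorphism(2)[OF that assms(2)])
    then show ?thesis
      using identification_automorphism(1)[OF that assms(2)] assms(3) unfolding same_orbit_def by blast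
  qed
  then show ?thesis using assms by (simp add: in_orbit_of_model_def)
qed

lemma identificationD:
  assumes "split_identification C \<phi>"
  shows "\<phi> (u + v) = \<phi> u + \<phi> v" "\<phi> (scal split_octonions c u) = c \<star> \<phi> u"
    "\<phi> (mul split_octonions u v) = \<phi> u \<cdot> \<phi> v" "bij \<phi>" "N (\<phi> u) = nrm split_octonions u"
    "\<phi> 0 = 0" "\<phi> (mat 1, 0) = e"
proof -
  show add: "\<phi> (u + v) = \<phi> u + \<phi> v" and "\<phi> (scal split_octonions c u) = c \<star> \<phi> u"
    and mul: "\<And>u v. \<phi> (mul split_octonions u v) = \<phi> u \<cdot> \<phi> v" and bij: "bij \<phi>"
    and "N (\<phi> u) = nrm split_octonions u" for u v
    using assms unfolding split_identification_def alg_iso_def by blast+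
  show "\<phi> 0 = 0" using add[of 0 0] by simp
  obtain u where u: "\<phi> u = e" using bij by (metis bij_pointE)
  have "\<phi> (mul split_octonions (mat 1, 0) u) = \<phi> (mat 1, 0) \<cdot> e" using mul u by simp
  moreover have "mul split_octonions (mat 1, 0) u = u"
    using split_octonions.one_mul[of u] by simp
  ultimately show "\<phi> (mat 1, 0) = e" using u by simp
qed

text \<open>Version for a map that is linear on \<open>B\<close> only: it is replaced by a linear
  map of the whole space that agrees with it on a basis of \<open>B\<close>.\<close>

lemma witt_on_subspace:
  assumes B: "vs.subspace B" and f: "\<And>x y. x \<in> B \<Longrightarrow> y \<in> B \<Longrightarrow> f (x + y) = f x + f y"
    "\<And>c x. x \<in> B \<Longrightarrow> f (c \<star> x) = c \<star> f x" "\<And>x. x \<in> B \<Longrightarrow> N (f x) = N x" "inj_on f B"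
  obtains g where "isometry g" "\<And>x. x \<in> B \<Longrightarrow> g x = f x"
proof -
  obtain S where S: "S \<subseteq> B" "vs.independent S" "B \<subseteq> vs.span S"
    by (rule vs.basis_exists[of B])
  have spS: "vs.span S = B" using vs.span_minimal[OF S(1) B] S(3) by blast
  interpret pp: vector_space_pair "scal C" "scal C" by unfold_locales
  obtain h where h: "Vector_Spaces.linear (scal C) (scal C) h" "\<And>x. x \<in> S \<Longrightarrow> h x = f x"
    using pp.linear_independent_extend[OF S(2), of f] by blast
  interpret l: Vector_Spaces.linear "scal C" "scal C" h by fact
  have "0 \<in> B" using B by (rule vs.subspace_0)
  then have f0: "f 0 = 0" using f(2)[of 0 0] by simp
  have hf: "x \<in> B \<and> h x = f x" if "x \<in> vs.span S" for x
    using that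
  proof (induction rule: vs.span_induct_alt)
    case (step c x y)
    have "x \<in> B" using step S by blast
    then show ?case
      using step B f h(2)[of x] by (auto simp: l.add l.scale vs.subspace_add vs.subspace_scale)
  qed (simp add: \<open>0 \<in> B\<close> f0 l.zero)
  have "inj_on h (vs.span S)" using f(4) hf spS by (auto simp: inj_on_def)
  moreover have "N (h x) = N x" if "x \<in> vs.span S" for x using hf[OF that] f(3) by simp
  ultimately obtain g where "isometry g" "\<forall>x\<in>vs.span S. g x = h x"
    using witt_extension[OF fd.finiteI_independent[OF S(2)] S(2) h(1)] by blast
  then show ?thesis using that hf spS by auto
qed

text \<open>\<open>coords S\<close> is injective on \<open>B\<close> by non-degeneracy of
  \<open>B\<close>, hence maps \<open>B\<close> onto itself; the vector of \<open>B\<close> with the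
  same \<open>coords\<close> as \<open>y\<close> is the projection.\<close>

lemma projection:
  assumes B: "vs.subspace B" "\<And>x. x \<in> B \<Longrightarrow> (\<And>y. y \<in> B \<Longrightarrow> b x y = 0) \<Longrightarrow> x = 0"
  obtains h where "h \<in> B" "y - h \<in> perp C B"
proof -
  obtain S where S: "S \<subseteq> B" "vs.independent S" "B \<subseteq> vs.span S"
    by (rule vs.basis_exists[of B])
  have spS: "vs.span S = B" using vs.span_minimal[OF S(1) B(1)] S(3) by blast
  have fin: "finite S" using S fd.finiteI_independent by blast
  interpret l: Vector_Spaces.linear "scal C" "scal C" "coords S" by (rule linear_coords)
  interpret fp: finite_dimensional_vector_space_pair_1 "scal C" some_basis "scal C" by unfold_locales
  have in_B: "coords S x \<in> B" for x
    unfolding coords_def spS[symmetric] by (intro vs.span_sum vs.span_scale vs.span_base)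
  have zero: "b s x = 0" if "coords S x = 0" "s \<in> S" for s x
    using vs.independentD[OF S(2) fin subset_refl _ that(2), of "\<lambda>s. b s x"] that(1)
    by (simp add: coords_def)
  have "x = 0" if "x \<in> B" "coords S x = 0" for x
  proof (rule B(2)[OF that(1)])
    fix z assume "z \<in> B"
    then have "b z x = 0" using perp_span[of z S x] zero[OF that(2)] spS by blast
    then show "b x z = 0" by (simp only: polar_commute)
  qed
  then have inj: "inj_on (coords S) B"
    using B(1) by (intro inj_onI) (metis l.diff right_minus_eq vs.subspace_diff)
  have "coords S ` B = B"
  proof (rule fd.subspace_dim_equal)
    show "vs.subspace (coords S ` B)" by (rule l.subspace_image[OF B(1)])
    show "coords S ` B \<subseteq> B" using in_B by blast
    have "vs.dim (coords S ` B) = vs.dim B"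
      using inj B(1) by (intro fp.dim_image_eq linear_coords) (simp add: vs.span_eq_iff[THEN iffD2])
    then show "vs.dim B \<le> vs.dim (coords S ` B)" by simp
  qed (rule B(1))
  then obtain h where h: "h \<in> B" "coords S h = coords S y" using in_B[of y] by (metis imageE)
  have "coords S (y - h) = 0" using h by (simp add: l.diff)
  have "b (y - h) z = 0" if "z \<in> B" for z
    using perp_span[of z S "y - h"] zero[OF \<open>coords S (y - h) = 0\<close>] spS that
    unfolding polar_commute[of "y - h" z] by blast
  then show ?thesis using that h by (simp add: perp_def)
qed

text \<open>If all of \<open>A \<inter> perp C B\<close> were singular, the polar form would vanish
  there. Then the component orthogonal to \<open>B\<close> of any vector of \<open>A\<close> would
  be orthogonal to all of \<open>A\<close>, hence zero, and \<open>A = B\<close>.\<close>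

lemma anisotropic_in_perp:
  assumes A: "vs.subspace A" "\<And>x. x \<in> A \<Longrightarrow> (\<And>y. y \<in> A \<Longrightarrow> b x y = 0) \<Longrightarrow> x = 0"
    and B: "vs.subspace B" "\<And>x. x \<in> B \<Longrightarrow> (\<And>y. y \<in> B \<Longrightarrow> b x y = 0) \<Longrightarrow> x = 0"
    and sub: "B \<subset> A"
  obtains c where "c \<in> A" "c \<in> perp C B" "N c \<noteq> 0"
proof (rule ccontr)
  assume "\<not> thesis"
  then have N0: "N c = 0" if "c \<in> A" "c \<in> perp C B" for c using that \<open>\<And>c. \<lbrakk>c \<in> A; c \<in> perp C B; N c \<noteq> 0\<rbrakk> \<Longrightarrow> thesis\<close> by blast
  obtain y where y: "y \<in> A" "y \<notin> B" using sub by auto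
  obtain h where h: "h \<in> B" "y - h \<in> perp C B" using projection[OF B] by blast
  have in_A: "y - h \<in> A" using y h sub A(1) by (intro vs.subspace_diff) auto
  have "y - h = 0"
  proof (rule A(2)[OF in_A])
    fix z assume z: "z \<in> A"
    obtain k where k: "k \<in> B" "z - k \<in> perp C B" using projection[OF B] by blast
    have "z - k \<in> A" using z k sub A(1) by (intro vs.subspace_diff) auto
    then have "N (y - h) = 0" "N (z - k) = 0" "N ((y - h) + (z - k)) = 0"
      using N0 h k in_A A(1) subspace_perp by (auto intro!: N0 vs.subspace_add)
    then have "b (y - h) (z - k) = 0" by (simp add: N_add)
    moreover have "b (y - h) k = 0" using h k by (simp add: perp_def)
    ultimately show "b (y - h) z = 0" using polar_add_right[of "y - h" "z - k" k] by simp
  qed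
  then show False using y h by simp
qed

lemma nonsingular_subalgebraD:
  assumes "nonsingular_subalgebra C B"
  shows "vs.subspace B" "\<And>x. x \<in> B \<Longrightarrow> (\<And>y. y \<in> B \<Longrightarrow> b x y = 0) \<Longrightarrow> x = 0"
  using assms by (auto simp: nonsingular_subalgebra_def subalgebra_def)

lemma embedding_isometry:
  assumes B: "nonsingular_subalgebra C B" and f: "embedding C C B f"
  obtains g where "isometry g" "\<And>x. x \<in> B \<Longrightarrow> g x = f x"
proof -
  note sB = nonsingular_subalgebraD(1)[OF B]
  have f': "f (x + y) = f x + f y" "f (c \<star> x) = c \<star> f x" "N (f x) = N x" if "x \<in> B" "y \<in> B" for x y c
    using f that by (simp_all add: embedding_def)
  have polar: "b (f x) (f y) = b x y" if "x \<in> B" "y \<in> B" for x y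
    using f'(3)[of "x + y"] f'(1,3) that vs.subspace_add[OF sB that] by (simp add: N_add)
  have "inj_on f B"
  proof (rule inj_onI)
    fix x y assume xy: "x \<in> B" "y \<in> B" "f x = f y"
    have "x - y = 0"
    proof (rule nonsingular_subalgebraD(2)[OF B])
      show "x - y \<in> B" using xy sB by (simp add: vs.subspace_diff)
      show "b (x - y) z = 0" if "z \<in> B" for z
        using polar[OF xy(1) that] polar[OF xy(2) that] xy(3) by (simp add: polar_lin)
    qed
    then show "x = y" by simp
  qed
  then show ?thesis using witt_on_subspace[OF sB, of f] f' that by metis
qed

lemma dim_cayley_pair:
  assumes "4 * N p \<noteq> (T p)\<^sup>2" "q \<in> perp C (generated_line C p)" "N q \<noteq> 0"
  shows "vs.dim (double C (generated_line C p) q) = 4"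
  using dim_double[OF nonsingular_generated_line[OF assms(1)] assms(2,3)] dim_generated_line[OF assms(1)]
  by simp

lemma UNIV_nonsingular: "vs.subspace UNIV" "x \<in> UNIV \<Longrightarrow> (\<And>y. y \<in> UNIV \<Longrightarrow> b x y = 0) \<Longrightarrow> x = 0"
  using nondegenerate by (auto simp: vs.subspace_UNIV)

text \<open>A third member \<open>r\<close> exists by \<open>anisotropic_in_perp\<close>. Its
  counterpart is its image under a Witt extension of the isomorphism of quaternion algebras, which
  has the required norm and orthogonality.\<close>

lemma cayley_pair_automorphism:
  assumes p: "4 * N p \<noteq> (T p)\<^sup>2" and q: "T q = 0" "b q p = 0" "N q \<noteq> 0"
    and p': "T p' = T p" "N p' = N p" and q': "T q' = 0" "b q' p' = 0" "N q' = N q"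
  obtains g where "g \<in> automorphisms C" "g p = p'" "g q = q'"
proof -
  interpret pr: octonion_pair C C by unfold_locales
  let ?L = "generated_line C p" and ?L' = "generated_line C p'"
  have qp: "q \<in> perp C ?L" "q' \<in> perp C ?L'" using q q' by (simp_all add: perp_generated_line)
  have disc': "4 * N p' \<noteq> (T p')\<^sup>2" using p p' by simp
  obtain f where f: "embedding C C ?L f" "f p = p'" "f ` ?L = ?L'"
    using pr.embedding_generated_line[OF p p'] by blast
  note L = nonsingular_generated_line[OF p]
  obtain h where h: "embedding C C (double C ?L q) h"
    "\<And>x. x \<in> ?L \<Longrightarrow> h x = f x" "h q = q'" "h ` double C ?L q = double C ?L' q'"
    using pr.embedding_double[OF L f(1) qp(1) q(3), of q'] qp(2) q'(3) f(3) by metis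
  note H = nonsingular_double[OF L qp(1) q(3)]
  note HD = nonsingular_subalgebraD[OF H]
  have "double C ?L q \<noteq> UNIV"
    using dim_cayley_pair[OF p qp(1) q(3)] dim_UNIV by auto
  then obtain r where r: "r \<in> perp C (double C ?L q)" "N r \<noteq> 0"
    using anisotropic_in_perp[OF UNIV_nonsingular HD] by (metis top.not_eq_extremum)
  obtain G where G: "isometry G" "\<And>x. x \<in> double C ?L q \<Longrightarrow> G x = h x"
    using embedding_isometry[OF H h(1)] by blast
  have "b (G r) (G x) = 0" if "x \<in> double C ?L q" for x
    using r(1) that by (simp add: isometry_polar[OF G(1)] perp_def)
  then have "G r \<in> perp C (double C ?L' q')"
    using G(2) unfolding h(4)[symmetric] by (auto simp: perp_def)
  then have "cayley_triple C p q r" "cayley_triple C p' q' (G r)"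
    using p disc' qp q q' r by (simp_all add: cayley_triple_def isometry_N[OF G(1)])
  then obtain g where "alg_iso C UNIV C UNIV g" "g p = p'" "g q = q'"
    using pr.cayley_triple_iso[of p q r p' q' "G r"] p' q'(3) isometry_N[OF G(1), of r] by metis
  then show ?thesis using that by (simp add: automorphisms_def)
qed

lemma separable_element_automorphism:
  assumes p: "4 * N p \<noteq> (T p)\<^sup>2" and p': "T p' = T p" "N p' = N p"
  obtains g where "g \<in> automorphisms C" "g p = p'"
proof -
  interpret pr: octonion_pair C C by unfold_locales
  let ?L = "generated_line C p" and ?L' = "generated_line C p'"
  obtain f where f: "embedding C C ?L f" "f p = p'" "f ` ?L = ?L'"
    using pr.embedding_generated_line[OF p p'] by blast
  note L = nonsingular_generated_line[OF p]
  obtain G where G: "isometry G" "\<And>x. x \<in> ?L \<Longrightarrow> G x = f x"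
    using embedding_isometry[OF L f(1)] by blast
  have "?L \<noteq> UNIV" using dim_generated_line[OF p] dim_UNIV by auto
  then obtain q where q: "q \<in> perp C ?L" "N q \<noteq> 0"
    using anisotropic_in_perp[OF UNIV_nonsingular nonsingular_subalgebraD[OF L]]
    by (metis top.not_eq_extremum)
  have Ge: "G e = e" using G(2)[of e] f(1) mem_generated_line by (simp add: embedding_def)
  have Gp: "G p = p'" using G(2)[of p] f(2) mem_generated_line by simp
  have q': "T (G q) = 0" "b (G q) p' = 0" "N (G q) = N q"
    using isometry_polar[OF G(1), of q e] isometry_polar[OF G(1), of q p] q(1)
    by (simp_all add: Ge Gp perp_generated_line isometry_N[OF G(1)])
  show ?thesis
    using cayley_pair_automorphism[OF p _ _ q(2) p' q'] q(1) that by (auto simp: perp_generated_line)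
qed

text \<open>The plane \<open>F + F x\<close> is totally isotropic for the polar form, so it cannot
  start a triple. An element \<open>a\<close> of trace one orthogonal to \<open>x\<close> starts it,
  with \<open>x\<close> as second member; its counterpart is the image under a Witt extension of the
  map from \<open>x\<close> to \<open>x'\<close>.\<close>

lemma inseparable_element_automorphism:
  assumes two: "(2::'f) = 0"
    and x: "T x = 0" "N x \<noteq> 0" "x \<notin> vs.span {e}" and x': "T x' = 0" "N x' = N x" "x' \<notin> vs.span {e}"
  obtains g where "g \<in> automorphisms C" "g x = x'"
proof -
  interpret pp: vector_space_pair "scal C" "scal C" by unfold_locales
  have ind: "vs.independent {x, e}" "vs.independent {x', e}"
    using x x' one_nonzero by (simp_all add: vs.independent_insert)
  have ne: "x \<noteq> e" "x' \<noteq> e" using x x' by (auto simp: vs.span_base)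
  obtain f where f: "Vector_Spaces.linear (scal C) (scal C) f" "\<forall>z\<in>{x, e}. f z = (if z = x then x' else e)"
    using pp.linear_independent_extend[OF ind(1), of "\<lambda>z. if z = x then x' else e"] by blast
  interpret l: Vector_Spaces.linear "scal C" "scal C" f by fact
  have fx: "f x = x'" "f e = e" using f(2) ne by auto
  have elem: "\<exists>s t. z = s \<star> e + t \<star> x" if "z \<in> vs.span {x, e}" for z
    using that generated_line_eq_span[of x] by (auto simp: insert_commute generated_line_def)
  have N: "N (f z) = N z" if "z \<in> vs.span {x, e}" for z
    using elem[OF that] x x'
    by (auto simp: l.add l.scale fx N_add_scal N_scal polar_lin polar_commute[of e])
  have "f z = 0 \<Longrightarrow> z = 0" if zs: "z \<in> vs.span {x, e}" for z
  proof -
    assume z0: "f z = 0"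
    obtain s t where z: "z = s \<star> e + t \<star> x" using elem[OF zs] by blast
    have 1: "t \<star> x' = (- s) \<star> e" using z0 by (simp add: z l.add l.scale fx eq_neg_iff_add_eq_0 add.commute)
    have "t = 0"
    proof (rule ccontr)
      assume "t \<noteq> 0"
      then have "x' = (1 / t) \<star> t \<star> x'" by simp
      also have "\<dots> \<in> vs.span {e}" unfolding 1 by (intro vs.span_scale vs.span_base) simp
      finally show False using x' by simp
    qed
    then show ?thesis using 1 one_nonzero z by simp
  qed
  then have inj: "inj_on f (vs.span {x, e})"
    using l.inj_on_iff_eq_0[OF vs.subspace_span] by blast
  obtain G where G: "isometry G" "\<And>z. z \<in> vs.span {x, e} \<Longrightarrow> G z = f z"
    using witt_on_subspace[OF vs.subspace_span l.add l.scale N inj] by blast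
  have Gx: "G x = x'" "G e = e" using G(2) fx by (simp_all add: vs.span_base)
  have "e \<notin> vs.span {x}"
  proof
    assume "e \<in> vs.span {x}"
    then obtain k where k: "e = k \<star> x" by (auto simp: vs.span_singleton)
    then have "x = (1 / k) \<star> e" using one_nonzero by (cases "k = 0") simp_all
    then have "x \<in> vs.span {e}" by (auto simp: vs.span_singleton)
    then show False using x by simp
  qed
  then obtain a where a: "b a e = 1" "\<And>z. z \<in> vs.span {x} \<Longrightarrow> b a z = 0"
    using separation[OF vs.subspace_span] by metis
  have ax: "b x a = 0" using a(2)[of x] by (simp add: vs.span_base polar_commute)
  \<comment> \<open>Since \<open>4 = 0\<close>, trace one is enough for a non-zero Gram
    determinant.\<close>
  have "(4::'f) = 2 * 2" by simp
  then have "(4::'f) = 0" using two by simp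
  then have disc: "4 * N a \<noteq> (T a)\<^sup>2" using a by simp
  have "T (G a) = T a" "b x' (G a) = 0" "N (G a) = N a"
    using isometry_polar[OF G(1), of a e] isometry_polar[OF G(1), of x a] ax
    by (simp_all add: Gx isometry_N[OF G(1)])
  then show ?thesis
    using cayley_pair_automorphism[OF disc x(1) ax x(2), of "G a" x'] x' that by metis
qed

text \<open>A non-scalar element has non-zero discriminant, or is a scalar plus a nilpotent element,
  or neither; completing the square shows that the last case occurs only in characteristic 2 and
  with trace zero.\<close>

theorem element_automorphism:
  assumes "x \<notin> vs.span {e}" "x' \<notin> vs.span {e}" "T x' = T x" "N x' = N x"
  obtains g where "g \<in> automorphisms C" "g x = x'"
proof (cases "4 * N x = (T x)\<^sup>2")
  case False
  then show ?thesis using separable_element_automorphism assms that by metis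
next
  case disc: True
  show ?thesis
  proof (cases "\<exists>k. T (x - k \<star> e) = 0 \<and> N (x - k \<star> e) = 0")
    case True
    then obtain k where k: "T (x - k \<star> e) = 0" "N (x - k \<star> e) = 0" by blast
    then have k': "T (x' - k \<star> e) = 0" "N (x' - k \<star> e) = 0"
      using assms by (simp_all add: polar_lin N_diff N_scal)
    have "x - k \<star> e \<noteq> 0" "x' - k \<star> e \<noteq> 0"
      using assms by (auto simp: vs.span_singleton)
    then obtain \<phi> \<psi> where \<phi>: "split_identification C \<phi>" "\<phi> (n\<^sub>0, 0) = x - k \<star> e"
      and \<psi>: "split_identification C \<psi>" "\<psi> (n\<^sub>0, 0) = x' - k \<star> e"
      using nilpotent_identification k k' by metis
    let ?g = "\<psi> \<circ> inv \<phi>"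
    have g: "?g \<in> automorphisms C" and gx: "?g (x - k \<star> e) = x' - k \<star> e"
      using identification_automorphism[OF \<phi>(1) \<psi>(1)] \<phi>(2) \<psi>(2) by metis+
    have "?g e = e"
      using identification_automorphism(2)[OF \<phi>(1) \<psi>(1), of "(mat 1, 0)"]
        identificationD(7)[OF \<phi>(1)] identificationD(7)[OF \<psi>(1)] by simp
    then have "?g x = x'"
      using automorphismD(1)[OF g, of "x - k \<star> e" "k \<star> e"] automorphismD(2)[OF g, of k e] gx by simp
    then show ?thesis using g that by blast
  next
    case False
    have two: "(2::'f) = 0"
    proof (rule ccontr)
      assume 2: "(2::'f) \<noteq> 0"
      have "(2::'f) * 2 \<noteq> 0" using 2 by (metis mult_eq_0_iff)
      then have 4: "(4::'f) \<noteq> 0" by simp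
      have "N x = (T x)\<^sup>2 / 4" using disc 4 by (simp add: field_simps)
      then have "T (x - (T x / 2) \<star> e) = 0 \<and> N (x - (T x / 2) \<star> e) = 0"
        using 2 4 by (simp add: polar_lin T_one N_diff N_scal field_simps power2_eq_square)
      then show False using False by blast
    qed
    have "(4::'f) = 2 * 2" by simp
    then have "T x = 0" using disc two by simp
    moreover from this have "N x \<noteq> 0" using False[simplified, rule_format, of 0] by simp
    ultimately show ?thesis using inseparable_element_automorphism[OF two] assms that by metis
  qed
qed

end

section \<open>Subalgebras of dimension three and four\<close>

context octonion
begin

text \<open>Abstract counterpart of \<open>(p\<^sub>0, 0)\<close> and
  \<open>(n\<^sub>0, 0)\<close>.\<close>

definition triangular_pair where
  "triangular_pair p n \<longleftrightarrow> T p = 1 \<and> N p = 0 \<and> T n = 0 \<and> b n p = 0 \<and> p \<cdot> n = n \<and> n \<noteq> 0"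

text \<open>Abstract counterpart of \<open>(0, p\<^sub>0)\<close> and
  \<open>(0, n\<^sub>0)\<close>.\<close>

definition null_pair where
  "null_pair x y \<longleftrightarrow> T x = 0 \<and> N x = 0 \<and> T y = 0 \<and> N y = 0 \<and> x \<cdot> y = 0 \<and> x \<notin> vs.span {y} \<and> y \<noteq> 0"

text \<open>Abstract counterpart of \<open>(0, n\<^sub>0)\<close> and
  \<open>(0, mat 1 - p\<^sub>0)\<close> in \<open>heisenberg_model\<close>, and equally of
  \<open>(n\<^sub>0, 0)\<close> and \<open>(0, p\<^sub>0)\<close>.\<close>

definition heisenberg_pair where
  "heisenberg_pair x y \<longleftrightarrow> T x = 0 \<and> N x = 0 \<and> T y = 0 \<and> N y = 0 \<and> b x y = 0 \<and> x \<cdot> y \<noteq> 0"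

definition quaternion_pair where
  "quaternion_pair p q \<longleftrightarrow> 4 * N p \<noteq> (T p)\<^sup>2 \<and> T q = 0 \<and> b q p = 0 \<and> N q \<noteq> 0"

lemma independent_two: "x \<notin> vs.span {z} \<Longrightarrow> z \<noteq> 0 \<Longrightarrow> vs.independent {z, x} \<and> card {z, x} = 2"
  by (auto simp: vs.independent_insert insert_commute[of z x] vs.span_base card_insert_if)

lemma independent_three:
  assumes "x \<notin> vs.span {z}" "y \<notin> vs.span {z, x}" "z \<noteq> 0"
  shows "vs.independent {z, x, y} \<and> card {z, x, y} = 3"
proof -
  have "y \<notin> {z, x}" using assms(2) vs.span_base[of y "{z, x}"] by blast
  moreover have "{z, x, y} = insert y {z, x}" by auto
  ultimately show ?thesis
    using independent_two[OF assms(1,3)] assms(2) by (simp add: vs.independent_insertI)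
qed

lemma independent_four:
  assumes "x \<notin> vs.span {z}" "y \<notin> vs.span {z, x}" "w \<notin> vs.span {z, x, y}" "z \<noteq> 0"
  shows "vs.independent {z, x, y, w} \<and> card {z, x, y, w} = 4"
proof -
  have "w \<notin> {z, x, y}" using assms(3) vs.span_base[of w "{z, x, y}"] by blast
  moreover have "{z, x, y, w} = insert w {z, x, y}" by auto
  ultimately show ?thesis
    using independent_three[OF assms(1,2,4)] assms(3) by (simp add: vs.independent_insertI)
qed

lemma span_eq_of_dim:
  assumes "vs.subspace A" "S \<subseteq> A" "vs.independent S \<and> card S = vs.dim A"
  shows "A = vs.span S"
proof -
  have "vs.span S \<subseteq> A" using assms by (intro vs.span_minimal) auto
  moreover have "vs.dim (vs.span S) = vs.dim A" using assms by (simp add: vs.dim_eq_card_independent)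
  ultimately show ?thesis
    using fd.subspace_dim_equal[of "vs.span S" A] assms(1) by simp
qed

text \<open>The vectors come as a list because its length bounds the cardinality of the set even
  when entries coincide.\<close>

lemma exists_outside_span:
  assumes "length xs < vs.dim A" obtains x where "x \<in> A" "x \<notin> vs.span (set xs)"
proof -
  have "\<not> A \<subseteq> vs.span (set xs)"
    using vs.dim_le_card[of A "set xs"] assms card_length[of xs] by auto
  then show ?thesis using that by blast
qed

lemma span_coords:
  "z \<in> vs.span {x} \<Longrightarrow> \<exists>\<alpha>. z = \<alpha> \<star> x"
  "z \<in> vs.span {x, y} \<Longrightarrow> \<exists>\<alpha> \<beta>. z = \<alpha> \<star> x + \<beta> \<star> y"
  "z \<in> vs.span {x, y, u} \<Longrightarrow> \<exists>\<alpha> \<beta> \<gamma>. z = \<alpha> \<star> x + \<beta> \<star> y + \<gamma> \<star> u"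
  "z \<in> vs.span {x, y, u, v} \<Longrightarrow> \<exists>\<alpha> \<beta> \<gamma> \<delta>. z = \<alpha> \<star> x + \<beta> \<star> y + \<gamma> \<star> u + \<delta> \<star> v"
  unfolding vs.span_breakdown_eq by (auto simp: algebra_simps)

lemma lin_comb_in_span:
  "\<alpha> \<star> x \<in> vs.span {x}" "\<alpha> \<star> x + \<beta> \<star> y \<in> vs.span {x, y}"
  "\<alpha> \<star> x + \<beta> \<star> y + \<gamma> \<star> u \<in> vs.span {x, y, u}"
  "\<alpha> \<star> x + \<beta> \<star> y + \<gamma> \<star> u + \<delta> \<star> v \<in> vs.span {x, y, u, v}"
  by (intro vs.span_add vs.span_scale vs.span_base; simp)+

text \<open>Multiplying by \<open>x\<close> leaves
  \<open>\<gamma> \<star> (x \<cdot> y) = 0\<close>. If \<open>\<gamma> = 0\<close>, then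
  \<open>x\<close> annihilates \<open>y - \<beta> \<star> e\<close>, whose norm is
  \<open>\<beta>\<^sup>2\<close>, so \<open>\<beta> = 0\<close> unless \<open>x = 0\<close>.\<close>

lemma nilpotent_product:
  assumes "T x = 0" "N x = 0" "T y = 0" "N y = 0" "x \<cdot> y = \<beta> \<star> x + \<gamma> \<star> y"
  shows "x \<cdot> y = 0"
proof -
  have "x \<cdot> x = 0" using assms by (simp add: quadratic)
  moreover have "x \<cdot> (x \<cdot> y) = 0" using left_alternative[of x y] assms by simp
  ultimately have "\<gamma> \<star> (x \<cdot> y) = 0" using arg_cong[OF assms(5), of "\<lambda>z. x \<cdot> z"] by (simp add: mul_lin)
  moreover have "x \<cdot> y = 0" if "\<gamma> = 0"
  proof (cases "x = 0")
    case False
    have "x \<cdot> (y - \<beta> \<star> e) = 0" using assms(5) that by (simp add: mul_lin)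
    then have "N (y - \<beta> \<star> e) = 0" using mul_eq_0_N False by blast
    then have "\<beta> = 0" using assms by (simp add: N_diff N_scal polar_lin)
    then show ?thesis using assms(5) that by simp
  qed simp
  ultimately show ?thesis by auto
qed

text \<open>Otherwise \<open>(x - \<gamma>) y \<in> F + F x\<close> for some \<open>\<gamma>\<close>, and \<open>x - \<gamma>\<close> is invertible in
  the field \<open>F + F x\<close>.\<close>

lemma product_outside_span:
  assumes y: "y \<notin> vs.span {e, x}" and aniso: "\<And>\<gamma>. N (x - \<gamma> \<star> e) \<noteq> 0"
  shows "x \<cdot> y \<notin> vs.span {e, x, y}"
proof
  assume "x \<cdot> y \<in> vs.span {e, x, y}"
  then obtain \<alpha> \<beta> \<gamma> where xy: "x \<cdot> y = \<alpha> \<star> e + \<beta> \<star> x + \<gamma> \<star> y" using span_coords(3) by blast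
  let ?u = "x - \<gamma> \<star> e"
  have "?u \<cdot> y = \<alpha> \<star> e + \<beta> \<star> x" by (simp add: xy mul_lin)
  then have "N ?u \<star> y = cj ?u \<cdot> (\<alpha> \<star> e + \<beta> \<star> x)" using cj_mul_mul[of ?u y] by simp
  also have "\<dots> \<in> generated_line C x"
  proof -
    have x: "x \<in> generated_line C x" "e \<in> generated_line C x" by (fact mem_generated_line)+
    note L = subalgebraD[OF subalgebra_generated_line[of x]]
    have "cj ?u \<in> generated_line C x"
      by (intro cj_closed subalgebra_generated_line L(4,5) x)
    then show ?thesis by (intro L(1,3,5) x)
  qed
  finally have "(1 / N ?u) \<star> N ?u \<star> y \<in> vs.span {e, x}"
    unfolding generated_line_eq_span by (rule vs.span_scale)
  then show False using y aniso[of \<gamma>] by simp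
qed

section \<open>The two radicals of a unital subalgebra\<close>

context
  fixes A
  assumes A: "subalgebra C A" and eA: "e \<in> A"
begin

lemmas cl = subalgebraD[OF A]

lemma cj_in: "x \<in> A \<Longrightarrow> cj x \<in> A"
  using cj_closed[OF A eA] .

lemma bilinear_radicalD: "x \<in> bilinear_radical C A \<Longrightarrow> x \<in> A" "x \<in> bilinear_radical C A \<Longrightarrow> a \<in> A \<Longrightarrow> b x a = 0"
  by (auto simp: bilinear_radical_def perp_def)

lemma quadratic_radicalD:
  assumes "x \<in> quadratic_radical C A"
  shows "x \<in> A" "a \<in> A \<Longrightarrow> b x a = 0" "N x = 0" "T x = 0" "x \<in> bilinear_radical C A"
  using assms eA by (auto simp: quadratic_radical_def perp_def bilinear_radical_def)

lemma quadratic_radicalI: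
  "x \<in> A \<Longrightarrow> (\<And>a. a \<in> A \<Longrightarrow> b x a = 0) \<Longrightarrow> N x = 0 \<Longrightarrow> x \<in> quadratic_radical C A"
  by (auto simp: quadratic_radical_def perp_def)

text \<open>The adjoint of multiplication by \<open>a\<close> is multiplication by
  \<open>cj a\<close>, and \<open>A\<close> is closed under conjugation.\<close>

lemma bilinear_radical_ideal:
  assumes "r \<in> bilinear_radical C A" "a \<in> A"
  shows "a \<cdot> r \<in> bilinear_radical C A" "r \<cdot> a \<in> bilinear_radical C A"
proof -
  have "b (a \<cdot> r) z = 0" "b (r \<cdot> a) z = 0" if "z \<in> A" for z
    unfolding adjoint_left[of a] adjoint_right[of r]
    using that assms cj_in[OF assms(2)] cl(1) bilinear_radicalD by blast+
  then show "a \<cdot> r \<in> bilinear_radical C A" "r \<cdot> a \<in> bilinear_radical C A"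
    using assms cl(1) bilinear_radicalD(1)[OF assms(1)] by (auto simp: bilinear_radical_def perp_def)
qed

lemma quadratic_radical_ideal:
  assumes "r \<in> quadratic_radical C A" "a \<in> A"
  shows "a \<cdot> r \<in> quadratic_radical C A" "r \<cdot> a \<in> quadratic_radical C A"
  using bilinear_radical_ideal[of r a] assms quadratic_radicalD(3,5)[OF assms(1)]
  by (auto simp: quadratic_radical_def bilinear_radical_def N_mul)

lemma subspace_bilinear_radical: "vs.subspace (bilinear_radical C A)"
  unfolding bilinear_radical_def by (intro vs.subspace_inter subspace_perp cl(7))

lemma subspace_quadratic_radical: "vs.subspace (quadratic_radical C A)"
proof (rule vs.subspaceI)
  show "x + y \<in> quadratic_radical C A"
    if "x \<in> quadratic_radical C A" "y \<in> quadratic_radical C A" for x y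
    using that quadratic_radicalD[OF that(1)] quadratic_radicalD[OF that(2)] cl
    by (intro quadratic_radicalI) (simp_all add: N_add polar_lin)
  show "c \<star> x \<in> quadratic_radical C A" if "x \<in> quadratic_radical C A" for c x
    using quadratic_radicalD[OF that] cl by (intro quadratic_radicalI) (simp_all add: N_scal polar_lin)
qed (use cl in \<open>auto intro: quadratic_radicalI\<close>)

lemma one_outside_radical: "k \<star> e \<in> quadratic_radical C A \<Longrightarrow> k = 0"
  using quadratic_radicalD(3)[of "k \<star> e"] by (simp add: N_scal)

text \<open>The quadratic radical is a singular subspace and \<open>N e = 1\<close>, so it meets
  \<open>F\<close> only in zero.\<close>

lemma radical_outside_span:
  assumes "v \<in> quadratic_radical C A" "S \<subseteq> quadratic_radical C A" "v \<notin> vs.span S"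
  shows "v \<notin> vs.span (insert e S)"
proof
  assume "v \<in> vs.span (insert e S)"
  then obtain k where k: "v - k \<star> e \<in> vs.span S" unfolding vs.span_breakdown_eq by blast
  have "vs.span S \<subseteq> quadratic_radical C A"
    using assms(2) subspace_quadratic_radical by (rule vs.span_minimal)
  then have "v - (v - k \<star> e) \<in> quadratic_radical C A"
    using k assms(1) subspace_quadratic_radical by (meson subsetD vs.subspace_diff)
  then have "k = 0" using one_outside_radical by simp
  then show False using k assms(3) by simp
qed

lemma radical_square: "x \<in> quadratic_radical C A \<Longrightarrow> x \<cdot> x = 0"
  using quadratic_radicalD[of x] by (simp add: quadratic)

text \<open>An anisotropic \<open>r\<close> is invertible, and the bilinear radical is an
  ideal.\<close>

lemma whole_radical:
  assumes "r \<in> bilinear_radical C A" "N r \<noteq> 0" shows "bilinear_radical C A = A"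
proof -
  have "a \<in> bilinear_radical C A" if "a \<in> A" for a
  proof -
    have "(a \<cdot> cj r) \<cdot> cj (cj r) = N r \<star> a" using mul_mul_cj[of a "cj r"] unfolding N_cj .
    moreover have "(a \<cdot> cj r) \<cdot> r \<in> bilinear_radical C A"
      using assms(1) that cj_in bilinear_radicalD(1) by (intro bilinear_radical_ideal cl(1)) auto
    ultimately have "N r \<star> a \<in> bilinear_radical C A" unfolding cj_cj by simp
    then have "(1 / N r) \<star> N r \<star> a \<in> bilinear_radical C A"
      using subspace_bilinear_radical by (rule vs.subspace_scale[rotated])
    then show ?thesis using assms(2) by simp
  qed
  then show ?thesis using bilinear_radicalD(1) by blast
qed

lemma isotropic_trace_zero:
  assumes "\<And>p. p \<in> A \<Longrightarrow> T p = 1 \<Longrightarrow> N p \<noteq> 0" "z \<in> A" "N z = 0" shows "T z = 0"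
proof (rule ccontr)
  assume "T z \<noteq> 0"
  then have "T ((1 / T z) \<star> z) = 1" "N ((1 / T z) \<star> z) = 0" using assms(3) by (simp_all add: polar_lin N_scal)
  then show False using assms(1)[of "(1 / T z) \<star> z"] cl(5)[OF assms(2)] by blast
qed

text \<open>In the absence of non-trivial idempotents every singular vector has trace zero. This
  applies to \<open>z\<close> and to \<open>z \<cdot> a\<close>, and
  \<open>b z a = T z * T a - T (z \<cdot> a)\<close>.\<close>

lemma isotropic_in_radical:
  assumes "\<And>p. p \<in> A \<Longrightarrow> T p = 1 \<Longrightarrow> N p \<noteq> 0" "z \<in> A" "N z = 0"
  shows "z \<in> quadratic_radical C A"
proof (rule quadratic_radicalI)
  fix a assume a: "a \<in> A"
  have "T (z \<cdot> a) = 0" using a assms(2,3) cl by (intro isotropic_trace_zero[OF assms(1)]) (auto simp: N_mul)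
  then show "b z a = 0" using T_mul[of z a] isotropic_trace_zero[OF assms] by simp
qed fact+

section \<open>Subalgebras of dimension three\<close>

lemma idempotent_outside_scalars: assumes "T p = 1" "N p = 0" shows "p \<notin> vs.span {e}"
proof
  assume "p \<in> vs.span {e}"
  then obtain k where "p = k \<star> e" using span_coords(1) by blast
  then show False using assms by (auto simp: N_scal polar_lin)
qed

text \<open>A vector \<open>y\<close> of \<open>A\<close> orthogonal to \<open>F + F p\<close> spans
  a line invariant under left multiplication by \<open>p\<close>. The eigenvalue is 0 or 1, and in
  the case 0 the complement \<open>e - p\<close> replaces \<open>p\<close>.\<close>

lemma classification_three_with_idempotent:
  assumes dim: "vs.dim A = 3" and p: "p \<in> A" "T p = 1" "N p = 0"
  obtains q n where "triangular_pair q n" "A = vs.span {e, q, n}"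
proof -
  let ?L = "generated_line C p"
  note disc = idempotent_disc[OF p(2,3)]
  note LD = nonsingular_subalgebraD[OF nonsingular_generated_line[OF disc]]
  have L: "?L = vs.span {e, p}" by (rule generated_line_eq_span)
  have LA: "?L \<subseteq> A" unfolding L using eA p by (intro vs.span_minimal cl(7)) auto
  obtain y0 where y0: "y0 \<in> A" "y0 \<notin> vs.span {e, p}"
    using exists_outside_span[of "[e, p]" A] dim by auto
  obtain h where h: "h \<in> ?L" "y0 - h \<in> perp C ?L" using projection[OF LD] by blast
  define y where "y = y0 - h"
  have y: "y \<in> A" "T y = 0" "b y p = 0"
    using y0 h LA cl(4) by (auto simp: y_def perp_generated_line)
  have yL: "y \<notin> vs.span {e, p}"
  proof
    assume "y \<in> vs.span {e, p}"
    then have "y + h \<in> vs.span {e, p}" using h(1) unfolding L by (rule vs.span_add)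
    then show False using y0 by (simp add: y_def)
  qed
  have pe: "p \<notin> vs.span {e}" by (rule idempotent_outside_scalars[OF p(2,3)])
  have Aeq: "A = vs.span {e, p, y}"
    using independent_three[OF pe yL one_nonzero] dim y p eA by (intro span_eq_of_dim cl(7)) auto
  have "p \<cdot> y \<in> A" using p(1) y(1) by (rule cl(1))
  then obtain \<alpha> \<beta> \<gamma> where py: "p \<cdot> y = \<alpha> \<star> e + \<beta> \<star> p + \<gamma> \<star> y"
    unfolding Aeq using span_coords(3) by blast
  \<comment> \<open>Both \<open>p \<cdot> y\<close> and \<open>y\<close> are orthogonal to
    \<open>F + F p\<close>, hence so is the component of \<open>p \<cdot> y\<close> in that
    plane.\<close>
  have "\<alpha> \<star> e + \<beta> \<star> p = 0"
  proof (rule LD(2))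
    show "\<alpha> \<star> e + \<beta> \<star> p \<in> ?L" by (auto simp: generated_line_def)
    fix z assume z: "z \<in> ?L"
    have "\<alpha> \<star> e + \<beta> \<star> p = p \<cdot> y - \<gamma> \<star> y" by (simp add: py)
    moreover have "T (p \<cdot> y) = 0" using T_mul[of p y] y polar_commute[of p y] by simp
    moreover have "b (p \<cdot> y) p = 0"
      using adjoint_left[of p y p] y p by (simp add: mul_lin quadratic)
    ultimately have "T (\<alpha> \<star> e + \<beta> \<star> p) = 0" "b (\<alpha> \<star> e + \<beta> \<star> p) p = 0"
      using y by (simp_all only: polar_diff polar_scal_left) simp_all
    then show "b (\<alpha> \<star> e + \<beta> \<star> p) z = 0"
      using z by (auto simp: generated_line_def polar_add_right polar_scal_right)
  qed
  then have py': "p \<cdot> y = \<gamma> \<star> y" by (simp add: py)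
  have y_ne: "y \<noteq> 0" using yL vs.span_zero by auto
  have "(\<gamma> * \<gamma>) \<star> y = \<gamma> \<star> y"
    using left_alternative[of p y] p by (simp add: py' mul_lin)
  then have "\<gamma> * (\<gamma> - 1) = 0" using y_ne by (simp add: algebra_simps)
  then consider "\<gamma> = 1" | "\<gamma> = 0" by auto
  then show ?thesis
  proof cases
    case 1
    then have "triangular_pair p y" using p y y_ne py' by (simp add: triangular_pair_def)
    then show ?thesis using that Aeq by blast
  next
    case 2
    then have "triangular_pair (e - p) y"
      using p y y_ne py' by (simp add: triangular_pair_def polar_lin T_one N_diff polar_commute mul_lin)
    moreover have "A = vs.span {e, e - p, y}"
    proof
      show "A \<subseteq> vs.span {e, e - p, y}" unfolding Aeq
      proof (intro vs.span_minimal vs.subspace_span)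
        have "e - (e - p) \<in> vs.span {e, e - p, y}" by (intro vs.span_diff vs.span_base) auto
        then show "{e, p, y} \<subseteq> vs.span {e, e - p, y}" by (simp add: vs.span_base)
      qed
      show "vs.span {e, e - p, y} \<subseteq> A" using eA p y cl by (intro vs.span_minimal) auto
    qed
    ultimately show ?thesis by (rule that)
  qed
qed

lemma null_pair_in_radical:
  assumes "x \<in> quadratic_radical C A" "y \<in> quadratic_radical C A" "x \<notin> vs.span {y}" "y \<noteq> 0"
    "x \<cdot> y \<in> vs.span {x, y}"
  shows "null_pair x y"
proof -
  obtain \<beta> \<gamma> where "x \<cdot> y = \<beta> \<star> x + \<gamma> \<star> y" using assms(5) span_coords(2) by blast
  then have "x \<cdot> y = 0"
    using quadratic_radicalD(3,4)[OF assms(1)] quadratic_radicalD(3,4)[OF assms(2)] nilpotent_product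
    by blast
  then show ?thesis
    using assms quadratic_radicalD(3,4)[OF assms(1)] quadratic_radicalD(3,4)[OF assms(2)]
    by (simp add: null_pair_def)
qed

lemma classification_three_isotropic:
  assumes dim: "vs.dim A = 3" and no_idem: "\<And>p. p \<in> A \<Longrightarrow> T p = 1 \<Longrightarrow> N p \<noteq> 0"
    and z: "z \<in> A" "z \<noteq> 0" "N z = 0"
  obtains x y where "null_pair x y" "A = vs.span {e, x, y}"
proof -
  let ?Q = "quadratic_radical C A"
  note inQ = isotropic_in_radical[OF no_idem]
  have zQ: "z \<in> ?Q" using inQ z by blast
  \<comment> \<open>If the radical were \<open>F z\<close>, every \<open>y\<close> in
    \<open>A\<close> would satisfy \<open>z \<cdot> y = k \<star> z\<close> for some
    \<open>k\<close>; then \<open>y - k \<star> e\<close> is singular, hence a multiple of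
    \<open>z\<close>, and \<open>A\<close> would be too small.\<close>
  have "\<exists>x\<in>?Q. x \<notin> vs.span {z}"
  proof (rule ccontr)
    assume "\<not> ?thesis"
    then have Qz: "?Q \<subseteq> vs.span {z}" by blast
    obtain y where y: "y \<in> A" "y \<notin> vs.span {e, z}"
      using exists_outside_span[of "[e, z]" A] dim by auto
    obtain k where k: "z \<cdot> y = k \<star> z"
      using quadratic_radical_ideal(2)[OF zQ y(1)] Qz span_coords(1) by blast
    then have "z \<cdot> (y - k \<star> e) = 0" by (simp add: mul_lin)
    then have "N (y - k \<star> e) = 0" using mul_eq_0_N z by blast
    then have "y - k \<star> e \<in> vs.span {z}" using inQ cl(4)[OF y(1) cl(5)[OF eA]] Qz by blast
    then have "y \<in> vs.span {e, z}" by (auto simp: vs.span_breakdown_eq[of y e])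
    then show False using y by simp
  qed
  then obtain x where x: "x \<in> ?Q" "x \<notin> vs.span {z}" by blast
  have ze: "z \<notin> vs.span {e}" using radical_outside_span[OF zQ, of "{}"] z by simp
  have xe: "x \<notin> vs.span {e, z}" using radical_outside_span[OF x(1), of "{z}"] x zQ by simp
  have Aeq: "A = vs.span {e, z, x}"
    using independent_three[OF ze xe one_nonzero] dim z x eA quadratic_radicalD(1)[OF x(1)]
    by (intro span_eq_of_dim cl(7)) auto
  have xz: "x \<cdot> z \<in> ?Q" using quadratic_radical_ideal(2)[OF x(1) z(1)] .
  have "x \<cdot> z \<in> vs.span {x, z}"
  proof (rule ccontr)
    assume "x \<cdot> z \<notin> vs.span {x, z}"
    then have "x \<cdot> z \<notin> vs.span {e, x, z}" using radical_outside_span[OF xz, of "{x, z}"] x zQ by simp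
    moreover have "x \<cdot> z \<in> A" using quadratic_radicalD(1)[OF xz] .
    ultimately show False unfolding Aeq by (simp add: insert_commute)
  qed
  then have "null_pair x z" using null_pair_in_radical x zQ z by blast
  then show ?thesis using that Aeq by (simp add: insert_commute)
qed

text \<open>An anisotropic \<open>A\<close> cannot occur: by \<open>product_outside_span\<close> it
  would contain a fourth independent vector.\<close>

theorem classification_three:
  assumes dim: "vs.dim A = 3"
  obtains p n where "triangular_pair p n" "A = vs.span {e, p, n}"
  | x y where "null_pair x y" "A = vs.span {e, x, y}"
proof (cases "\<exists>p\<in>A. T p = 1 \<and> N p = 0")
  case True
  then show ?thesis using classification_three_with_idempotent[OF dim] that(1) by metis
next
  case no_idem: False
  have "\<exists>z\<in>A. z \<noteq> 0 \<and> N z = 0"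
  proof (rule ccontr)
    assume aniso: "\<not> ?thesis"
    obtain x where x: "x \<in> A" "x \<notin> vs.span {e}"
      using exists_outside_span[of "[e]" A] dim by auto
    obtain y where y: "y \<in> A" "y \<notin> vs.span {e, x}"
      using exists_outside_span[of "[e, x]" A] dim by auto
    have Aeq: "A = vs.span {e, x, y}"
      using independent_three[OF x(2) y(2) one_nonzero] dim x y eA
      by (intro span_eq_of_dim cl(7)) auto
    have "N (x - k \<star> e) \<noteq> 0" for k
    proof -
      have "x - k \<star> e \<noteq> 0" using x(2) by (auto simp: vs.span_singleton)
      then show ?thesis using aniso cl(4)[OF x(1) cl(5)[OF eA]] by blast
    qed
    then have "x \<cdot> y \<notin> A" unfolding Aeq using product_outside_span[OF y(2)] by blast
    then show False using cl(1)[OF x(1) y(1)] by blast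
  qed
  then show ?thesis using classification_three_isotropic[OF dim] no_idem that(2) by metis
qed

text \<open>The first generator needs a non-zero discriminant. If all discriminants vanished, then
  in characteristic 2 the trace would vanish on \<open>A\<close> and \<open>e\<close> would be
  radical; otherwise all trace-zero elements would be singular and therefore radical. The second
  generator comes from \<open>anisotropic_in_perp\<close>.\<close>

lemma classification_four_nonsingular:
  assumes dim: "vs.dim A = 4" and R: "bilinear_radical C A = {0}"
  obtains p q where "quaternion_pair p q" "A = double C (generated_line C p) q"
proof -
  have nd: "x = 0" if "x \<in> A" "\<And>y. y \<in> A \<Longrightarrow> b x y = 0" for x
    using that R by (auto simp: bilinear_radical_def perp_def)
  have "\<exists>p\<in>A. 4 * N p \<noteq> (T p)\<^sup>2"
  proof (rule ccontr)
    assume "\<not> ?thesis"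
    then have disc: "4 * N p = (T p)\<^sup>2" if "p \<in> A" for p using that by blast
    have four: "(4::'f) = 2 * 2" by simp
    have two: "(2::'f) \<noteq> 0"
    proof
      assume "(2::'f) = 0"
      then have "T p = 0" if "p \<in> A" for p using disc[OF that] four by simp
      then show False using nd[OF eA] one_nonzero by (simp add: polar_commute)
    qed
    have "(2::'f) * 2 \<noteq> 0" using two by (metis mult_eq_0_iff)
    then have N0: "N z = 0" if "z \<in> A" "T z = 0" for z using disc[OF that(1)] that(2) by simp
    define pr where "pr z = z - (T z / 2) \<star> e" for z
    have pr: "pr z \<in> A" "T (pr z) = 0" if "z \<in> A" for z
      using that eA cl two by (simp_all add: pr_def polar_lin T_one)
    obtain x where x: "x \<in> A" "x \<notin> vs.span {e}"
      using exists_outside_span[of "[e]" A] dim by auto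
    have "pr x = 0"
    proof (rule nd[OF pr(1)[OF x(1)]])
      fix y assume y: "y \<in> A"
      have "N (pr x + pr y) = 0" "N (pr x) = 0" "N (pr y) = 0"
        using pr[OF x(1)] pr[OF y] cl by (auto intro!: N0 simp: polar_lin)
      then have "b (pr x) (pr y) = 0" by (simp add: N_add)
      moreover have "y = pr y + (T y / 2) \<star> e" by (simp add: pr_def)
      ultimately show "b (pr x) y = 0"
        using pr(2)[OF x(1)] by (metis polar_add_right polar_scal_right mult_zero_right add_0)
    qed
    then have "x = (T x / 2) \<star> e" by (simp add: pr_def)
    then show False using x(2) lin_comb_in_span(1) by metis
  qed
  then obtain p where p: "p \<in> A" "4 * N p \<noteq> (T p)\<^sup>2" by blast
  let ?L = "generated_line C p"
  note L = nonsingular_generated_line[OF p(2)]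
  have LA: "?L \<subseteq> A" unfolding generated_line_eq_span using eA p by (intro vs.span_minimal cl(7)) auto
  have "?L \<noteq> A" using dim_generated_line[OF p(2)] dim by auto
  then obtain q where q: "q \<in> A" "q \<in> perp C ?L" "N q \<noteq> 0"
    using anisotropic_in_perp[OF cl(7) nd nonsingular_subalgebraD[OF L]] LA by (metis psubsetI)
  have "double C ?L q \<subseteq> A" using LA q(1) by (auto simp: double_def intro!: cl(1,3))
  moreover have "vs.subspace (double C ?L q)"
    using nonsingular_subalgebraD(1)[OF nonsingular_double[OF L q(2,3)]] .
  ultimately have "double C ?L q = A"
    using dim_cayley_pair[OF p(2) q(2,3)] dim by (intro fd.subspace_dim_equal cl(7)) auto
  moreover have "quaternion_pair p q"
    using p q by (simp add: quaternion_pair_def perp_generated_line)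
  ultimately show ?thesis using that by blast
qed

text \<open>A non-zero radical vector is anisotropic, so \<open>whole_radical\<close> makes all of
  \<open>A\<close> radical; a basis then arises from \<open>product_outside_span\<close>.\<close>

lemma classification_four_anisotropic:
  assumes dim: "vs.dim A = 4" and R: "bilinear_radical C A \<noteq> {0}"
    and aniso: "\<And>z. z \<in> A \<Longrightarrow> N z = 0 \<Longrightarrow> z = 0"
  obtains x y where "A \<subseteq> perp C A" "x \<notin> vs.span {e}" "y \<notin> vs.span {e, x}" "x \<cdot> y \<notin> vs.span {e, x, y}"
    "A = vs.span {e, x, y, x \<cdot> y}"
proof -
  obtain r where r: "r \<in> bilinear_radical C A" "r \<noteq> 0"
    using R vs.subspace_0[OF subspace_bilinear_radical] by blast
  then have "N r \<noteq> 0" using aniso bilinear_radicalD(1) by blast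
  then have RA: "bilinear_radical C A = A" using whole_radical r by blast
  obtain x where x: "x \<in> A" "x \<notin> vs.span {e}"
    using exists_outside_span[of "[e]" A] dim by auto
  obtain y where y: "y \<in> A" "y \<notin> vs.span {e, x}"
    using exists_outside_span[of "[e, x]" A] dim by auto
  have "N (x - k \<star> e) \<noteq> 0" for k
  proof -
    have "x - k \<star> e \<noteq> 0" using x(2) by (auto simp: vs.span_singleton)
    then show ?thesis using aniso cl(4)[OF x(1) cl(5)[OF eA]] by blast
  qed
  then have xy: "x \<cdot> y \<notin> vs.span {e, x, y}" using product_outside_span[OF y(2)] by blast
  have "A = vs.span {e, x, y, x \<cdot> y}"
    using independent_four[OF x(2) y(2) xy one_nonzero] dim x y eA cl
    by (intro span_eq_of_dim cl(7)) auto
  then show ?thesis using that RA x y xy by (auto simp: bilinear_radical_def)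
qed

text \<open>Multiplying \<open>(0, p\<^sub>0)\<close> and \<open>(0, n\<^sub>0)\<close> from the
  left by \<open>(h, k)\<close> exhibits the two rows of \<open>h\<close> and the second row of
  \<open>k\<close>; only the first row of \<open>k\<close> remains free.\<close>

lemma null_plane_annihilator:
  assumes \<phi>: "split_identification C \<phi>" and w: "w \<cdot> \<phi> (0, p\<^sub>0) = 0" "w \<cdot> \<phi> (0, n\<^sub>0) = 0"
  shows "w \<in> vs.span {\<phi> (0, p\<^sub>0), \<phi> (0, n\<^sub>0)}"
proof -
  note \<phi>D = identificationD[OF \<phi>]
  obtain h k where hk: "w = \<phi> (h, k)" using \<phi>D(4) by (metis bij_pointE surj_pair)
  have inj: "u = 0" if "\<phi> u = 0" for u using \<phi>D(4,6) that by (metis bij_pointE)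
  have "mul split_octonions (h, k) (0, p\<^sub>0) = 0" "mul split_octonions (h, k) (0, n\<^sub>0) = 0"
    using w by (auto intro!: inj simp only: \<phi>D(3) hk)
  then have "h = 0" "k = mat_scal (k $ 1 $ 1) p\<^sub>0 + mat_scal (k $ 1 $ 2) n\<^sub>0"
    by (simp_all add: mat2_simps zero_prod_def)
  then have "(h, k) = scal split_octonions (k $ 1 $ 1) (0, p\<^sub>0) + scal split_octonions (k $ 1 $ 2) (0, n\<^sub>0)"
    by (simp add: mat2_simps)
  then have "w = (k $ 1 $ 1) \<star> \<phi> (0, p\<^sub>0) + (k $ 1 $ 2) \<star> \<phi> (0, n\<^sub>0)"
    using hk by (simp only: \<phi>D)
  then show ?thesis using lin_comb_in_span(2) by metis
qed

lemma null_pair_annihilator: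
  assumes "null_pair x y" "w \<cdot> x = 0" "w \<cdot> y = 0" shows "w \<in> vs.span {x, y}"
proof -
  obtain \<phi> where "split_identification C \<phi>" "\<phi> (0, p\<^sub>0) = x" "\<phi> (0, n\<^sub>0) = y"
    using null_pair_identification[of x y] assms(1) unfolding null_pair_def by blast
  then show ?thesis using null_plane_annihilator assms(2,3) by metis
qed

text \<open>The kernel of left multiplication by the radical vector \<open>z\<close> would have dimension three and
  be totally singular; the trace then forces a second radical vector in it.\<close>

lemma second_radical_vector:
  assumes dim: "vs.dim A = 4" and z: "z \<in> quadratic_radical C A" "z \<noteq> 0"
  obtains x where "x \<in> quadratic_radical C A" "x \<notin> vs.span {z}"
proof (rule ccontr)
  let ?Q = "quadratic_radical C A"
  assume "\<not> thesis"
  then have Qz: "x \<in> vs.span {z}" if "x \<in> ?Q" for x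
    using \<open>\<And>x. \<lbrakk>x \<in> ?Q; x \<notin> vs.span {z}\<rbrakk> \<Longrightarrow> thesis\<close> \<open>x \<in> ?Q\<close> by blast
  define K where "K = {a \<in> A. z \<cdot> a = 0}"
  have K_lin: "x + y \<in> K" "c \<star> x \<in> K" if "x \<in> K" "y \<in> K" for x y c
    using that cl(3,5) by (auto simp: K_def mul_lin)
  have K_N: "N x = 0" if "x \<in> K" for x using that z mul_eq_0_N by (auto simp: K_def)
  have K_polar: "b x y = 0" if "x \<in> K" "y \<in> K" for x y
    using K_N[OF K_lin(1)[OF that]] K_N[OF that(1)] K_N[OF that(2)] by (simp add: N_add)
  have split_off: "\<exists>k. a - k \<star> e \<in> K" if a: "a \<in> A" for a
  proof -
    obtain k where "z \<cdot> a = k \<star> z"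
      using Qz[OF quadratic_radical_ideal(2)[OF z(1) a]] span_coords(1) by blast
    then have "z \<cdot> (a - k \<star> e) = 0" by (simp add: mul_lin)
    then show ?thesis using cl(4)[OF a cl(5)[OF eA]] unfolding K_def by blast
  qed
  have shift: "a - k \<star> e \<notin> vs.span (insert e S)" if "a \<notin> vs.span (insert e S)" for a k S
  proof
    assume as: "a - k \<star> e \<in> vs.span (insert e S)"
    have "k \<star> e \<in> vs.span (insert e S)" by (intro vs.span_scale vs.span_base) auto
    with as have "(a - k \<star> e) + k \<star> e \<in> vs.span (insert e S)" by (rule vs.span_add)
    then show False using that by simp
  qed
  have zK: "z \<in> K" using radical_square[OF z(1)] quadratic_radicalD(1)[OF z(1)] by (simp add: K_def)
  have ze: "z \<notin> vs.span {e}" using radical_outside_span[OF z(1), of "{}"] z by simp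
  obtain a1 where a1: "a1 \<in> A" "a1 \<notin> vs.span {e, z}"
    using exists_outside_span[of "[e, z]" A] dim by auto
  obtain c1 where c1: "a1 - c1 \<star> e \<in> K" using split_off[OF a1(1)] by blast
  define k1 where "k1 = a1 - c1 \<star> e"
  have k1: "k1 \<in> K" "k1 \<notin> vs.span {e, z}" using c1 shift[OF a1(2)] by (simp_all add: k1_def)
  obtain a2 where a2: "a2 \<in> A" "a2 \<notin> vs.span {e, z, k1}"
    using exists_outside_span[of "[e, z, k1]" A] dim by auto
  obtain c2 where c2: "a2 - c2 \<star> e \<in> K" using split_off[OF a2(1)] by blast
  define k2 where "k2 = a2 - c2 \<star> e"
  have k2: "k2 \<in> K" "k2 \<notin> vs.span {e, z, k1}" using c2 shift[OF a2(2)] by (simp_all add: k2_def)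
  have Aeq: "A = vs.span {e, z, k1, k2}"
    using independent_four[OF ze k1(2) k2(2) one_nonzero] dim eA zK k1(1) k2(1)
    by (intro span_eq_of_dim cl(7)) (auto simp: K_def)
  \<comment> \<open>\<open>A\<close> is spanned by \<open>e\<close> and vectors of \<open>K\<close>,
    and the polar form vanishes on \<open>K\<close>, so trace zero already makes an element of
    \<open>K\<close> radical.\<close>
  have KQ: "k \<in> vs.span {z}" if k: "k \<in> K" "T k = 0" for k
  proof (rule Qz, rule quadratic_radicalI)
    show "k \<in> A" "N k = 0" using k K_N by (auto simp: K_def)
    fix a assume "a \<in> A"
    then obtain \<alpha> \<beta> \<gamma> \<delta> where "a = \<alpha> \<star> e + \<beta> \<star> z + \<gamma> \<star> k1 + \<delta> \<star> k2"
      unfolding Aeq using span_coords(4) by blast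
    then show "b k a = 0"
      using k(2) K_polar[OF k(1) zK] K_polar[OF k(1) k1(1)] K_polar[OF k(1) k2(1)]
      by (simp add: polar_add_right polar_scal_right)
  qed
  have sub: "vs.span {z} \<subseteq> vs.span {e, z}" "vs.span {z} \<subseteq> vs.span {e, z, k1}"
    by (intro vs.span_mono; auto)+
  show False
  proof (cases "T k1 = 0")
    case True
    then show False using KQ[OF k1(1)] k1(2) sub by blast
  next
    case False
    define k where "k = k2 + (- (T k2 / T k1)) \<star> k1"
    have "k \<in> K" unfolding k_def using k1(1) k2(1) K_lin by blast
    moreover have "T k = 0" using False by (simp add: k_def polar_lin)
    ultimately have "k \<in> vs.span {e, z, k1}" using KQ sub by blast
    moreover have "(T k2 / T k1) \<star> k1 \<in> vs.span {e, z, k1}"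
      by (intro vs.span_scale vs.span_base) auto
    ultimately have "k + (T k2 / T k1) \<star> k1 \<in> vs.span {e, z, k1}" by (rule vs.span_add)
    then show False using k2(2) by (simp add: k_def)
  qed
qed

lemma heisenberg_from_radical:
  assumes dim: "vs.dim A = 4" and x: "x \<in> quadratic_radical C A" and y: "y \<in> quadratic_radical C A"
    and xy: "x \<cdot> y \<noteq> 0"
  shows "heisenberg_pair x y" "A = vs.span {e, x, y, x \<cdot> y}"
proof -
  note xD = quadratic_radicalD[OF x] and yD = quadratic_radicalD[OF y]
  have bxy: "b x y = 0" using xD(2) yD(1) by blast
  then show "heisenberg_pair x y" using xD yD xy by (simp add: heisenberg_pair_def)
  note h = heisenberg_pair_facts[OF xD(4,3) yD(4,3) bxy xy]
  have n: "x \<cdot> y \<in> quadratic_radical C A" using quadratic_radical_ideal(2)[OF x yD(1)] .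
  have "x \<noteq> 0" using xy by auto
  then have "x \<notin> vs.span {e}" using radical_outside_span[OF x, of "{}"] by simp
  moreover have "y \<notin> vs.span {e, x}" using radical_outside_span[OF y, of "{x}"] x h by simp
  moreover have "x \<cdot> y \<notin> vs.span {e, x, y}" using radical_outside_span[OF n, of "{x, y}"] x y h by simp
  ultimately show "A = vs.span {e, x, y, x \<cdot> y}"
    using independent_four[OF _ _ _ one_nonzero] dim eA xD(1) yD(1) quadratic_radicalD(1)[OF n]
    by (intro span_eq_of_dim cl(7)) auto
qed

text \<open>The radical contains a null plane and, by \<open>null_pair_annihilator\<close>, equals
  it. A further element \<open>\<beta>\<close> of \<open>A\<close> acts on this plane by a matrix
  \<open>h\<close> that is not scalar, so some vector \<open>x1\<close> and its image
  \<open>\<beta> \<cdot> x1\<close> form a basis of the plane.\<close>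

lemma plane_from_radical:
  assumes dim: "vs.dim A = 4" and z: "z \<in> quadratic_radical C A" "z \<noteq> 0"
    and prod: "\<And>u v. u \<in> quadratic_radical C A \<Longrightarrow> v \<in> quadratic_radical C A \<Longrightarrow> u \<cdot> v = 0"
  obtains \<beta> x where "null_pair x (\<beta> \<cdot> x)" "A = vs.span {e, \<beta>, x, \<beta> \<cdot> x}"
    "quadratic_radical C A \<subseteq> vs.span {x, \<beta> \<cdot> x}"
proof -
  let ?Q = "quadratic_radical C A"
  obtain x where x: "x \<in> ?Q" "x \<notin> vs.span {z}" using second_radical_vector[OF dim z] .
  have "null_pair x z"
    using x z prod[OF x(1) z(1)] by (intro null_pair_in_radical) (simp_all add: vs.span_zero)
  then obtain \<phi> where \<phi>: "split_identification C \<phi>" and \<phi>x: "\<phi> (0, p\<^sub>0) = x" "\<phi> (0, n\<^sub>0) = z"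
    using null_pair_identification[of x z] unfolding null_pair_def by blast
  note \<phi>D = identificationD[OF \<phi>]
  have Qspan: "w \<in> vs.span {x, z}" if "w \<in> ?Q" for w
    using null_pair_annihilator[OF \<open>null_pair x z\<close>] prod that x(1) z(1) by blast
  have row: "\<phi> (0, mat_scal r p\<^sub>0 + mat_scal s n\<^sub>0) = r \<star> x + s \<star> z" for r s
  proof -
    have "(0 :: 'f mat2, mat_scal r p\<^sub>0 + mat_scal s n\<^sub>0) =
        scal split_octonions r (0, p\<^sub>0) + scal split_octonions s (0, n\<^sub>0)" by (simp add: mat2_simps)
    then show ?thesis by (simp only: \<phi>D \<phi>x)
  qed
  have row_Q: "r \<star> x + s \<star> z \<in> ?Q" for r s
    using x z subspace_quadratic_radical by (intro vs.subspace_add vs.subspace_scale)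
  obtain \<beta>0 where \<beta>0: "\<beta>0 \<in> A" "\<beta>0 \<notin> vs.span {e, x, z}"
    using exists_outside_span[of "[e, x, z]" A] dim by auto
  obtain h k where hk: "\<beta>0 = \<phi> (h, k)" using \<phi>D(4) by (metis bij_pointE surj_pair)
  \<comment> \<open>The matrix component of \<open>\<beta>0 \<cdot> x\<close> vanishes because this
    product is radical. This kills the second row of \<open>k\<close>, so a radical vector corrects
    \<open>\<beta>0\<close> to an element of the form \<open>\<phi> (h, 0)\<close>.\<close>
  have k: "k = mat_scal (k $ 1 $ 1) p\<^sub>0 + mat_scal (k $ 1 $ 2) n\<^sub>0"
  proof -
    have "\<beta>0 \<cdot> x \<in> ?Q" using quadratic_radical_ideal(1)[OF x(1) \<beta>0(1)] .
    then obtain r s where "\<beta>0 \<cdot> x = r \<star> x + s \<star> z" using Qspan span_coords(2) by blast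
    then have "\<phi> (mul split_octonions (h, k) (0, p\<^sub>0)) = \<phi> (0, mat_scal r p\<^sub>0 + mat_scal s n\<^sub>0)"
      by (simp only: \<phi>D(3) hk \<phi>x row)
    then have "mul split_octonions (h, k) (0, p\<^sub>0) = (0, mat_scal r p\<^sub>0 + mat_scal s n\<^sub>0)"
      using \<phi>D(4) by (metis bij_is_inj injD)
    then show ?thesis by (simp add: mat2_simps)
  qed
  define \<beta> where "\<beta> = \<phi> (h, 0)"
  have "(h, k) = (h, 0) + (0, mat_scal (k $ 1 $ 1) p\<^sub>0 + mat_scal (k $ 1 $ 2) n\<^sub>0)" using k by simp
  then have \<beta>0_eq: "\<beta>0 = \<beta> + ((k $ 1 $ 1) \<star> x + (k $ 1 $ 2) \<star> z)" unfolding hk \<beta>_def by (metis \<phi>D(1) row)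
  then have \<beta>A: "\<beta> \<in> A"
    using cl(4)[OF \<beta>0(1) quadratic_radicalD(1)[OF row_Q]] by (metis add_diff_cancel_right')
  have \<beta>_out: "\<beta> \<notin> vs.span {e, x, z}"
  proof
    assume "\<beta> \<in> vs.span {e, x, z}"
    then have "\<beta>0 \<in> vs.span {e, x, z}"
      unfolding \<beta>0_eq by (intro vs.span_add vs.span_scale) (auto simp: vs.span_base)
    then show False using \<beta>0(2) by simp
  qed
  have \<beta>_row: "\<beta> \<cdot> (r \<star> x + s \<star> z) =
      (r * h $ 1 $ 1 + s * h $ 2 $ 1) \<star> x + (r * h $ 1 $ 2 + s * h $ 2 $ 2) \<star> z" for r s
  proof -
    have "mul split_octonions (h, 0) (0, mat_scal r p\<^sub>0 + mat_scal s n\<^sub>0) =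
      (0, mat_scal (r * h $ 1 $ 1 + s * h $ 2 $ 1) p\<^sub>0 + mat_scal (r * h $ 1 $ 2 + s * h $ 2 $ 2) n\<^sub>0)"
      by (simp add: mat2_simps)
    then show ?thesis by (metis \<beta>_def \<phi>D(3) row)
  qed
  have coeff: "r = r' \<and> s = s'" if "r \<star> x + s \<star> z = r' \<star> x + s' \<star> z" for r s r' s'
  proof -
    have "\<phi> (0, mat_scal r p\<^sub>0 + mat_scal s n\<^sub>0) = \<phi> (0, mat_scal r' p\<^sub>0 + mat_scal s' n\<^sub>0)"
      using that by (simp only: row)
    then have "(0 :: 'f mat2, mat_scal r p\<^sub>0 + mat_scal s n\<^sub>0) = (0, mat_scal r' p\<^sub>0 + mat_scal s' n\<^sub>0)"
      using \<phi>D(4) by (metis bij_is_inj injD)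
    then show ?thesis by (simp add: mat2_simps)
  qed
  \<comment> \<open>If every vector of the plane were an eigenvector, \<open>h\<close> would be
    scalar and \<open>\<beta>\<close> would lie in \<open>F\<close>.\<close>
  have "\<exists>r s. \<beta> \<cdot> (r \<star> x + s \<star> z) \<notin> vs.span {r \<star> x + s \<star> z}"
  proof (rule ccontr)
    assume "\<not> ?thesis"
    then have "\<exists>c. \<beta> \<cdot> (r \<star> x + s \<star> z) = c \<star> (r \<star> x + s \<star> z)" for r s
      using span_coords(1) by blast
    then have ex: "\<exists>c. r * h $ 1 $ 1 + s * h $ 2 $ 1 = c * r \<and> r * h $ 1 $ 2 + s * h $ 2 $ 2 = c * s" for r s
      unfolding \<beta>_row vs.scale_right_distrib vs.scale_scale using coeff by blast
    have "h = mat (h $ 1 $ 1)"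
      using ex[of 1 0] ex[of 0 1] ex[of 1 1] by (auto simp: mat2_simps)
    then have "(h, 0) = scal split_octonions (h $ 1 $ 1) (mat 1, 0 :: 'f mat2)"
      by (simp add: mat2_simps)
    then have "\<beta> = (h $ 1 $ 1) \<star> e" unfolding \<beta>_def by (metis \<phi>D(2,7))
    then have "\<beta> \<in> vs.span {e, x, z}" by (simp add: vs.span_scale vs.span_base)
    then show False using \<beta>_out by simp
  qed
  then obtain r s where rs: "\<beta> \<cdot> (r \<star> x + s \<star> z) \<notin> vs.span {r \<star> x + s \<star> z}" by blast
  define x1 where "x1 = r \<star> x + s \<star> z"
  have x1: "x1 \<in> ?Q" "\<beta> \<cdot> x1 \<in> ?Q" "\<beta> \<cdot> x1 \<notin> vs.span {x1}"
    using row_Q rs quadratic_radical_ideal(1)[OF row_Q \<beta>A] by (simp_all add: x1_def)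
  have x1': "x1 \<notin> vs.span {\<beta> \<cdot> x1}"
  proof
    assume "x1 \<in> vs.span {\<beta> \<cdot> x1}"
    then obtain c where c: "x1 = c \<star> (\<beta> \<cdot> x1)" using span_coords(1) by blast
    have "c \<noteq> 0"
    proof
      assume "c = 0"
      then have "x1 = 0" using c by simp
      then show False using x1(3) by (simp add: vs.span_zero)
    qed
    then have "\<beta> \<cdot> x1 = (1 / c) \<star> x1" by (metis c vs.scale_scale vs.scale_one nonzero_eq_divide_eq mult.commute)
    then show False using x1(3) lin_comb_in_span(1) by metis
  qed
  have "\<beta> \<cdot> x1 \<noteq> 0" using x1(3) vs.span_zero by auto
  then have null: "null_pair x1 (\<beta> \<cdot> x1)"
    using x1 x1' prod[OF x1(1,2)] by (intro null_pair_in_radical) (simp_all add: vs.span_zero)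
  have "x1 \<noteq> 0" using x1(3) by (auto simp: vs.span_zero)
  then have ind: "x1 \<notin> vs.span {e}" "\<beta> \<cdot> x1 \<notin> vs.span {e, x1}"
    using radical_outside_span[OF x1(1), of "{}"] radical_outside_span[OF x1(2), of "{x1}"] x1 by simp_all
  have "vs.span {e, x1, \<beta> \<cdot> x1} \<subseteq> vs.span {e, x, z}"
  proof (intro vs.span_minimal vs.subspace_span)
    have "vs.span {x, z} \<subseteq> vs.span {e, x, z}" by (intro vs.span_mono) auto
    then show "{e, x1, \<beta> \<cdot> x1} \<subseteq> vs.span {e, x, z}"
      using Qspan[OF x1(1)] Qspan[OF x1(2)] by (auto simp: vs.span_base)
  qed
  then have "\<beta> \<notin> vs.span {e, x1, \<beta> \<cdot> x1}" using \<beta>_out by blast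
  then have "A = vs.span {e, x1, \<beta> \<cdot> x1, \<beta>}"
    using independent_four[OF ind _ one_nonzero] dim eA \<beta>A quadratic_radicalD(1)[OF x1(1)]
      quadratic_radicalD(1)[OF x1(2)]
    by (intro span_eq_of_dim cl(7)) auto
  moreover have "{e, x1, \<beta> \<cdot> x1, \<beta>} = {e, \<beta>, x1, \<beta> \<cdot> x1}" by auto
  moreover have "?Q \<subseteq> vs.span {x1, \<beta> \<cdot> x1}"
    using null_pair_annihilator[OF null] prod x1(1,2) by blast
  ultimately show ?thesis using that null by metis
qed

theorem classification_four:
  assumes dim: "vs.dim A = 4"
  obtains
    (quaternion) p q where "bilinear_radical C A = {0}" "quaternion_pair p q" "A = double C (generated_line C p) q"
  | (plane) \<beta> x where "null_pair x (\<beta> \<cdot> x)" "A = vs.span {e, \<beta>, x, \<beta> \<cdot> x}"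
      "quadratic_radical C A \<subseteq> vs.span {x, \<beta> \<cdot> x}"
  | (heisenberg) x y where "heisenberg_pair x y" "A = vs.span {e, x, y, x \<cdot> y}"
  | (anisotropic) x y where "\<And>z. z \<in> A \<Longrightarrow> N z = 0 \<Longrightarrow> z = 0" "A \<subseteq> perp C A"
      "x \<notin> vs.span {e}" "y \<notin> vs.span {e, x}" "x \<cdot> y \<notin> vs.span {e, x, y}"
      "A = vs.span {e, x, y, x \<cdot> y}"
proof (cases "bilinear_radical C A = {0}")
  case True
  then show ?thesis using classification_four_nonsingular[OF dim] quaternion by metis
next
  case R: False
  show ?thesis
  proof (cases "\<exists>z\<in>A. z \<noteq> 0 \<and> N z = 0")
    case False
    then have "\<And>z. z \<in> A \<Longrightarrow> N z = 0 \<Longrightarrow> z = 0" by blast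
    then show ?thesis using classification_four_anisotropic[OF dim R] anisotropic by metis
  next
    case True
    then obtain z0 where z0: "z0 \<in> A" "z0 \<noteq> 0" "N z0 = 0" by blast
    obtain r where r: "r \<in> bilinear_radical C A" "r \<noteq> 0"
      using R vs.subspace_0[OF subspace_bilinear_radical] by blast
    \<comment> \<open>A radical vector that is not singular makes all of \<open>A\<close> radical,
      in particular \<open>z0\<close>.\<close>
    have "\<exists>z\<in>quadratic_radical C A. z \<noteq> 0"
    proof (cases "N r = 0")
      case True
      then show ?thesis using r by (auto simp: quadratic_radical_def bilinear_radical_def)
    next
      case False
      then have "z0 \<in> bilinear_radical C A" using whole_radical r z0 by blast
      then show ?thesis using z0 by (auto simp: quadratic_radical_def bilinear_radical_def)
    qed
    then obtain z where z: "z \<in> quadratic_radical C A" "z \<noteq> 0" by blast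
    show ?thesis
    proof (cases "\<exists>u\<in>quadratic_radical C A. \<exists>v\<in>quadratic_radical C A. u \<cdot> v \<noteq> 0")
      case True
      then show ?thesis using heisenberg_from_radical[OF dim] heisenberg by metis
    next
      case False
      then show ?thesis using plane_from_radical[OF dim z] plane by metis
    qed
  qed
qed

end

end

section \<open>Isomorphic subalgebras are conjugate\<close>

text \<open>The action on a plane with basis \<open>x, \<beta>x\<close> of an element
  \<open>\<beta>\<close> with trace \<open>t\<close> and norm \<open>n\<close>. It is written by
  rows because \<open>(h, 0)\<close> acts on \<open>(0, y)\<close> as \<open>y ** h\<close>.\<close>

definition companion :: "'f::field \<Rightarrow> 'f \<Rightarrow> 'f mat2" where
  "companion t n = vector [vector [0, 1], vector [- n, t]]"

context octonion
begin

lemma automorphism_one: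
  assumes "g \<in> automorphisms C" shows "g e = e"
proof -
  obtain u where "g u = e" using automorphismD(4)[OF assms] by (metis bij_pointE)
  then show ?thesis using automorphismD(3)[OF assms, of e u] by simp
qed

lemma identity_automorphism: "(\<lambda>x. x) \<in> automorphisms C"
  using octonion by (simp add: automorphisms_def alg_iso_def octonion_algebra_def
      composition_algebra_def bij_betw_def)

lemma algebra_of_subalgebra: "subalgebra C A \<Longrightarrow> algebra C A"
  by (simp add: algebra_def vs.vector_space_axioms mul_lin)

lemma alg_isomorphic_of_same_orbit:
  assumes A: "subalgebra C A" and "subalgebra C A'" and "same_orbit C A A'"
  shows "alg_isomorphic C A C A'"
proof -
  obtain g where g: "g \<in> automorphisms C" "g ` A = A'" using assms by (auto simp: same_orbit_def)
  have "bij_betw g A A'"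
    using automorphismD(4)[OF g(1)] g(2) by (auto simp: bij_betw_def bij_def intro: inj_on_subset)
  then have "alg_iso C A C A' g"
    using automorphismD[OF g(1)] algebra_of_subalgebra assms(1,2) by (simp add: alg_iso_def)
  then show ?thesis by (auto simp: alg_isomorphic_def)
qed

lemma generated_double_span: "double C (generated_line C p) q = vs.span {e, p, q, p \<cdot> q}"
proof
  show "double C (generated_line C p) q \<subseteq> vs.span {e, p, q, p \<cdot> q}"
  proof
    fix z assume "z \<in> double C (generated_line C p) q"
    then obtain s t s' t' where "z = (s \<star> e + t \<star> p) + (s' \<star> e + t' \<star> p) \<cdot> q"
      by (auto simp: double_def generated_line_def)
    then have "z = s \<star> e + t \<star> p + s' \<star> q + t' \<star> (p \<cdot> q)" by (simp add: mul_lin)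
    then show "z \<in> vs.span {e, p, q, p \<cdot> q}" using lin_comb_in_span(4) by simp
  qed
  show "vs.span {e, p, q, p \<cdot> q} \<subseteq> double C (generated_line C p) q"
  proof
    fix z assume "z \<in> vs.span {e, p, q, p \<cdot> q}"
    then obtain s t s' t' where "z = s \<star> e + t \<star> p + s' \<star> q + t' \<star> (p \<cdot> q)"
      using span_coords(4) by blast
    then have "z = (s \<star> e + t \<star> p) + (s' \<star> e + t' \<star> p) \<cdot> q" by (simp add: mul_lin)
    then show "z \<in> double C (generated_line C p) q"
      unfolding double_def generated_line_def by blast
  qed
qed

lemma identification_T:
  assumes "split_identification C \<phi>"
  shows "b (\<phi> u) (\<phi> v) = polar split_octonions u v"
    "T (\<phi> (h, k)) = h $ 1 $ 1 + h $ 2 $ 2"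
proof -
  note D = identificationD[OF assms]
  show polar: "b (\<phi> u) (\<phi> v) = polar split_octonions u v" for u v
    by (simp add: polar_def D(5) flip: D(1))
  show "T (\<phi> (h, k)) = h $ 1 $ 1 + h $ 2 $ 2"
    using polar[of "(h, k)" "(mat 1, 0)"] by (simp only: D(7)) (simp add: mat_def)
qed

lemma identification_span:
  assumes "split_identification C \<phi>"
  shows "\<phi> ` plane_extension_model (generated_line mat_alg h) =
    vs.span {e, \<phi> (h, 0), \<phi> (0, p\<^sub>0), \<phi> (0, n\<^sub>0)}"
proof -
  note D = identificationD[OF assms]
  have 1: "\<phi> (mat_scal s (mat 1) + mat_scal t h, mat_scal u p\<^sub>0 + mat_scal v n\<^sub>0) =
      s \<star> e + t \<star> \<phi> (h, 0) + u \<star> \<phi> (0, p\<^sub>0) + v \<star> \<phi> (0, n\<^sub>0)" for s t u v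
  proof -
    have "(mat_scal s (mat 1) + mat_scal t h, mat_scal u p\<^sub>0 + mat_scal v n\<^sub>0) =
      scal split_octonions s (mat 1, 0 :: 'f mat2) + scal split_octonions t (h, 0) +
      scal split_octonions u (0, p\<^sub>0) + scal split_octonions v (0, n\<^sub>0)"
      by (simp add: mat2_simps)
    then show ?thesis by (simp only: D)
  qed
  have 2: "plane_extension_model (generated_line mat_alg h) =
      {(mat_scal s (mat 1) + mat_scal t h, mat_scal u p\<^sub>0 + mat_scal v n\<^sub>0) | s t u v. True}"
    unfolding plane_extension_model_def generated_line_def p0_n0_plane_def mat_alg_def by auto
  show ?thesis
  proof
    show "\<phi> ` plane_extension_model (generated_line mat_alg h) \<subseteq>
        vs.span {e, \<phi> (h, 0), \<phi> (0, p\<^sub>0), \<phi> (0, n\<^sub>0)}"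
      unfolding 2 using 1 lin_comb_in_span(4) by auto
    show "vs.span {e, \<phi> (h, 0), \<phi> (0, p\<^sub>0), \<phi> (0, n\<^sub>0)} \<subseteq>
        \<phi> ` plane_extension_model (generated_line mat_alg h)"
    proof
      fix z assume "z \<in> vs.span {e, \<phi> (h, 0), \<phi> (0, p\<^sub>0), \<phi> (0, n\<^sub>0)}"
      then obtain s t u v where "z = s \<star> e + t \<star> \<phi> (h, 0) + u \<star> \<phi> (0, p\<^sub>0) + v \<star> \<phi> (0, n\<^sub>0)"
        using span_coords(4) by blast
      then have "z = \<phi> (mat_scal s (mat 1) + mat_scal t h, mat_scal u p\<^sub>0 + mat_scal v n\<^sub>0)"
        using 1 by simp
      then show "z \<in> \<phi> ` plane_extension_model (generated_line mat_alg h)" unfolding 2 by blast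
    qed
  qed
qed

text \<open>On the plane \<open>F x + F \<beta>x\<close> the element \<open>\<beta>\<close> acts by a companion matrix, so
  the pair \<open>(\<beta>, x)\<close> is determined up to automorphisms and elements of the plane by the
  trace and norm of \<open>\<beta>\<close>.\<close>

lemma plane_identification:
  assumes "null_pair x (\<beta> \<cdot> x)"
  obtains \<phi> where "split_identification C \<phi>" "\<phi> (0, p\<^sub>0) = x" "\<phi> (0, n\<^sub>0) = \<beta> \<cdot> x"
    "\<phi> ` plane_extension_model (generated_line mat_alg (companion (T \<beta>) (N \<beta>))) =
       vs.span {e, \<beta>, x, \<beta> \<cdot> x}"
proof -
  obtain \<phi> where \<phi>: "split_identification C \<phi>" "\<phi> (0, p\<^sub>0) = x" "\<phi> (0, n\<^sub>0) = \<beta> \<cdot> x"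
    using null_pair_identification[of x "\<beta> \<cdot> x"] assms unfolding null_pair_def by blast
  note D = identificationD[OF \<phi>(1)]
  obtain h k where hk: "\<beta> = \<phi> (h, k)" using D(4) by (metis bij_pointE surj_pair)
  \<comment> \<open>This equation determines the first row of \<open>h\<close> and kills the second
    row of \<open>k\<close>; trace and norm of \<open>\<beta>\<close> then determine the second row
    of \<open>h\<close>.\<close>
  have "\<phi> (mul split_octonions (h, k) (0, p\<^sub>0)) = \<phi> (0, n\<^sub>0)"
    using \<phi>(2,3) by (simp only: D(3) hk)
  then have "mul split_octonions (h, k) (0, p\<^sub>0) = (0, n\<^sub>0)"
    using D(4) by (metis bij_is_inj injD)
  then have h1: "h $ 1 $ 1 = 0" "h $ 1 $ 2 = 1" and k2: "k $ 2 $ 1 = 0" "k $ 2 $ 2 = 0"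
    by (simp_all add: mat2_simps)
  have T: "T \<beta> = h $ 2 $ 2" using identification_T(2)[OF \<phi>(1)] h1 by (simp add: hk)
  have N: "N \<beta> = - h $ 2 $ 1" using D(5)[of "(h, k)"] h1 k2 by (simp add: hk det_2)
  have h: "h = companion (T \<beta>) (N \<beta>)"
    unfolding T N by (simp add: companion_def vec_eq_iff forall_2 h1)
  have "(h, k) = (h, 0) + scal split_octonions (k $ 1 $ 1) (0, p\<^sub>0) + scal split_octonions (k $ 1 $ 2) (0, n\<^sub>0)"
    using k2 by (simp add: mat2_simps)
  then have \<beta>: "\<beta> = \<phi> (h, 0) + (k $ 1 $ 1) \<star> x + (k $ 1 $ 2) \<star> (\<beta> \<cdot> x)"
    using hk \<phi>(2,3) D(1,2) by metis
  have "vs.span {e, \<phi> (h, 0), x, \<beta> \<cdot> x} = vs.span {e, \<beta>, x, \<beta> \<cdot> x}"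
  proof (intro equalityI vs.span_minimal vs.subspace_span)
    define y where "y = \<beta> \<cdot> x"
    have "\<phi> (h, 0) \<in> vs.span {e, \<beta>, x, y}"
    proof -
      have "\<phi> (h, 0) = \<beta> - ((k $ 1 $ 1) \<star> x + (k $ 1 $ 2) \<star> y)"
        using \<beta> by (simp add: y_def algebra_simps)
      also have "\<dots> \<in> vs.span {e, \<beta>, x, y}"
        by (intro vs.span_diff vs.span_add vs.span_scale vs.span_base) auto
      finally show ?thesis .
    qed
    then show "{e, \<phi> (h, 0), x, \<beta> \<cdot> x} \<subseteq> vs.span {e, \<beta>, x, \<beta> \<cdot> x}"
      by (auto simp: y_def vs.span_base)
    have "\<phi> (h, 0) + (k $ 1 $ 1) \<star> x + (k $ 1 $ 2) \<star> y \<in> vs.span {e, \<phi> (h, 0), x, y}"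
      by (intro vs.span_add vs.span_scale vs.span_base) auto
    then have "\<beta> \<in> vs.span {e, \<phi> (h, 0), x, y}" using \<beta> by (simp add: y_def)
    then show "{e, \<beta>, x, \<beta> \<cdot> x} \<subseteq> vs.span {e, \<phi> (h, 0), x, \<beta> \<cdot> x}"
      by (auto simp: y_def vs.span_base)
  qed
  then show ?thesis
    using that[OF \<phi>] identification_span[OF \<phi>(1), of h] \<phi>(2,3) h by simp
qed

section \<open>An isomorphism between unital subalgebras and the orbits of these\<close>

context
  fixes A A' f
  assumes A: "subalgebra C A" "e \<in> A" and A': "subalgebra C A'" "e \<in> A'"
    and f: "alg_iso C A C A' f"
begin

lemma isoD: "x \<in> A \<Longrightarrow> y \<in> A \<Longrightarrow> f (x + y) = f x + f y" "x \<in> A \<Longrightarrow> f (c \<star> x) = c \<star> f x"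
  "x \<in> A \<Longrightarrow> y \<in> A \<Longrightarrow> f (x \<cdot> y) = f x \<cdot> f y" "f ` A = A'" "inj_on f A"
  using f by (auto simp: alg_iso_def bij_betw_def)

lemma iso_in: "x \<in> A \<Longrightarrow> f x \<in> A'"
  using isoD(4) by auto

lemma iso_one: "f e = e"
proof -
  obtain u where u: "u \<in> A" "f u = e" using isoD(4) A'(2) by (metis imageE)
  then show ?thesis using isoD(3)[OF A(2) u(1)] by simp
qed

lemma iso_zero: "f 0 = 0"
  using isoD(2)[OF A(2), of 0] by simp

lemma iso_eq_0: "x \<in> A \<Longrightarrow> f x = 0 \<Longrightarrow> x = 0"
  using isoD(5) iso_zero subalgebraD(2)[OF A(1)] by (metis inj_onD)

lemma iso_diff: assumes "x \<in> A" "y \<in> A" shows "f (x - y) = f x - f y"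
proof -
  have "f ((x - y) + y) = f (x - y) + f y" using assms subalgebraD(4)[OF A(1)] by (intro isoD(1))
  then show ?thesis by (simp add: algebra_simps)
qed

lemma iso_outside_span: assumes "x \<in> A" "z \<in> A" "x \<notin> vs.span {z}" shows "f x \<notin> vs.span {f z}"
proof
  assume "f x \<in> vs.span {f z}"
  then obtain k where "f x = k \<star> f z" using span_coords(1) by blast
  then have "f x = f (k \<star> z)" using isoD(2)[OF assms(2)] by simp
  then have "x = k \<star> z" using isoD(5) assms subalgebraD(5)[OF A(1)] by (metis inj_onD)
  then show False using assms(3) lin_comb_in_span(1) by simp
qed

lemma iso_T_N: assumes x: "x \<in> A" shows "T (f x) = T x" "N (f x) = N x"
proof -
  have "T (f x) = T x \<and> N (f x) = N x"
  \<comment> \<open>A scalar does not determine the coefficients of its quadratic equation, but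
    \<open>f\<close> fixes it. Otherwise \<open>f x\<close> and \<open>e\<close> are independent,
    and coefficients can be compared.\<close>
  proof (cases "x \<in> vs.span {e}")
    case True
    then obtain k where "x = k \<star> e" using span_coords(1) by blast
    then have "f x = x" using isoD(2)[OF A(2)] iso_one by simp
    then show ?thesis by simp
  next
    case False
    then have out: "f x \<notin> vs.span {e}" using iso_outside_span[OF x A(2)] iso_one by simp
    have "f (x \<cdot> x) = T x \<star> f x - N x \<star> e"
      unfolding quadratic[of x] using x A subalgebraD(5)[OF A(1)] by (simp add: iso_diff isoD(2) iso_one)
    then have eq: "T x \<star> f x - N x \<star> e = T (f x) \<star> f x - N (f x) \<star> e"
      using isoD(3)[OF x x] quadratic[of "f x"] by simp
    then have 1: "(T x - T (f x)) \<star> f x = (N x - N (f x)) \<star> e" by (simp add: vs_lin algebra_simps)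
    have T: "T x = T (f x)"
    proof (rule ccontr)
      assume "T x \<noteq> T (f x)"
      then have "f x = (1 / (T x - T (f x))) \<star> (T x - T (f x)) \<star> f x" by simp
      also have "\<dots> \<in> vs.span {e}" unfolding 1 by (intro vs.span_scale vs.span_base) simp
      finally show False using out by simp
    qed
    then have "N x = N (f x)" using 1 one_nonzero by simp
    with T show ?thesis by simp
  qed
  then show "T (f x) = T x" "N (f x) = N x" by auto
qed

lemma iso_polar: assumes "x \<in> A" "y \<in> A" shows "b (f x) (f y) = b x y"
  using iso_T_N(2)[OF subalgebraD(3)[OF A(1) assms]] iso_T_N(2) assms isoD(1)[OF assms] by (simp add: N_add)

lemma iso_span: assumes "A = vs.span S" shows "A' = vs.span (f ` S)"
proof
  have SA: "S \<subseteq> A" using assms by (simp add: vs.span_superset)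
  have "x \<in> A \<and> f x \<in> vs.span (f ` S)" if "x \<in> vs.span S" for x
    using that
  proof (induction rule: vs.span_induct_alt)
    case base
    then show ?case using iso_zero subalgebraD(2)[OF A(1)] by (simp add: vs.span_zero)
  next
    case (step c x y)
    then have "x \<in> A" using SA by blast
    then show ?case
      using step isoD(1,2) subalgebraD(3,5)[OF A(1)] by (simp add: vs.span_add vs.span_scale vs.span_base)
  qed
  then show "A' \<subseteq> vs.span (f ` S)" using assms isoD(4) by blast
  show "vs.span (f ` S) \<subseteq> A'" using SA iso_in subalgebraD(7)[OF A'(1)] by (intro vs.span_minimal) auto
qed

lemma automorphism_maps:
  assumes S: "A = vs.span S" and g: "g \<in> automorphisms C" "\<forall>x\<in>S. g x = f x"
  shows "same_orbit C A A'"
proof -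
  have SA: "S \<subseteq> A" using S by (simp add: vs.span_superset)
  have g0: "g 0 = 0" using automorphismD(2)[OF g(1), of 0 0] by simp
  have "x \<in> A \<and> g x = f x" if "x \<in> vs.span S" for x
    using that
  proof (induction rule: vs.span_induct_alt)
    case base
    then show ?case using iso_zero subalgebraD(2)[OF A(1)] g0 by simp
  next
    case (step c x y)
    then have "x \<in> A" using SA by blast
    then show ?case
      using step isoD(1,2) subalgebraD(3,5)[OF A(1)] automorphismD(1,2)[OF g(1)] g(2) by simp
  qed
  then have "g ` A = A'" using S isoD(4) by (metis image_cong)
  then show ?thesis using g(1) by (auto simp: same_orbit_def)
qed

lemma identification_maps:
  assumes "split_identification C \<phi>" "split_identification C \<psi>"
  obtains g where "g \<in> automorphisms C" "\<And>u. g (\<phi> u) = \<psi> u" "g e = e"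
  using that identification_automorphism[OF assms]
    automorphism_one[OF identification_automorphism(1)[OF assms]] by blast

lemma same_orbit_of_isomorphic_three:
  assumes dim: "vs.dim A = 3" shows "same_orbit C A A'"
  using A dim
proof (cases rule: classification_three)
  case (1 p n)
  have in_A: "p \<in> A" "n \<in> A" unfolding 1(2) by (simp_all add: vs.span_base)
  have "triangular_pair (f p) (f n)"
    using 1(1) in_A iso_T_N iso_polar isoD(3)[OF in_A] iso_eq_0[OF in_A(2)]
    by (auto simp: triangular_pair_def)
  with 1(1) obtain \<phi> \<psi> where \<phi>: "split_identification C \<phi>" "\<phi> (p\<^sub>0, 0) = p" "\<phi> (n\<^sub>0, 0) = n"
    and \<psi>: "split_identification C \<psi>" "\<psi> (p\<^sub>0, 0) = f p" "\<psi> (n\<^sub>0, 0) = f n"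
    using peirce_pair_identification[of p n] peirce_pair_identification[of "f p" "f n"]
    unfolding triangular_pair_def by metis
  obtain g where g: "g \<in> automorphisms C" "\<And>u. g (\<phi> u) = \<psi> u" "g e = e"
    using identification_maps[OF \<phi>(1) \<psi>(1)] by blast
  have "g p = f p" "g n = f n" using g(2) \<phi> \<psi> by metis+
  then show ?thesis using automorphism_maps[OF 1(2) g(1)] g(3) iso_one by auto
next
  case (2 x y)
  have in_A: "x \<in> A" "y \<in> A" unfolding 2(2) by (simp_all add: vs.span_base)
  have "null_pair (f x) (f y)"
    using 2(1) in_A iso_T_N isoD(3)[OF in_A] iso_eq_0[OF in_A(2)] iso_outside_span[OF in_A] iso_zero
    by (auto simp: null_pair_def)
  with 2(1) obtain \<phi> \<psi> where \<phi>: "split_identification C \<phi>" "\<phi> (0, p\<^sub>0) = x" "\<phi> (0, n\<^sub>0) = y"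
    and \<psi>: "split_identification C \<psi>" "\<psi> (0, p\<^sub>0) = f x" "\<psi> (0, n\<^sub>0) = f y"
    using null_pair_identification[of x y] null_pair_identification[of "f x" "f y"]
    unfolding null_pair_def by metis
  obtain g where g: "g \<in> automorphisms C" "\<And>u. g (\<phi> u) = \<psi> u" "g e = e"
    using identification_maps[OF \<phi>(1) \<psi>(1)] by blast
  have "g x = f x" "g y = f y" using g(2) \<phi> \<psi> by metis+
  then show ?thesis using automorphism_maps[OF 2(2) g(1)] g(3) iso_one by auto
qed

text \<open>Choosing \<open>a\<close> of trace one orthogonal to \<open>x, y, xy\<close> makes \<open>(a, x, y)\<close> a Cayley
  triple; Witt's theorem supplies a matching \<open>a'\<close> of the same norm on the other side.\<close>

lemma same_orbit_of_isomorphic_anisotropic: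
  assumes aniso: "\<And>z. z \<in> A \<Longrightarrow> N z = 0 \<Longrightarrow> z = 0" and perp: "A \<subseteq> perp C A"
    and x: "x \<notin> vs.span {e}" and y: "y \<notin> vs.span {e, x}" and xy: "x \<cdot> y \<notin> vs.span {e, x, y}"
    and Aeq: "A = vs.span {e, x, y, x \<cdot> y}"
  shows "same_orbit C A A'"
proof -
  interpret pr: octonion_pair C C by unfold_locales
  note sA = subalgebraD(7)[OF A(1)]
  have in_A: "x \<in> A" "y \<in> A" "x \<cdot> y \<in> A" unfolding Aeq by (simp_all add: vs.span_base)
  have b0: "b u v = 0" if "u \<in> A" "v \<in> A" for u v using perp that by (auto simp: perp_def)
  \<comment> \<open>\<open>A\<close> is orthogonal to itself and contains \<open>e\<close>, and
    \<open>b e e = 2\<close>.\<close>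
  have "(2::'f) = 0" using b0[OF A(2) A(2)] by (simp add: T_one)
  moreover have "(4::'f) = 2 * 2" by simp
  ultimately have four: "(4::'f) = 0" by simp
  obtain G where G: "isometry G" "\<And>z. z \<in> A \<Longrightarrow> G z = f z"
    using witt_on_subspace[OF sA isoD(1,2) iso_T_N(2) isoD(5)] by blast
  have "e \<notin> {x, y, x \<cdot> y}"
    using vs.span_base[of x "{e, x}"] x y xy by (auto simp: vs.span_base)
  then have "{e, x, y, x \<cdot> y} - {e} = {x, y, x \<cdot> y}" by auto
  then have "e \<notin> vs.span {x, y, x \<cdot> y}"
    using independent_four[OF x y xy one_nonzero] unfolding vs.dependent_def by auto
  then obtain a where a: "b a e = 1" "\<And>z. z \<in> vs.span {x, y, x \<cdot> y} \<Longrightarrow> b a z = 0"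
    using separation[OF vs.subspace_span] by metis
  have a0: "b a x = 0" "b a y = 0" "b a (x \<cdot> y) = 0" using a(2) by (simp_all add: vs.span_base)
  have triple: "cayley_triple C a' x' y'"
    if "T a' = 1" "b a' x' = 0" "b a' y' = 0" "b a' (x' \<cdot> y') = 0" "T x' = 0" "T y' = 0" "b x' y' = 0"
      "N x' \<noteq> 0" "N y' \<noteq> 0" for a' x' y'
  proof -
    \<comment> \<open>As \<open>x'\<close> and \<open>y'\<close> anticommute, orthogonality of
      \<open>a'\<close> to \<open>x' \<cdot> y'\<close> becomes the orthogonality of
      \<open>y'\<close> to \<open>a' \<cdot> x'\<close> that a triple requires.\<close>
    have "y' \<cdot> x' = - (x' \<cdot> y')" using mul_commute[of y' x'] that by simp
    then have "b (a' \<cdot> x') y' = 0" using adjoint_right[of a' x' y'] that by (simp add: mul_lin)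
    then show ?thesis
      using that four by (simp add: cayley_triple_def perp_generated_line perp_double_generated_line polar_commute)
  qed
  have Nxy: "N x \<noteq> 0" "N y \<noteq> 0"
    using aniso in_A x y vs.span_zero by metis+
  have t: "cayley_triple C a x y"
    using a a0 b0 in_A A(2) Nxy by (intro triple) auto
  have G': "b (G a) (f z) = b a z" if "z \<in> A" for z
    using isometry_polar[OF G(1), of a z] G(2)[OF that] by simp
  have "T (f x) = 0" "T (f y) = 0" "b (f x) (f y) = 0" "N (f x) = N x" "N (f y) = N y"
    using b0 in_A A(2) iso_T_N iso_polar by auto
  then have t': "cayley_triple C (G a) (f x) (f y)"
    using G'[OF A(2)] G'[OF in_A(1)] G'[OF in_A(2)] G'[OF in_A(3)] a a0 Nxy isoD(3)[OF in_A(1,2)]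
    by (intro triple) (simp_all add: iso_one)
  obtain g where g: "alg_iso C UNIV C UNIV g" "g x = f x" "g y = f y"
    using pr.cayley_triple_iso[OF t t'] G'[OF A(2)] iso_one isometry_N[OF G(1), of a]
      iso_T_N(2)[OF in_A(1)] iso_T_N(2)[OF in_A(2)] by metis
  have "g \<in> automorphisms C" using g(1) by (simp add: automorphisms_def)
  then show ?thesis
    using automorphism_maps[OF Aeq] g(2,3) automorphism_one[of g] automorphismD(3)[of g x y]
      isoD(3)[OF in_A(1,2)] iso_one by auto
qed

lemma same_orbit_of_isomorphic_four:
  assumes dim: "vs.dim A = 4" shows "same_orbit C A A'"
  using A dim
proof (cases rule: classification_four)
  case (quaternion p q)
  note Aeq = quaternion(3)[unfolded generated_double_span]
  have in_A: "p \<in> A" "q \<in> A" unfolding Aeq by (simp_all add: vs.span_base)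
  have "T (f p) = T p" "N (f p) = N p" "T (f q) = 0" "b (f q) (f p) = 0" "N (f q) = N q"
    using quaternion(2) in_A iso_T_N iso_polar by (auto simp: quaternion_pair_def)
  then obtain g where g: "g \<in> automorphisms C" "g p = f p" "g q = f q"
    using cayley_pair_automorphism[of p q "f p" "f q"] quaternion(2) by (auto simp: quaternion_pair_def)
  then show ?thesis
    using automorphism_maps[OF Aeq g(1)] automorphism_one[OF g(1)] automorphismD(3)[OF g(1)]
      isoD(3)[OF in_A] iso_one by auto
next
  case (plane \<beta> x)
  have in_A: "\<beta> \<in> A" "x \<in> A" "\<beta> \<cdot> x \<in> A" unfolding plane(2) by (simp_all add: vs.span_base)
  have fbx: "f (\<beta> \<cdot> x) = f \<beta> \<cdot> f x" using isoD(3)[OF in_A(1,2)] .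
  have null: "null_pair (f x) (f \<beta> \<cdot> f x)"
    using plane(1) in_A iso_T_N isoD(3)[OF in_A(2,3)] iso_eq_0[OF in_A(3)] iso_outside_span[OF in_A(2,3)] iso_zero
    unfolding null_pair_def fbx[symmetric] by auto
  have A'eq: "A' = vs.span {e, f \<beta>, f x, f \<beta> \<cdot> f x}"
    using iso_span[OF plane(2)] fbx iso_one by simp
  obtain \<phi> where \<phi>: "split_identification C \<phi>"
    "\<phi> ` plane_extension_model (generated_line mat_alg (companion (T \<beta>) (N \<beta>))) = A"
    using plane_identification[OF plane(1)] plane(2) by metis
  obtain \<psi> where \<psi>: "split_identification C \<psi>"
    "\<psi> ` plane_extension_model (generated_line mat_alg (companion (T \<beta>) (N \<beta>))) = A'"
    using plane_identification[OF null] A'eq iso_T_N[OF in_A(1)] by metis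
  \<comment> \<open>This \<open>g\<close> need not extend \<open>f\<close>: the two may differ on
    \<open>\<beta>\<close> by a vector of the plane. Only the images of \<open>A\<close> are
    compared.\<close>
  obtain g where g: "g \<in> automorphisms C" "\<And>u. g (\<phi> u) = \<psi> u" "g e = e"
    using identification_maps[OF \<phi>(1) \<psi>(1)] by blast
  have "g ` A = A'" unfolding \<phi>(2)[symmetric] \<psi>(2)[symmetric] image_image by (simp add: g(2))
  then show ?thesis using g(1) by (auto simp: same_orbit_def)
next
  case (heisenberg x y)
  have in_A: "x \<in> A" "y \<in> A" unfolding heisenberg(2) by (simp_all add: vs.span_base)
  have "f x \<cdot> f y \<noteq> 0"
    using isoD(3)[OF in_A] iso_eq_0[OF subalgebraD(1)[OF A(1) in_A]] heisenberg(1) by (auto simp: heisenberg_pair_def)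
  then have "heisenberg_pair (f x) (f y)"
    using heisenberg(1) in_A iso_T_N iso_polar by (auto simp: heisenberg_pair_def)
  with heisenberg(1) obtain \<phi> \<psi> where \<phi>: "split_identification C \<phi>" "\<phi> (n\<^sub>0, 0) = x" "\<phi> (0, p\<^sub>0) = y"
    and \<psi>: "split_identification C \<psi>" "\<psi> (n\<^sub>0, 0) = f x" "\<psi> (0, p\<^sub>0) = f y"
    using heisenberg_pair_identification[of x y] heisenberg_pair_identification[of "f x" "f y"]
    unfolding heisenberg_pair_def by metis
  obtain g where g: "g \<in> automorphisms C" "\<And>u. g (\<phi> u) = \<psi> u" "g e = e"
    using identification_maps[OF \<phi>(1) \<psi>(1)] by blast
  have "g x = f x" "g y = f y" using g(2) \<phi> \<psi> by metis+
  then show ?thesis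
    using automorphism_maps[OF heisenberg(2) g(1)] g(3) iso_one automorphismD(3)[OF g(1)] isoD(3)[OF in_A]
    by auto
next
  case (anisotropic x y)
  then show ?thesis using same_orbit_of_isomorphic_anisotropic by blast
qed

lemma same_orbit_of_isomorphic:
  assumes "vs.dim A \<le> 4" shows "same_orbit C A A'"
proof -
  have "vs.dim A \<noteq> 0" using A(2) one_nonzero by (auto simp: fd.dim_eq_0)
  then consider "vs.dim A = 1" | "vs.dim A = 2" | "vs.dim A = 3" | "vs.dim A = 4" using assms by linarith
  then show ?thesis
  proof cases
    case 1
    have "A = vs.span {e}" using 1 A one_nonzero by (intro span_eq_of_dim subalgebraD(7)) auto
    then show ?thesis using automorphism_maps[OF _ identity_automorphism] iso_one by simp
  next
    case 2
    obtain x where x: "x \<in> A" "x \<notin> vs.span {e}" using exists_outside_span[of "[e]" A] 2 by auto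
    have Aeq: "A = vs.span {e, x}"
      using independent_two[OF x(2) one_nonzero] 2 x A by (intro span_eq_of_dim subalgebraD(7)) auto
    have "f x \<notin> vs.span {e}" using iso_outside_span[OF x(1) A(2) x(2)] iso_one by simp
    then obtain g where "g \<in> automorphisms C" "g x = f x"
      using element_automorphism[OF x(2)] iso_T_N[OF x(1)] by metis
    then show ?thesis using automorphism_maps[OF Aeq] automorphism_one iso_one by auto
  qed (use same_orbit_of_isomorphic_three same_orbit_of_isomorphic_four in blast)+
qed

end

section \<open>Associativity\<close>

definition associator :: "'a \<Rightarrow> 'a \<Rightarrow> 'a \<Rightarrow> 'a" where
  "associator x y z = (x \<cdot> y) \<cdot> z - x \<cdot> (y \<cdot> z)"

lemma associator_alternating:
  "associator x x y = 0" "associator y x x = 0" "associator x y x = 0"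
  "associator e x y = 0" "associator x e y = 0" "associator x y e = 0"
  "associator y x z = - associator x y z" "associator x z y = - associator x y z"
proof -
  show "associator x x y = 0"
    using left_alternative[of x y] by (simp add: associator_def quadratic mul_lin)
  show "associator y x x = 0"
    using right_alternative[of y x] by (simp add: associator_def quadratic mul_lin)
  show "associator x y x = 0" by (simp add: associator_def flexible)
  show "associator y x z = - associator x y z"
    using left_linearized[of x y z] by (simp add: associator_def mul_lin algebra_simps)
  show "associator x z y = - associator x y z"
    using right_linearized[of x y z] by (simp add: associator_def mul_lin algebra_simps)
qed (simp_all add: associator_def)

lemma associator_lin:
  "associator (x + y) z w = associator x z w + associator y z w"
  "associator z (x + y) w = associator z x w + associator z y w"
  "associator z w (x + y) = associator z w x + associator z w y"
  "associator (c \<star> x) z w = c \<star> associator x z w"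
  "associator z (c \<star> x) w = c \<star> associator z x w"
  "associator z w (c \<star> x) = c \<star> associator z w x"
  by (simp_all add: associator_def mul_lin vs_lin algebra_simps)

lemma associator_zero: "associator 0 x y = 0" "associator x 0 y = 0" "associator x y 0 = 0"
  by (simp_all add: associator_def)

lemma associator_span:
  assumes S: "\<And>x y z. x \<in> S \<Longrightarrow> y \<in> S \<Longrightarrow> z \<in> S \<Longrightarrow> associator x y z = 0"
    and "x \<in> vs.span S" "y \<in> vs.span S" "z \<in> vs.span S"
  shows "associator x y z = 0"
proof -
  have 1: "associator u v z = 0" if "u \<in> S" "v \<in> S" for u v
    using assms(4) by (induction rule: vs.span_induct_alt) (simp_all add: associator_lin associator_zero S that)
  have 2: "associator u y z = 0" if "u \<in> S" for u
    using assms(3) by (induction rule: vs.span_induct_alt) (simp_all add: associator_lin associator_zero 1 that)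
  show ?thesis
    using assms(2) by (induction rule: vs.span_induct_alt) (simp_all add: associator_lin associator_zero 2)
qed

text \<open>The associator vanishes when an argument is \<open>e\<close> or two arguments agree. Up
  to permutation only \<open>x, y, x \<cdot> y\<close> remains, and that is
  \<open>artin\<close>.\<close>

lemma associative_generated: "assoc_on C (vs.span {e, x, y, x \<cdot> y})"
proof -
  have 0: "associator x y (x \<cdot> y) = 0" by (simp add: associator_def artin)
  have perms: "associator y x (x \<cdot> y) = 0" "associator x (x \<cdot> y) y = 0" "associator (x \<cdot> y) x y = 0"
    "associator y (x \<cdot> y) x = 0" "associator (x \<cdot> y) y x = 0"
    using 0 associator_alternating(7,8) by (metis minus_zero)+
  have gens: "associator u v w = 0" if "u \<in> {e, x, y, x \<cdot> y}" "v \<in> {e, x, y, x \<cdot> y}" "w \<in> {e, x, y, x \<cdot> y}" for u v w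
    using that 0 perms by (auto simp: associator_alternating(1-6))
  have "associator u v w = 0"
    if "u \<in> vs.span {e, x, y, x \<cdot> y}" "v \<in> vs.span {e, x, y, x \<cdot> y}" "w \<in> vs.span {e, x, y, x \<cdot> y}" for u v w
    by (rule associator_span[OF _ that]) (rule gens)
  then show ?thesis by (simp add: assoc_on_def associator_def)
qed

text \<open>It suffices that \<open>A\<close> lies in the span of
  \<open>e, x, y, x \<cdot> y\<close> for some \<open>x, y\<close>. In dimension four each case of
  the classification provides these; below that, a spanning set of three elements containing
  \<open>e\<close> is enough.\<close>

theorem associative_of_dim_le_four:
  assumes A: "subalgebra C A" "e \<in> A" and dim: "vs.dim A \<le> 4"
  shows "assoc_on C A"
proof -
  have "\<exists>x y. A \<subseteq> vs.span {e, x, y, x \<cdot> y}"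
  proof (cases "vs.dim A = 4")
    case True
    with A show ?thesis
    proof (cases rule: classification_four)
      case (quaternion p q)
      then show ?thesis unfolding generated_double_span by blast
    qed blast+
  next
    case False
    then have dim: "vs.dim A \<le> 3" using dim by simp
    \<comment> \<open>The disjunction covers small dimensions, where \<open>e\<close> itself serves
      as the next element.\<close>
    have "\<exists>x\<in>A. x \<notin> vs.span {e} \<or> A \<subseteq> vs.span {e}" using A(2) by blast
    then obtain x where x: "x \<in> A" "x \<notin> vs.span {e} \<or> A \<subseteq> vs.span {e}" by blast
    have "\<exists>y\<in>A. y \<notin> vs.span {e, x} \<or> A \<subseteq> vs.span {e, x}" using A(2) by blast
    then obtain y where y: "y \<in> A" "y \<notin> vs.span {e, x} \<or> A \<subseteq> vs.span {e, x}" by blast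
    have mono: "vs.span {e} \<subseteq> vs.span {e, x, y, x \<cdot> y}" "vs.span {e, x} \<subseteq> vs.span {e, x, y, x \<cdot> y}"
      "vs.span {e, x, y} \<subseteq> vs.span {e, x, y, x \<cdot> y}"
      by (intro vs.span_mono; auto)+
    show ?thesis
    proof (cases "A \<subseteq> vs.span {e} \<or> A \<subseteq> vs.span {e, x}")
      case True
      then show ?thesis using mono by blast
    next
      case False
      then have ind: "vs.independent {e, x, y}" "card {e, x, y} = 3"
        using independent_three[OF _ _ one_nonzero] x y by blast+
      have "card {e, x, y} \<le> vs.dim A"
        using ind x y A by (intro fd.independent_card_le_dim) auto
      then have "A = vs.span {e, x, y}"
        using ind dim x y A by (intro span_eq_of_dim subalgebraD(7)) auto
      then show ?thesis using mono by blast
    qed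
  qed
  then obtain x y where "A \<subseteq> vs.span {e, x, y, x \<cdot> y}" by blast
  then show ?thesis using associative_generated[of x y] by (auto simp: assoc_on_def subset_eq)
qed

end

section \<open>Separable elements and subalgebras of dimension two\<close>

lemma CHAR_eq_2: assumes "(2::'f::field) = 0" shows "CHAR('f) = 2"
proof (rule CHAR_eqI)
  show "of_nat 2 = (0::'f)" using assms by simp
  fix x :: nat assume x: "of_nat x = (0::'f)"
  show "2 dvd x"
  proof (rule ccontr)
    assume "\<not> 2 dvd x"
    then obtain k where "x = 2 * k + 1" by (metis oddE)
    then have "of_nat x = (1::'f)" using assms by simp
    then show False using x by simp
  qed
qed

text \<open>A uniform upper limit allows all polynomials of degree at most two to be evaluated by
  the same three-term sum.\<close>

lemma alg_eval_atMost:
  assumes "vector_space (scal D)" "degree p \<le> m"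
  shows "alg_eval D p y = (\<Sum>i\<le>m. scal D (coeff p i) (alg_pow D y i))"
proof -
  interpret v: vector_space "scal D" by fact
  show ?thesis unfolding alg_eval_def
    using assms(2) by (intro sum.mono_neutral_left) (auto simp: coeff_eq_0)
qed

lemma alg_pow_simps:
  assumes "mul D y (unity D) = y"
  shows "alg_pow D y 0 = unity D" "alg_pow D y (Suc 0) = y" "alg_pow D y (Suc (Suc 0)) = mul D y y"
  using assms by (simp_all add: alg_pow_def)

text \<open>Stated for a general \<open>D\<close>, because it is applied both to elements of an
  octonion algebra and to companion matrices in \<open>mat_alg\<close>.\<close>

locale quadratic_element =
  fixes D :: "('f::field, 'a::ab_group_add) normed_alg" and y :: 'a and t n :: 'f
  assumes vs: "vector_space (scal D)" and one: "mul D y (unity D) = y"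
    and square: "mul D y y = scal D t y - scal D n (unity D)"
    and indep: "\<And>u v. scal D u (unity D) + scal D v y = 0 \<Longrightarrow> u = 0 \<and> v = 0"
begin

sublocale vector_space "scal D" by (rule vs)

lemma eval:
  assumes "degree p \<le> 2"
  shows "alg_eval D p y =
    scal D (coeff p 0 - n * coeff p 2) (unity D) + scal D (coeff p 1 + t * coeff p 2) y"
  unfolding alg_eval_atMost[OF vs assms]
  by (simp add: numeral_2_eq_2 alg_pow_simps[OF one] square scale_left_distrib scale_left_diff_distrib
      scale_right_diff_distrib algebra_simps)

lemma eval_eq_0: "degree p \<le> 2 \<Longrightarrow> alg_eval D p y = 0 \<Longrightarrow> coeff p 0 = n * coeff p 2 \<and> coeff p 1 = - t * coeff p 2"
  using indep[of "coeff p 0 - n * coeff p 2" "coeff p 1 + t * coeff p 2"]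
  by (simp add: eval eq_neg_iff_add_eq_0)

lemma minimal: "minimal_polynomial D y [:n, - t, 1:]"
  unfolding minimal_polynomial_def
proof (intro conjI allI impI)
  show "alg_eval D [:n, - t, 1:] y = 0" by (subst eval) (simp_all add: numeral_2_eq_2)
  fix q assume q: "q \<noteq> 0 \<and> alg_eval D q y = 0"
  show "degree [:n, - t, 1:] \<le> degree q"
  proof (rule ccontr)
    assume "\<not> ?thesis"
    then have deg: "degree q < 2" by simp
    then have "coeff q 2 = 0" by (simp add: coeff_eq_0)
    then have "coeff q 0 = 0" "coeff q 1 = 0" using eval_eq_0[of q] q deg by simp_all
    then have "coeff q i = 0" for i using deg
      by (cases "i < 2") (auto simp: less_2_cases_iff coeff_eq_0)
    then have "q = 0" by (simp add: poly_eq_iff)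
    then show False using q by simp
  qed
qed simp

lemma minimal_unique: assumes "minimal_polynomial D y p" shows "p = [:n, - t, 1:]"
proof -
  have deg: "degree p = 2"
  proof (rule antisym)
    have "[:n, - t, 1:] \<noteq> 0" by simp
    then have "degree p \<le> degree [:n, - t, 1:]"
      using assms minimal unfolding minimal_polynomial_def by blast
    then show "degree p \<le> 2" by simp
    have "p \<noteq> 0" using assms by (auto simp: minimal_polynomial_def)
    then have "degree [:n, - t, 1:] \<le> degree p"
      using assms minimal unfolding minimal_polynomial_def by blast
    then show "2 \<le> degree p" by simp
  qed
  have lc: "coeff p 2 = 1" using assms deg by (simp add: minimal_polynomial_def)
  have "coeff p 0 = n" "coeff p 1 = - t"
    using eval_eq_0[of p] assms deg lc by (simp_all add: minimal_polynomial_def)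
  then have "coeff p i = coeff [:n, - t, 1:] i" for i
    using deg lc by (cases "i \<le> 2")
      (auto simp: coeff_eq_0 numeral_2_eq_2 le_Suc_eq)
  then show ?thesis by (simp add: poly_eq_iff)
qed

lemma separable: assumes "4 * n \<noteq> t\<^sup>2" shows "separable_element D y"
  unfolding separable_element_def
proof (intro exI conjI)
  show "minimal_polynomial D y [:n, - t, 1:]" by (rule minimal)
  show "coprime [:n, - t, 1:] (pderiv [:n, - t, 1:])"
  proof (rule coprimeI)
    fix c assume c: "c dvd [:n, - t, 1:]" "c dvd pderiv [:n, - t, 1:]"
    \<comment> \<open>With \<open>g = X\<^sup>2 - t X + n\<close> and derivative \<open>g'\<close>
      this reads \<open>4 g - (g')\<^sup>2 = 4 n - t\<^sup>2\<close>, a non-zero constant.\<close>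
    have "smult 4 [:n, - t, 1:] - pderiv [:n, - t, 1:] * pderiv [:n, - t, 1:] = [:4 * n - t\<^sup>2:]"
      by (simp add: pderiv_pCons power2_eq_square algebra_simps)
    moreover have "c dvd smult 4 [:n, - t, 1:] - pderiv [:n, - t, 1:] * pderiv [:n, - t, 1:]"
      using c by (intro dvd_diff dvd_smult dvd_mult)
    ultimately have "c dvd [:4 * n - t\<^sup>2:]" by simp
    moreover have "is_unit [:4 * n - t\<^sup>2:]" using assms by (intro is_unit_triv) simp
    ultimately show "is_unit c" by (rule dvd_trans)
  qed
qed

text \<open>The minimal polynomial is \<open>X\<^sup>2 + n\<close>, whose derivative vanishes in
  characteristic 2.\<close>

lemma inseparable: assumes "(2::'f) = 0" "t = 0" shows "\<not> separable_element D y"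
proof
  assume "separable_element D y"
  then have "coprime [:n, - t, 1:] (pderiv [:n, - t, 1:])"
    using minimal_unique unfolding separable_element_def by blast
  moreover have "pderiv [:n, - t, 1:] = 0" using assms by (simp add: pderiv_pCons)
  ultimately have "is_unit [:n, - t, 1:]" by simp
  then show False by (simp add: is_unit_pCons_iff)
qed

end

lemma separable_scalar:
  assumes vs: "vector_space (scal D)" and one: "mul D (scal D c (unity D)) (unity D) = scal D c (unity D)"
    and ne: "unity D \<noteq> 0"
  shows "separable_element D (scal D c (unity D))"
  unfolding separable_element_def
proof (intro exI conjI)
  interpret v: vector_space "scal D" by fact
  show "minimal_polynomial D (scal D c (unity D)) [:- c, 1:]"
    unfolding minimal_polynomial_def
  proof (intro conjI allI impI)
    show "alg_eval D [:- c, 1:] (scal D c (unity D)) = 0"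
      by (simp add: alg_eval_def alg_pow_simps[OF one])
    fix q assume q: "q \<noteq> 0 \<and> alg_eval D q (scal D c (unity D)) = 0"
    show "degree [:- c, 1:] \<le> degree q"
    proof (rule ccontr)
      assume "\<not> ?thesis"
      then have "degree q = 0" by simp
      then obtain a where "q = [:a:]" by (rule degree_eq_zeroE)
      then show False using q ne by (simp add: alg_eval_def alg_pow_def)
    qed
  qed simp
  have "pderiv [:- c, 1:] = 1" by (simp add: pderiv_pCons one_pCons)
  then show "coprime [:- c, 1:] (pderiv [:- c, 1:])" by simp
qed

subsection \<open>Quadratic quotients of the polynomial ring\<close>

lemma vector_space_smult: "vector_space (smult :: 'f::field \<Rightarrow> _)"
  by unfold_locales (simp_all add: smult_add_left smult_add_right)

lemma algebra_quotient: "algebra (quotient_alg g) (remainders (g :: 'f::field poly))"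
proof -
  interpret v: vector_space "smult :: 'f \<Rightarrow> 'f poly \<Rightarrow> 'f poly" by (rule vector_space_smult)
  have "v.subspace (remainders g)"
  proof (rule v.subspaceI)
    show "0 \<in> remainders g" unfolding remainders_def by (metis mod_0 rangeI)
    show "x + y \<in> remainders g" if "x \<in> remainders g" "y \<in> remainders g" for x y
      using that unfolding remainders_def by (auto simp flip: poly_mod_add_left)
    show "smult c x \<in> remainders g" if "x \<in> remainders g" for c x
      using that unfolding remainders_def by (auto simp flip: mod_smult_left)
  qed
  then show ?thesis
    by (auto simp: algebra_def subalgebra_def quotient_alg_def vector_space_smult remainders_def
        poly_mod_add_left mod_smult_left algebra_simps)
qed

lemma remainders_quadratic: "remainders [:n, - t, 1 :: 'f::field:] = {[:u, v:] | u v. True}"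
proof
  show "remainders [:n, - t, 1:] \<subseteq> {[:u, v:] | u v. True}"
  proof
    fix p assume "p \<in> remainders [:n, - t, 1:]"
    then obtain q where q: "p = q mod [:n, - t, 1:]" by (auto simp: remainders_def)
    have "p = 0 \<or> degree p < degree [:n, - t, 1:]" unfolding q by (rule degree_mod_less) simp
    then have "degree p \<le> 1" by auto
    then have "p = [:coeff p 0, coeff p 1:]"
      by (auto simp: poly_eq_iff coeff_pCons coeff_eq_0 split: nat.splits)
    then show "p \<in> {[:u, v:] | u v. True}" by blast
  qed
  show "{[:u, v:] | u v. True} \<subseteq> remainders [:n, - t, 1:]"
  proof clarify
    fix u v :: 'f
    have "[:u, v:] mod [:n, - t, 1:] = [:u, v:]" by (rule mod_poly_less) simp
    then show "[:u, v:] \<in> remainders [:n, - t, 1:]" unfolding remainders_def by (metis rangeI)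
  qed
qed

lemma mul_mod_quadratic:
  "([:u, v:] * [:u', v':]) mod [:n, - t, 1 :: 'f::field:] =
     [:u * u' - n * (v * v'), u * v' + v * u' + t * (v * v'):]"
proof -
  have "[:u, v:] * [:u', v':] =
      [:u * u' - n * (v * v'), u * v' + v * u' + t * (v * v'):] + [:v * v':] * [:n, - t, 1:]"
    by (simp add: algebra_simps)
  then have "([:u, v:] * [:u', v':]) mod [:n, - t, 1:] =
      [:u * u' - n * (v * v'), u * v' + v * u' + t * (v * v'):] mod [:n, - t, 1:]"
    by (metis mod_mult_self2 mult.commute)
  also have "\<dots> = [:u * u' - n * (v * v'), u * v' + v * u' + t * (v * v'):]"
    by (rule mod_poly_less) simp
  finally show ?thesis .
qed

lemma quotient_isomorphic_product:
  "alg_isomorphic (quotient_alg [:0, - 1, 1 :: 'f::field:]) (remainders [:0, - 1, 1:])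
     (product_alg :: ('f, 'f \<times> 'f) alg) UNIV"
proof -
  \<comment> \<open>Evaluation at 0 and 1, the two roots of \<open>X\<^sup>2 - X\<close>.\<close>
  let ?h = "\<lambda>p :: 'f poly. (coeff p 0, coeff p 0 + coeff p 1)"
  have vs: "vector_space (scal (product_alg :: ('f, 'f \<times> 'f) alg))"
    by unfold_locales (auto simp: product_alg_def algebra_simps)
  interpret v: vector_space "scal (product_alg :: ('f, 'f \<times> 'f) alg)" by (rule vs)
  have "algebra (product_alg :: ('f, 'f \<times> 'f) alg) UNIV"
    unfolding algebra_def subalgebra_def using vs v.subspace_UNIV
    by (auto simp: product_alg_def algebra_simps)
  moreover have "bij_betw ?h (remainders [:0, - 1, 1:]) UNIV"
    unfolding bij_betw_def
  proof
    show "inj_on ?h (remainders [:0, - 1, 1:])"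
      unfolding remainders_quadratic[of 0 1] by (auto simp: inj_on_def)
    show "?h ` remainders [:0, - 1, 1:] = UNIV"
    proof (intro equalityI subsetI)
      fix z :: "'f \<times> 'f"
      have "z = ?h [:fst z, snd z - fst z:]" by (cases z) simp
      then show "z \<in> ?h ` remainders [:0, - 1, 1:]"
        unfolding remainders_quadratic[of 0 1] by blast
    qed simp
  qed
  ultimately have "alg_iso (quotient_alg [:0, - 1, 1:]) (remainders [:0, - 1, 1:]) product_alg UNIV ?h"
    unfolding alg_iso_def using algebra_quotient[of "[:0, - 1, 1 :: 'f:]"]
    by (auto simp: remainders_quadratic[of 0 1] quotient_alg_def product_alg_def
        mul_mod_quadratic[where n = 0 and t = 1, simplified] algebra_simps)
  then show ?thesis by (auto simp: alg_isomorphic_def)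
qed

context octonion
begin

lemma quadratic_element:
  assumes "x \<notin> vs.span {e}" shows "quadratic_element C x (T x) (N x)"
proof unfold_locales
  fix u v assume uv: "u \<star> e + v \<star> x = 0"
  show "u = 0 \<and> v = 0"
  proof (cases "v = 0")
    case False
    have "v \<star> x = (- u) \<star> e" using uv by (simp add: eq_neg_iff_add_eq_0 add.commute)
    then have "(1 / v) \<star> v \<star> x = (1 / v) \<star> (- u) \<star> e" by simp
    then have "x = (1 / v) \<star> (- u) \<star> e" using False by simp
    then have "x \<in> vs.span {e}" by (simp only: vs.scale_scale lin_comb_in_span(1))
    then show ?thesis using assms by simp
  qed (use uv one_nonzero in simp)
qed (simp_all add: quadratic)

lemma quotient_isomorphic:
  assumes A: "subalgebra C A" "A = vs.span {e, x}" and x: "x \<notin> vs.span {e}"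
  shows "alg_isomorphic C A (quotient_alg [:N x, - T x, 1:]) (remainders [:N x, - T x, 1:])"
proof -
  interpret q: quadratic_element C x "T x" "N x" by (rule quadratic_element[OF x])
  let ?h = "\<lambda>p. coeff p 0 \<star> e + coeff p 1 \<star> x"
  let ?R = "remainders [:N x, - T x, 1:]"
  have coords: "u = u' \<and> v = v'" if "u \<star> e + v \<star> x = u' \<star> e + v' \<star> x" for u v u' v'
    using q.indep[of "u - u'" "v - v'"] that by (simp add: vs_lin algebra_simps)
  have "bij_betw ?h ?R A"
    unfolding bij_betw_def
  proof
    show "inj_on ?h ?R" unfolding remainders_quadratic by (auto simp: inj_on_def dest!: coords)
    show "?h ` ?R = A"
    proof (intro equalityI subsetI)
      fix z assume "z \<in> ?h ` ?R"
      then show "z \<in> A" unfolding A(2) using lin_comb_in_span(2) by auto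
    next
      fix z assume "z \<in> A"
      then obtain u v where "z = u \<star> e + v \<star> x" unfolding A(2) using span_coords(2) by blast
      then have "z = ?h [:u, v:]" by simp
      then show "z \<in> ?h ` ?R" unfolding remainders_quadratic by blast
    qed
  qed
  moreover have "?h ((p * q) mod [:N x, - T x, 1:]) = ?h p \<cdot> ?h q" if pq: "p \<in> ?R" "q \<in> ?R" for p q
  proof -
    obtain u v u' v' where "p = [:u, v:]" "q = [:u', v':]"
      using pq unfolding remainders_quadratic by blast
    then show ?thesis unfolding \<open>p = _\<close> \<open>q = _\<close> mul_mod_quadratic
      by (simp add: mul_lin vs_lin quadratic algebra_simps)
  qed
  ultimately have "alg_iso (quotient_alg [:N x, - T x, 1:]) ?R C A ?h"
    unfolding alg_iso_def using algebra_quotient algebra_of_subalgebra[OF A(1)]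
    by (auto simp: quotient_alg_def vs_lin algebra_simps)
  then show ?thesis unfolding alg_isomorphic_def using alg_iso_inv by blast
qed

lemma composition_of_nonsingular:
  assumes "nonsingular_subalgebra C A" shows "composition_algebra C A"
  using assms algebra_of_subalgebra
  by (auto simp: nonsingular_subalgebra_def composition_algebra_def neutral_on_def
      quadratic_form_on_def N_scal polar_lin N_mul)

lemma neutral_on_unital: "e \<in> A \<Longrightarrow> neutral_on C A"
  by (simp add: neutral_on_def)

lemma field_extension_anisotropic:
  assumes A: "subalgebra C A" "e \<in> A" and aniso: "\<And>z. z \<in> A \<Longrightarrow> N z = 0 \<Longrightarrow> z = 0"
    and assoc: "assoc_on C A" and comm: "\<And>x y. x \<in> A \<Longrightarrow> y \<in> A \<Longrightarrow> x \<cdot> y = y \<cdot> x"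
  shows "field_extension C A"
proof -
  have "\<exists>y\<in>A. x \<cdot> y = e" if "x \<in> A" "x \<noteq> 0" for x
  proof
    have "N x \<noteq> 0" using aniso that by blast
    then show "x \<cdot> ((1 / N x) \<star> cj x) = e" using mul_mul_cj[of e x] by (simp add: mul_scal_right)
    show "(1 / N x) \<star> cj x \<in> A" using cj_closed[OF A that(1)] subalgebraD(5)[OF A(1)] by blast
  qed
  then show ?thesis
    using algebra_of_subalgebra[OF A(1)] neutral_on_unital[OF A(2)] one_nonzero assoc comm
    by (auto simp: field_extension_def)
qed

text \<open>\<open>F z\<close> is the set of non-units: since \<open>z\<close> squares to zero,
  \<open>u \<star> e + v \<star> z\<close> with \<open>u \<noteq> 0\<close> has an inverse of the
  same form, so every proper left ideal lies in \<open>F z\<close>.\<close>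

lemma local_algebra_nilpotent:
  assumes A: "subalgebra C A" "A = vs.span {e, z}" and z: "T z = 0" "N z = 0" "z \<notin> vs.span {e}"
    and assoc: "assoc_on C A"
  shows "local_algebra C A"
proof -
  interpret q: quadratic_element C z "T z" "N z" by (rule quadratic_element[OF z(3)])
  have zz: "z \<cdot> z = 0" using z by (simp add: quadratic)
  have eA: "e \<in> A" unfolding A(2) by (simp add: vs.span_base)
  let ?M = "vs.span {z}"
  have coords: "\<exists>u v. a = u \<star> e + v \<star> z" if "a \<in> A" for a
    using that span_coords(2) unfolding A(2) by blast
  have MA: "?M \<subseteq> A" unfolding A(2) by (rule vs.span_mono) auto
  have left: "left_ideal C A ?M"
    unfolding left_ideal_def
  proof (intro conjI ballI MA vs.subspace_span)
    fix a x assume "a \<in> A" "x \<in> ?M"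
    then obtain u v k where "a = u \<star> e + v \<star> z" "x = k \<star> z" using coords span_coords(1) by metis
    then have "a \<cdot> x = (u * k) \<star> z" by (simp add: mul_lin zz algebra_simps)
    then show "a \<cdot> x \<in> ?M" using lin_comb_in_span(1) by simp
  qed
  have "e \<notin> ?M"
  proof
    assume "e \<in> ?M"
    then obtain k where k: "e = k \<star> z" using span_coords(1) by blast
    then have "1 \<star> e + (- k) \<star> z = 0" by simp
    then show False using q.indep by fastforce
  qed
  then have MneA: "?M \<noteq> A" using eA by blast
  have proper: "I \<subseteq> ?M" if I: "left_ideal C A I" "I \<noteq> A" for I
  proof (rule ccontr)
    assume "\<not> I \<subseteq> ?M"
    then obtain a where a: "a \<in> I" "a \<notin> ?M" by blast
    then obtain u v where uv: "a = u \<star> e + v \<star> z" using coords I(1) unfolding left_ideal_def by blast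
    then have u: "u \<noteq> 0" using a(2) lin_comb_in_span(1) by auto
    have "((1 / u) \<star> e - (v / u\<^sup>2) \<star> z) \<cdot> a = e"
      using u by (simp add: uv mul_lin vs_lin zz power2_eq_square)
    moreover have "(1 / u) \<star> e - (v / u\<^sup>2) \<star> z \<in> A"
      unfolding A(2) by (intro vs.span_diff vs.span_scale vs.span_base) auto
    ultimately have "e \<in> I" using I(1) a(1) unfolding left_ideal_def by metis
    then have "x \<cdot> e \<in> I" if "x \<in> A" for x using I(1) that unfolding left_ideal_def by blast
    then have "A \<subseteq> I" by auto
    then show False using I unfolding left_ideal_def by blast
  qed
  have "maximal_left_ideal C A ?M"
    unfolding maximal_left_ideal_def using left MneA proper by blast
  moreover have "M' = ?M" if "maximal_left_ideal C A M'" for M'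
    using that left MneA proper unfolding maximal_left_ideal_def by blast
  ultimately have "\<exists>!M. maximal_left_ideal C A M" by blast
  then show ?thesis
    using algebra_of_subalgebra[OF A(1)] neutral_on_unital[OF eA] assoc by (simp add: local_algebra_def)
qed

text \<open>A singular vector is nilpotent if its trace is zero, and otherwise a multiple of it is
  idempotent. Without singular vectors \<open>A\<close> is a field, and the discriminant of a
  generator decides separability.\<close>

theorem classification_two:
  assumes A: "subalgebra C A" "e \<in> A" and dim: "vs.dim A = 2"
  shows "separable_extension C A \<or> (inseparable_extension C A \<and> CHAR('f) = 2) \<or>
    (alg_isomorphic C A (quotient_alg [:0, - 1, 1 :: 'f:]) (remainders [:0, - 1, 1:]) \<and>
      composition_algebra C A \<and> split C A) \<or>
    (alg_isomorphic C A (quotient_alg [:0, 0, 1 :: 'f:]) (remainders [:0, 0, 1:]) \<and> local_algebra C A)"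
proof -
  have assoc: "assoc_on C A" using associative_of_dim_le_four A dim by simp
  have gen: "A = vs.span {e, x}" if "x \<in> A" "x \<notin> vs.span {e}" for x
    using independent_two[OF that(2) one_nonzero] dim that A by (intro span_eq_of_dim subalgebraD(7)) auto
  show ?thesis
  proof (cases "\<exists>z\<in>A. z \<noteq> 0 \<and> N z = 0")
    case True
    then obtain z where z: "z \<in> A" "z \<noteq> 0" "N z = 0" by blast
    have z_out: "z \<notin> vs.span {e}"
    proof
      assume "z \<in> vs.span {e}"
      then obtain k where "z = k \<star> e" using span_coords(1) by blast
      then show False using z by (simp add: N_scal)
    qed
    show ?thesis
    proof (cases "T z = 0")
      case True
      then have "local_algebra C A"
        using local_algebra_nilpotent[OF A(1) gen[OF z(1) z_out]] z z_out assoc by blast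
      moreover have "alg_isomorphic C A (quotient_alg [:0, 0, 1 :: 'f:]) (remainders [:0, 0, 1:])"
        using quotient_isomorphic[OF A(1) gen[OF z(1) z_out] z_out] True z by simp
      ultimately show ?thesis by blast
    next
      case False
      define p where "p = (1 / T z) \<star> z"
      have p: "p \<in> A" "T p = 1" "N p = 0"
        using z False subalgebraD(5)[OF A(1)] by (simp_all add: p_def polar_lin N_scal)
      note out = idempotent_outside_scalars[OF A p(2,3)]
      note Aeq = gen[OF p(1) out]
      have "composition_algebra C A"
        using composition_of_nonsingular[OF nonsingular_generated_line[OF idempotent_disc[OF p(2,3)]]]
        unfolding generated_line_eq_span Aeq[symmetric] .
      moreover have "split C A" using z by (auto simp: split_def)
      moreover have "alg_isomorphic C A (quotient_alg [:0, - 1, 1 :: 'f:]) (remainders [:0, - 1, 1:])"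
        using quotient_isomorphic[OF A(1) Aeq out] p by simp
      ultimately show ?thesis by blast
    qed
  next
    case False
    then have aniso: "\<And>z. z \<in> A \<Longrightarrow> N z = 0 \<Longrightarrow> z = 0" by blast
    obtain x where x: "x \<in> A" "x \<notin> vs.span {e}" using exists_outside_span[of "[e]" A] dim by auto
    have coords: "\<exists>u v. a = u \<star> e + v \<star> x" if "a \<in> A" for a
      using that span_coords(2) unfolding gen[OF x] by blast
    have "a \<cdot> a' = a' \<cdot> a" if a: "a \<in> A" "a' \<in> A" for a a'
    proof -
      obtain u v u' v' where "a = u \<star> e + v \<star> x" "a' = u' \<star> e + v' \<star> x" using coords a by metis
      then show ?thesis by (simp add: mul_lin vs_lin algebra_simps)
    qed
    then have field: "field_extension C A" using field_extension_anisotropic[OF A aniso assoc] by blast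
    show ?thesis
    proof (cases "4 * N x = (T x)\<^sup>2")
      case disc: False
      have "separable_element C y" if y: "y \<in> A" for y
      proof (cases "y \<in> vs.span {e}")
        case True
        then obtain k where "y = k \<star> e" using span_coords(1) by blast
        then show ?thesis using separable_scalar[OF vs.vector_space_axioms _ one_nonzero] by simp
      next
        case y_out: False
        obtain u v where uv: "y = u \<star> e + v \<star> x" using coords y by blast
        have v: "v \<noteq> 0" using y_out uv lin_comb_in_span(1) by auto
        \<comment> \<open>The discriminant changes by the factor \<open>v\<^sup>2\<close>, so all
          non-scalar elements inherit separability from \<open>x\<close>.\<close>
        have "4 * N y - (T y)\<^sup>2 = v\<^sup>2 * (4 * N x - (T x)\<^sup>2)"
          by (simp add: uv N_add N_scal polar_lin T_one polar_commute[of e x] algebra_simps power2_eq_square)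
        then have "4 * N y \<noteq> (T y)\<^sup>2" using v disc by auto
        then show ?thesis using quadratic_element.separable[OF quadratic_element[OF y_out]] by blast
      qed
      then show ?thesis using field by (simp add: separable_extension_def)
    next
      case disc: True
      \<comment> \<open>Otherwise \<open>x - (T x / 2) \<star> e\<close> would be singular, hence
        zero, and \<open>x\<close> would be a scalar.\<close>
      have two: "(2::'f) = 0"
      proof (rule ccontr)
        assume 2: "(2::'f) \<noteq> 0"
        have "(2::'f) * 2 \<noteq> 0" using 2 by (metis mult_eq_0_iff)
        then have 4: "(4::'f) \<noteq> 0" by simp
        have "N x = (T x)\<^sup>2 / 4" using disc 4 by (simp add: field_simps)
        then have "N (x - (T x / 2) \<star> e) = 0"
          using 2 4 by (simp add: polar_lin N_diff N_scal field_simps power2_eq_square)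
        moreover have "x - (T x / 2) \<star> e \<in> A"
          using x(1) A subalgebraD(4,5)[OF A(1)] by simp
        ultimately have "x - (T x / 2) \<star> e = 0" using aniso by blast
        then have "x = (T x / 2) \<star> e" by simp
        then show False using x(2) lin_comb_in_span(1) by metis
      qed
      have "(4::'f) = 2 * 2" by simp
      then have "T x = 0" using disc two by simp
      then have "\<not> separable_element C x"
        using quadratic_element.inseparable[OF quadratic_element[OF x(2)] two] by blast
      then show ?thesis using field x(1) CHAR_eq_2[OF two] by (auto simp: inseparable_extension_def)
    qed
  qed
qed

end

section \<open>The model subalgebras\<close>

lemma mat_alg_sel [simp]:
  "scal mat_alg = mat_scal" "mul mat_alg = (**)" "unity mat_alg = mat 1" "nrm mat_alg = det"
  by (simp_all add: mat_alg_def)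

lemma vector_space_mat_scal: "vector_space (mat_scal :: 'f::field \<Rightarrow> _)"
  by unfold_locales (auto simp: mat2_simps algebra_simps)

lemma polar_mat_alg: "polar mat_alg a (c :: 'f::field mat2) =
    a $ 1 $ 1 * c $ 2 $ 2 + c $ 1 $ 1 * a $ 2 $ 2 - a $ 1 $ 2 * c $ 2 $ 1 - c $ 1 $ 2 * a $ 2 $ 1"
  by (simp add: polar_def det_2 algebra_simps)

section \<open>The plane \<open>F + F h\<close> of a companion matrix \<open>h\<close>\<close>

context
  fixes t n :: "'f::field"
begin

abbreviation (input) "L \<equiv> generated_line mat_alg (companion t n)"

lemma companion_line:
  "L = {mat_scal s (mat 1) + mat_scal u (companion t n) | s u. True}"
  by (simp add: generated_line_def)

lemma companion_line_mul:
  "(mat_scal s (mat 1) + mat_scal u (companion t n)) ** (mat_scal s' (mat 1) + mat_scal u' (companion t n)) =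
   mat_scal (s * s' - n * (u * u')) (mat 1) + mat_scal (s * u' + u * s' + t * (u * u')) (companion t n)"
  by (simp add: mat2_simps companion_def algebra_simps)

lemma companion_line_nrm:
  "det (mat_scal s (mat 1) + mat_scal u (companion t n)) = s\<^sup>2 + s * u * t + u\<^sup>2 * n"
  by (simp add: mat2_simps companion_def algebra_simps power2_eq_square)

lemma companion_line_polar:
  "polar mat_alg (mat_scal s (mat 1) + mat_scal u (companion t n)) (mat 1) = 2 * s + u * t"
  "polar mat_alg (mat_scal s (mat 1) + mat_scal u (companion t n)) (companion t n) = s * t + 2 * u * n"
  by (simp_all add: polar_mat_alg mat2_simps companion_def algebra_simps)

lemma companion_line_zero:
  "mat_scal s (mat 1) + mat_scal u (companion t n) = 0 \<longleftrightarrow> s = 0 \<and> u = 0"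
  by (auto simp: mat2_simps companion_def)

lemma companion_line_gens: "mat 1 \<in> L" "companion t n \<in> L"
proof -
  have "mat 1 = mat_scal 1 (mat 1) + mat_scal 0 (companion t n)"
    "companion t n = mat_scal 0 (mat 1) + mat_scal 1 (companion t n)"
    by (simp_all add: mat2_simps)
  then show "mat 1 \<in> L" "companion t n \<in> L" unfolding companion_line by blast+
qed

lemma subspace_companion_line: "module.subspace mat_scal L"
proof -
  interpret v: vector_space "mat_scal :: 'f \<Rightarrow> 'f mat2 \<Rightarrow> 'f mat2" by (rule vector_space_mat_scal)
  have "L = v.span {mat 1, companion t n}"
    unfolding companion_line v.span_insert v.span_singleton by (auto simp: algebra_simps)
  then show ?thesis by simp
qed

lemma dim_companion_line: "alg_dim mat_alg L = 2"
proof -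
  interpret v: vector_space "mat_scal :: 'f \<Rightarrow> 'f mat2 \<Rightarrow> 'f mat2" by (rule vector_space_mat_scal)
  have L: "L = v.span {mat 1, companion t n}"
    unfolding companion_line v.span_insert v.span_singleton by (auto simp: algebra_simps)
  have "companion t n \<notin> v.span {mat 1}"
    unfolding v.span_singleton by (auto simp: mat2_simps companion_def)
  moreover have "mat 1 \<noteq> (0 :: 'f mat2)" by (simp add: mat2_simps)
  ultimately have "v.independent {companion t n, mat 1}" "companion t n \<noteq> mat 1"
    by (auto simp: v.independent_insert v.span_base)
  then have "v.dim {companion t n, mat 1} = 2" by (simp add: v.dim_eq_card_independent)
  then show ?thesis unfolding alg_dim_def L by (simp add: insert_commute)
qed

lemma algebra_companion_line: "algebra mat_alg L"
proof -
  have "a ** c \<in> L" if ac: "a \<in> L" "c \<in> L" for a c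
  proof -
    obtain s u s' u' where "a = mat_scal s (mat 1) + mat_scal u (companion t n)"
      "c = mat_scal s' (mat 1) + mat_scal u' (companion t n)"
      using ac unfolding companion_line by blast
    then show ?thesis using companion_line_mul unfolding companion_line by blast
  qed
  then show ?thesis
    using subspace_companion_line vector_space_mat_scal
    by (simp add: algebra_def subalgebra_def mat2_simps algebra_simps)
qed

lemma neutral_companion_line: "neutral_on mat_alg L"
  using companion_line_gens(1) by (simp add: neutral_on_def)

lemma composition_companion_line:
  assumes "4 * n \<noteq> t\<^sup>2" shows "composition_algebra mat_alg L"
proof -
  have "quadratic_form_on mat_alg L"
    by (auto simp: quadratic_form_on_def polar_mat_alg mat2_simps algebra_simps power2_eq_square)
  moreover have "a = 0" if aL: "a \<in> L" "\<forall>c\<in>L. polar mat_alg a c = 0" for a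
  proof -
    obtain s u where a: "a = mat_scal s (mat 1) + mat_scal u (companion t n)"
      using aL(1) unfolding companion_line by blast
    have 1: "2 * s + u * t = 0" "s * t + 2 * u * n = 0"
      using aL(2) companion_line_gens unfolding a companion_line_polar[symmetric] by blast+
    have "u * (4 * n - t\<^sup>2) = 2 * (s * t + 2 * u * n) - t * (2 * s + u * t)"
      by (simp add: algebra_simps power2_eq_square)
    then have u: "u = 0" using assms 1 by simp
    have "s = 0"
    proof (rule ccontr)
      assume "s \<noteq> 0"
      then have "t = 0" "(2::'f) = 0" using 1 u by auto
      moreover have "(4::'f) = 2 * 2" by simp
      ultimately show False using assms by (simp only:) simp
    qed
    then show ?thesis by (simp add: a u companion_line_zero)
  qed
  ultimately show ?thesis
    using algebra_companion_line neutral_companion_line by (simp add: composition_algebra_def det_mul)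
qed

lemma inseparable_companion_line:
  assumes two: "(2::'f) = 0" "t = 0" and aniso: "\<And>a. a \<in> L \<Longrightarrow> det a = 0 \<Longrightarrow> a = 0"
  shows "inseparable_extension mat_alg L"
proof -
  interpret q: quadratic_element "mat_alg :: ('f, 'f mat2) normed_alg" "companion t n" t n
  proof (rule quadratic_element.intro)
    show "mul mat_alg (companion t n) (companion t n) =
        scal mat_alg t (companion t n) - scal mat_alg n (unity mat_alg)"
      by (simp add: mat2_simps companion_def)
  qed (simp_all add: vector_space_mat_scal companion_line_zero)
  have comm: "a ** c = c ** a" if "a \<in> L" "c \<in> L" for a c
    using that unfolding companion_line by (auto simp: companion_line_mul algebra_simps)
  have inv: "\<exists>c\<in>L. a ** c = mat 1" if aL: "a \<in> L" "a \<noteq> 0" for a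
  proof -
    obtain s u where a: "a = mat_scal s (mat 1) + mat_scal u (companion t n)"
      using aL(1) unfolding companion_line by blast
    define d where "d = s\<^sup>2 + u\<^sup>2 * n"
    have "det a = d" unfolding a companion_line_nrm d_def using two by simp
    then have d: "d \<noteq> 0" using aniso aL by blast
    \<comment> \<open>Conjugate divided by norm: as \<open>t = 0\<close>, the conjugate of
      \<open>s + u h\<close> is \<open>s - u h\<close>.\<close>
    let ?c = "mat_scal (s / d) (mat 1) + mat_scal (- u / d) (companion t n)"
    have "s * (s / d) - n * (u * (- u / d)) = (s\<^sup>2 + u\<^sup>2 * n) / d"
      by (simp add: power2_eq_square add_divide_distrib mult_ac)
    also have "\<dots> = 1" using d by (simp add: d_def)
    finally have "s * (s / d) - n * (u * (- u / d)) = 1" .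
    moreover have "s * (- u / d) + u * (s / d) + t * (u * (- u / d)) = 0"
      by (simp add: two algebra_simps)
    ultimately have "a ** ?c = mat 1" unfolding a companion_line_mul by (simp add: mat2_simps)
    then show ?thesis unfolding companion_line by blast
  qed
  have "field_extension mat_alg L"
    unfolding field_extension_def
    using algebra_companion_line neutral_companion_line comm inv
    by (auto simp: assoc_on_def matrix_mul_assoc mat2_simps(1,2) mat_def)
  then show ?thesis
    using q.inseparable[OF two] companion_line_gens(2) by (auto simp: inseparable_extension_def)
qed

end

text \<open>The matrix component of a product \<open>n\<^sub>0 u\<close> is supported in the first
  row, that of \<open>u n\<^sub>0\<close> in the second column; in both cases the
  \<open>w\<close>-components are precisely the matrices with vanishing first column.\<close>

lemma heisenberg_model_eq:
  "(heisenberg_model :: ('f::field mat2 \<times> 'f mat2) set) = {(mat_scal c (mat 1) + mat_scal s n\<^sub>0, mat_scal u n\<^sub>0 + mat_scal v (mat 1 - p\<^sub>0)) | c s u v. True}"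
  (is "_ = ?R")
proof
  show "heisenberg_model \<subseteq> ?R"
  proof
    fix z :: "'f mat2 \<times> 'f mat2" assume "z \<in> heisenberg_model"
    then obtain c w q q' where zw: "z = scal split_octonions c (mat 1, 0) + w"
      "w = mul split_octonions (n\<^sub>0, 0) q" "w = mul split_octonions q' (n\<^sub>0, 0)"
      unfolding heisenberg_model_def scalars_def split_octonions_sel(3) by blast
    obtain a y a' y' where "q = (a, y)" "q' = (a', y')" by (metis surj_pair)
    note z = zw[unfolded this]
    have "w = (mat_scal (a $ 2 $ 2) n\<^sub>0, mat_scal (y $ 1 $ 1) n\<^sub>0 + mat_scal (y $ 2 $ 1) (mat 1 - p\<^sub>0))"
      using z(2,3) by (simp add: mat2_simps)
    then have "z = (mat_scal c (mat 1) + mat_scal (a $ 2 $ 2) n\<^sub>0,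
        mat_scal (y $ 1 $ 1) n\<^sub>0 + mat_scal (y $ 2 $ 1) (mat 1 - p\<^sub>0))"
      using z(1) by (simp add: mat2_simps)
    then show "z \<in> ?R" by blast
  qed
  show "?R \<subseteq> heisenberg_model"
  proof clarify
    fix c s u v :: 'f
    let ?w = "(mat_scal s n\<^sub>0, mat_scal u n\<^sub>0 + mat_scal v (mat 1 - p\<^sub>0)) :: 'f mat2 \<times> 'f mat2"
    \<comment> \<open>The minus signs in the second factorization come from
      \<open>adjugate n\<^sub>0 = - n\<^sub>0\<close>.\<close>
    have "?w = mul split_octonions (n\<^sub>0, 0)
        (vector [vector [0, 0], vector [0, s]], vector [vector [u, 0], vector [v, 0]])"
      "?w = mul split_octonions
        (vector [vector [s, 0], vector [0, 0]], vector [vector [- u, 0], vector [- v, 0]]) (n\<^sub>0, 0)"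
      by (simp_all add: mat2_simps)
    then have "?w \<in> range (\<lambda>u. mul split_octonions (n\<^sub>0, 0) u) \<inter> range (\<lambda>u. mul split_octonions u (n\<^sub>0, 0))"
      by blast
    moreover have "scal split_octonions c (unity split_octonions) \<in> scalars (split_octonions :: ('f, 'f mat2 \<times> 'f mat2) normed_alg)"
      by (simp add: scalars_def)
    moreover have "(mat_scal c (mat 1) + mat_scal s n\<^sub>0, mat_scal u n\<^sub>0 + mat_scal v (mat 1 - p\<^sub>0)) =
        scal split_octonions c (unity split_octonions) + ?w"
      by (simp add: mat2_simps)
    ultimately show "(mat_scal c (mat 1) + mat_scal s n\<^sub>0, mat_scal u n\<^sub>0 + mat_scal v (mat 1 - p\<^sub>0)) \<in> heisenberg_model"
      unfolding heisenberg_model_def by blast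
  qed
qed

context octonion
begin

lemma split_of_identification:
  assumes "split_identification C \<phi>" shows "split C UNIV"
proof -
  note D = identificationD[OF assms]
  have "\<phi> (n\<^sub>0, 0) \<noteq> 0"
  proof
    assume "\<phi> (n\<^sub>0, 0) = 0"
    then have "(n\<^sub>0 :: 'f mat2, 0 :: 'f mat2) = 0" using D(4,6) by (metis bij_is_inj injD)
    then show False by (simp add: mat2_simps zero_prod_def)
  qed
  moreover have "N (\<phi> (n\<^sub>0, 0)) = 0" unfolding D(5) by (simp add: mat2_simps)
  ultimately show ?thesis by (auto simp: split_def)
qed

lemma triangular_model:
  assumes "triangular_pair p n"
  shows "in_orbit_of_model C (vs.span {e, p, n}) upper_triangular_model"
proof -
  obtain \<phi> where \<phi>: "split_identification C \<phi>" "\<phi> (p\<^sub>0, 0) = p" "\<phi> (n\<^sub>0, 0) = n"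
    using peirce_pair_identification[of p n] assms unfolding triangular_pair_def by blast
  note D = identificationD[OF \<phi>(1)]
  have 1: "\<phi> (mat c + (mat_scal u p\<^sub>0 + mat_scal v n\<^sub>0), 0) = c \<star> e + u \<star> p + v \<star> n" for c u v
  proof -
    have "(mat c + (mat_scal u p\<^sub>0 + mat_scal v n\<^sub>0), 0 :: 'f mat2) = scal split_octonions c (mat 1, 0) +
        scal split_octonions u (p\<^sub>0, 0) + scal split_octonions v (n\<^sub>0, 0)"
      by (simp add: mat2_simps)
    then show ?thesis by (simp only: D \<phi>)
  qed
  have "\<phi> ` upper_triangular_model =
      {\<phi> (mat c + (mat_scal u p\<^sub>0 + mat_scal v n\<^sub>0), 0) | c u v. True}"
    unfolding upper_triangular_model_def p0_n0_plane_def by blast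
  also have "\<dots> = {c \<star> e + u \<star> p + v \<star> n | c u v. True}" unfolding 1 ..
  also have "\<dots> = vs.span {e, p, n}" using span_coords(3) lin_comb_in_span(3) by blast
  finally show ?thesis using in_orbit_of_modelI split_of_identification \<phi>(1) by blast
qed

lemma null_model:
  assumes "null_pair x y"
  shows "in_orbit_of_model C (vs.span {e, x, y}) (plane_extension_model (scalars mat_alg))"
proof -
  obtain \<phi> where \<phi>: "split_identification C \<phi>" "\<phi> (0, p\<^sub>0) = x" "\<phi> (0, n\<^sub>0) = y"
    using null_pair_identification[of x y] assms unfolding null_pair_def by blast
  note D = identificationD[OF \<phi>(1)]
  have 1: "\<phi> (mat_scal c (mat 1), mat_scal u p\<^sub>0 + mat_scal v n\<^sub>0) = c \<star> e + u \<star> x + v \<star> y" for c u v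
  proof -
    have "(mat_scal c (mat 1), mat_scal u p\<^sub>0 + mat_scal v n\<^sub>0) = scal split_octonions c (mat 1, 0 :: 'f mat2) +
        scal split_octonions u (0, p\<^sub>0) + scal split_octonions v (0, n\<^sub>0)"
      by (simp add: mat2_simps)
    then show ?thesis by (simp only: D \<phi>)
  qed
  have "\<phi> ` plane_extension_model (scalars mat_alg) =
      {\<phi> (mat_scal c (mat 1), mat_scal u p\<^sub>0 + mat_scal v n\<^sub>0) | c u v. True}"
    unfolding plane_extension_model_def p0_n0_plane_def scalars_def mat_alg_sel by blast
  also have "\<dots> = {c \<star> e + u \<star> x + v \<star> y | c u v. True}" unfolding 1 ..
  also have "\<dots> = vs.span {e, x, y}" using span_coords(3) lin_comb_in_span(3) by blast
  finally show ?thesis using in_orbit_of_modelI split_of_identification \<phi>(1) by blast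
qed

text \<open>The polar form has Gram determinant \<open>- 1\<close> on the basis \<open>e, p\<close>,
  in every characteristic, and \<open>n\<close> is orthogonal to the whole span.\<close>

lemma triangular_radical:
  assumes "triangular_pair p n"
  shows "bilinear_radical C (vs.span {e, p, n}) = vs.span {n}"
proof
  have Nn: "N n = 0" using N_mul[of p n] assms by (simp add: triangular_pair_def)
  show "bilinear_radical C (vs.span {e, p, n}) \<subseteq> vs.span {n}"
  proof
    fix r assume r: "r \<in> bilinear_radical C (vs.span {e, p, n})"
    then have "r \<in> vs.span {e, p, n}" by (simp add: bilinear_radical_def)
    then obtain \<alpha> \<beta> \<gamma> where rr: "r = \<alpha> \<star> e + \<beta> \<star> p + \<gamma> \<star> n"
      using span_coords(3) by blast
    have "b r e = 0" "b r p = 0"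
      using r by (auto simp: bilinear_radical_def perp_def vs.span_base)
    then have "2 * \<alpha> + \<beta> = 0" "\<alpha> = 0"
      using assms by (simp_all add: rr polar_lin T_one triangular_pair_def polar_commute[of e p] polar_self)
    then show "r \<in> vs.span {n}" using lin_comb_in_span(1) by (simp add: rr)
  qed
  show "vs.span {n} \<subseteq> bilinear_radical C (vs.span {e, p, n})"
  proof
    fix r assume "r \<in> vs.span {n}"
    then obtain k where r: "r = k \<star> n" using span_coords(1) by blast
    have "r \<in> vs.span {e, p, n}" unfolding r by (intro vs.span_scale vs.span_base) simp
    moreover have "b r a = 0" if a: "a \<in> vs.span {e, p, n}" for a
    proof -
      obtain \<alpha> \<beta> \<gamma> where "a = \<alpha> \<star> e + \<beta> \<star> p + \<gamma> \<star> n" using a span_coords(3) by blast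
      then show ?thesis using assms Nn by (simp add: r polar_lin triangular_pair_def polar_self)
    qed
    ultimately show "r \<in> bilinear_radical C (vs.span {e, p, n})"
      by (simp add: bilinear_radical_def perp_def)
  qed
qed

lemma null_radical:
  assumes "null_pair x y"
  shows "{x, y} \<subseteq> bilinear_radical C (vs.span {e, x, y})"
proof -
  have bxy: "b x y = 0" using T_mul[of x y] assms by (simp add: null_pair_def)
  have "b x a = 0 \<and> b y a = 0" if "a \<in> vs.span {e, x, y}" for a
  proof -
    obtain \<alpha> \<beta> \<gamma> where "a = \<alpha> \<star> e + \<beta> \<star> x + \<gamma> \<star> y" using \<open>a \<in> _\<close> span_coords(3) by blast
    then show ?thesis using assms bxy by (simp add: polar_lin null_pair_def polar_self polar_commute[of y x])
  qed
  then show ?thesis by (simp add: bilinear_radical_def perp_def vs.span_base)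
qed

theorem dimension_three:
  assumes A: "subalgebra C A" "e \<in> A" and dim: "vs.dim A = 3"
  shows "bilinear_radical C A \<noteq> {0} \<and>
    ((vs.dim (bilinear_radical C A) = 1 \<and> in_orbit_of_model C A upper_triangular_model) \<or>
     (vs.dim (bilinear_radical C A) \<ge> 2 \<and>
      in_orbit_of_model C A (plane_extension_model (scalars mat_alg))))"
  using A dim
proof (cases rule: classification_three)
  case (1 p n)
  have "n \<noteq> 0" using 1(1) by (simp add: triangular_pair_def)
  moreover have "n \<in> bilinear_radical C A"
    using triangular_radical[OF 1(1)] 1(2) by (simp add: vs.span_base)
  ultimately show ?thesis
    using triangular_radical[OF 1(1)] triangular_model[OF 1(1)] 1(2) by auto
next
  case (2 x y)
  have "vs.independent {y, x}" "card {y, x} = 2"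
    using independent_two[of x y] 2(1) by (simp_all add: null_pair_def)
  then have "2 \<le> vs.dim (bilinear_radical C A)"
    using null_radical[OF 2(1)] fd.independent_card_le_dim[of "{y, x}" "bilinear_radical C A"] 2(2) by auto
  moreover have "vs.dim {0} = 0" by simp
  ultimately have "2 \<le> vs.dim (bilinear_radical C A)" "bilinear_radical C A \<noteq> {0}" by force+
  then show ?thesis using null_model[OF 2(1)] 2(2) by simp
qed

text \<open>\<open>heisenberg_pair_identification\<close> normalizes a pair to
  \<open>(n\<^sub>0, 0)\<close> and \<open>(0, p\<^sub>0)\<close>, whereas
  \<open>heisenberg_model\<close> is generated by the pair \<open>(0, n\<^sub>0)\<close> and
  \<open>(0, mat 1 - p\<^sub>0)\<close>. Applied to the model itself, the same lemma yields the
  change of coordinates \<open>\<psi>\<close> between the two.\<close>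

lemma heisenberg_in_orbit:
  assumes "heisenberg_pair x y"
  shows "in_orbit_of_model C (vs.span {e, x, y, x \<cdot> y}) heisenberg_model"
proof -
  obtain \<phi> where \<phi>: "split_identification C \<phi>" "\<phi> (n\<^sub>0, 0) = x" "\<phi> (0, p\<^sub>0) = y"
    using heisenberg_pair_identification[of x y] assms unfolding heisenberg_pair_def by blast
  let ?u = "(0, n\<^sub>0) :: 'f mat2 \<times> 'f mat2" and ?v = "(0, mat 1 - p\<^sub>0) :: 'f mat2 \<times> 'f mat2"
  obtain \<psi> where \<psi>: "split_identification split_octonions \<psi>" "\<psi> (n\<^sub>0, 0) = ?u" "\<psi> (0, p\<^sub>0) = ?v"
  proof (rule split_octonions.heisenberg_pair_identification[of ?u ?v])
    show "mul split_octonions ?u ?v \<noteq> 0" by (simp add: mat2_simps zero_prod_def)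
  qed (simp_all add: mat2_simps)
  have bij: "bij \<psi>" using split_octonions.identificationD(4)[OF \<psi>(1)] .
  define \<theta> where "\<theta> = \<phi> \<circ> inv \<psi>"
  have "alg_iso split_octonions UNIV C UNIV \<theta>"
    using \<phi>(1) \<psi>(1) alg_iso_inv[of split_octonions UNIV split_octonions UNIV \<psi>] alg_iso_compose
    unfolding \<theta>_def split_identification_def by blast
  moreover have "N (\<theta> w) = nrm split_octonions w" for w
  proof -
    have "N (\<theta> w) = nrm split_octonions (inv \<psi> w)"
      using \<phi>(1) unfolding \<theta>_def split_identification_def o_def by blast
    also have "\<dots> = nrm split_octonions (\<psi> (inv \<psi> w))"
      using \<psi>(1) unfolding split_identification_def by metis
    also have "\<psi> (inv \<psi> w) = w" using bij by (simp add: bij_def surj_f_inv_f)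
    finally show ?thesis .
  qed
  ultimately have \<theta>: "split_identification C \<theta>" by (simp add: split_identification_def)
  have inv: "inv \<psi> (\<psi> w) = w" for w using bij by (simp add: bij_def)
  have \<theta>u: "\<theta> ?u = x" "\<theta> ?v = y"
    using inv[of "(n\<^sub>0, 0)"] inv[of "(0, p\<^sub>0)"] \<phi> \<psi> by (simp_all add: \<theta>_def)
  note D = identificationD[OF \<theta>]
  have prod: "mul split_octonions ?u ?v = (n\<^sub>0, 0)" by (simp add: mat2_simps)
  have \<theta>n: "\<theta> (n\<^sub>0, 0) = x \<cdot> y" using D(3)[of ?u ?v] unfolding prod \<theta>u .
  have 1: "\<theta> (mat_scal c (mat 1) + mat_scal s n\<^sub>0, mat_scal u n\<^sub>0 + mat_scal v (mat 1 - p\<^sub>0)) =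
      c \<star> e + u \<star> x + v \<star> y + s \<star> (x \<cdot> y)" for c s u v
  proof -
    have "(mat_scal c (mat 1) + mat_scal s n\<^sub>0, mat_scal u n\<^sub>0 + mat_scal v (mat 1 - p\<^sub>0)) =
      scal split_octonions c (mat 1, 0 :: 'f mat2) + scal split_octonions u ?u +
      scal split_octonions v ?v + scal split_octonions s (n\<^sub>0, 0)"
      by (simp add: mat2_simps)
    then show ?thesis by (simp only: D(1,2,7) \<theta>u \<theta>n)
  qed
  have "\<theta> ` heisenberg_model =
      {\<theta> (mat_scal c (mat 1) + mat_scal s n\<^sub>0, mat_scal u n\<^sub>0 + mat_scal v (mat 1 - p\<^sub>0)) | c s u v. True}"
    unfolding heisenberg_model_eq by blast
  also have "\<dots> = {c \<star> e + u \<star> x + v \<star> y + s \<star> (x \<cdot> y) | c s u v. True}" unfolding 1 ..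
  also have "\<dots> = vs.span {e, x, y, x \<cdot> y}" using span_coords(4) lin_comb_in_span(4) by blast
  finally show ?thesis using in_orbit_of_modelI split_of_identification \<theta> by blast
qed

lemma heisenberg_radical:
  assumes "heisenberg_pair x y"
  shows "quadratic_radical C (vs.span {e, x, y, x \<cdot> y}) = vs.span {x, y, x \<cdot> y}"
proof -
  have H: "T x = 0" "N x = 0" "T y = 0" "N y = 0" "b x y = 0" "x \<cdot> y \<noteq> 0"
    using assms by (auto simp: heisenberg_pair_def)
  note h = heisenberg_pair_facts[OF H]
  have n: "N (x \<cdot> y) = 0" using H by (simp add: N_mul)
  have bn: "b x (x \<cdot> y) = 0" "b y (x \<cdot> y) = 0"
    using polar_mul_left[of x e y] polar_mul_right[of e y x] H by (simp_all add: polar_commute)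
  have bn': "b (x \<cdot> y) x = 0" "b (x \<cdot> y) y = 0" "b y x = 0"
    using bn H(5) by (simp_all only: polar_commute)
  have self: "b x x = 0" "b y y = 0" "b (x \<cdot> y) (x \<cdot> y) = 0" using H n by (simp_all add: polar_self)
  show ?thesis
  proof
    show "quadratic_radical C (vs.span {e, x, y, x \<cdot> y}) \<subseteq> vs.span {x, y, x \<cdot> y}"
    proof
      fix r assume r: "r \<in> quadratic_radical C (vs.span {e, x, y, x \<cdot> y})"
      then have "r \<in> vs.span {e, x, y, x \<cdot> y}" by (simp add: quadratic_radical_def)
      then obtain \<alpha> \<beta> \<gamma> \<delta> where rr: "r = \<alpha> \<star> e + \<beta> \<star> x + \<gamma> \<star> y + \<delta> \<star> (x \<cdot> y)"
        using span_coords(4) by blast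
      have "N r = \<alpha>\<^sup>2" unfolding rr using H h(7) n bn
        by (simp add: N_add N_scal polar_lin polar_commute[of e x] polar_commute[of e y] polar_commute[of e "x \<cdot> y"])
      then have "\<alpha> = 0" using r by (simp add: quadratic_radical_def)
      then show "r \<in> vs.span {x, y, x \<cdot> y}" using rr lin_comb_in_span(3) by simp
    qed
    show "vs.span {x, y, x \<cdot> y} \<subseteq> quadratic_radical C (vs.span {e, x, y, x \<cdot> y})"
    proof
      fix r assume r: "r \<in> vs.span {x, y, x \<cdot> y}"
      then obtain \<beta> \<gamma> \<delta> where rr: "r = \<beta> \<star> x + \<gamma> \<star> y + \<delta> \<star> (x \<cdot> y)" using span_coords(3) by blast
      have "vs.span {x, y, x \<cdot> y} \<subseteq> vs.span {e, x, y, x \<cdot> y}" by (intro vs.span_mono) auto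
      moreover have "N r = 0" unfolding rr using H n bn by (simp add: N_add N_scal polar_lin)
      moreover have "b r a = 0" if "a \<in> vs.span {e, x, y, x \<cdot> y}" for a
      proof -
        obtain \<alpha>' \<beta>' \<gamma>' \<delta>' where "a = \<alpha>' \<star> e + \<beta>' \<star> x + \<gamma>' \<star> y + \<delta>' \<star> (x \<cdot> y)"
          using \<open>a \<in> _\<close> span_coords(4) by blast
        then show ?thesis unfolding rr using H h(7) bn bn' self by (simp add: polar_lin)
      qed
      ultimately show "r \<in> quadratic_radical C (vs.span {e, x, y, x \<cdot> y})"
        using r by (auto simp: quadratic_radical_def perp_def)
    qed
  qed
qed

lemma vector_space_heisenberg: "vector_space (scal (heisenberg_alg :: ('f, 'f \<times> 'f \<times> 'f) alg))"
  by unfold_locales (auto simp: heisenberg_alg_def algebra_simps)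

lemma algebra_heisenberg: "algebra (heisenberg_alg :: ('f, 'f \<times> 'f \<times> 'f) alg) UNIV"
proof -
  interpret v: vector_space "scal (heisenberg_alg :: ('f, 'f \<times> 'f \<times> 'f) alg)"
    by (rule vector_space_heisenberg)
  show ?thesis
    unfolding algebra_def subalgebra_def using vector_space_heisenberg v.subspace_UNIV
    by (auto simp: heisenberg_alg_def algebra_simps)
qed

lemma heisenberg_radical_isomorphic:
  assumes "heisenberg_pair x y" and Q: "subalgebra C (vs.span {x, y, x \<cdot> y})"
  shows "alg_isomorphic C (vs.span {x, y, x \<cdot> y}) (heisenberg_alg :: ('f, 'f \<times> 'f \<times> 'f) alg) UNIV"
    and "vs.dim (vs.span {x, y, x \<cdot> y}) = 3"
proof -
  have H: "T x = 0" "N x = 0" "T y = 0" "N y = 0" "b x y = 0" "x \<cdot> y \<noteq> 0"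
    using assms by (auto simp: heisenberg_pair_def)
  note h = heisenberg_pair_facts[OF H]
  have xx: "x \<cdot> x = 0" "y \<cdot> y = 0" using H by (simp_all add: quadratic)
  have x0: "x \<noteq> 0" using H by auto
  have ind: "vs.independent {x, y, x \<cdot> y} \<and> card {x, y, x \<cdot> y} = 3"
    using independent_three[OF h(10,8) x0] .
  then show "vs.dim (vs.span {x, y, x \<cdot> y}) = 3" by (simp add: vs.dim_eq_card_independent)
  let ?h = "\<lambda>(u, v, w). u \<star> x + v \<star> y + w \<star> (x \<cdot> y)"
  \<comment> \<open>Left multiplication by \<open>x\<close> isolates \<open>v\<close>, right
    multiplication by \<open>y\<close> isolates \<open>u\<close>.\<close>
  have zero: "u = 0 \<and> v = 0 \<and> w = 0" if uvw: "u \<star> x + v \<star> y + w \<star> (x \<cdot> y) = 0" for u v w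
  proof -
    have "x \<cdot> (u \<star> x + v \<star> y + w \<star> (x \<cdot> y)) = v \<star> (x \<cdot> y)" "(u \<star> x + v \<star> y + w \<star> (x \<cdot> y)) \<cdot> y = u \<star> (x \<cdot> y)"
      by (simp_all add: mul_lin xx h)
    then show ?thesis using uvw H(6) by simp
  qed
  have "inj ?h"
  proof (rule injI)
    fix a c assume ac: "?h a = ?h c"
    obtain u v w u' v' w' where "a = (u, v, w)" "c = (u', v', w')" by (metis prod_cases3)
    then show "a = c" using zero[of "u - u'" "v - v'" "w - w'"] ac by (simp add: vs_lin algebra_simps)
  qed
  moreover have "range ?h = vs.span {x, y, x \<cdot> y}"
  proof
    show "range ?h \<subseteq> vs.span {x, y, x \<cdot> y}" using lin_comb_in_span(3) by auto
    show "vs.span {x, y, x \<cdot> y} \<subseteq> range ?h"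
    proof
      fix z assume "z \<in> vs.span {x, y, x \<cdot> y}"
      then obtain u v w where "z = ?h (u, v, w)" using span_coords(3) by fastforce
      then show "z \<in> range ?h" by blast
    qed
  qed
  moreover have "?h (mul heisenberg_alg a c) = ?h a \<cdot> ?h c" for a c
  proof -
    obtain u v w u' v' w' where "a = (u, v, w)" "c = (u', v', w')" by (metis prod_cases3)
    then show ?thesis by (simp add: heisenberg_alg_def mul_lin xx h vs_lin algebra_simps)
  qed
  ultimately have "alg_iso heisenberg_alg UNIV C (vs.span {x, y, x \<cdot> y}) ?h"
    unfolding alg_iso_def bij_betw_def using algebra_heisenberg algebra_of_subalgebra[OF Q]
    by (auto simp: heisenberg_alg_def vs_lin algebra_simps)
  then show "alg_isomorphic C (vs.span {x, y, x \<cdot> y}) (heisenberg_alg :: ('f, 'f \<times> 'f \<times> 'f) alg) UNIV"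
    unfolding alg_isomorphic_def using alg_iso_inv by blast
qed

text \<open>If \<open>F + F h\<close> is singular, its radical lies outside the quadratic radical of \<open>A\<close>,
  so it is anisotropic; this forces characteristic two and trace zero.\<close>

lemma plane_in_orbit:
  assumes null: "null_pair x (\<beta> \<cdot> x)"
    and Q: "quadratic_radical C (vs.span {e, \<beta>, x, \<beta> \<cdot> x}) \<subseteq> vs.span {x, \<beta> \<cdot> x}"
  shows "\<exists>B. alg_dim mat_alg B = 2 \<and> (composition_algebra mat_alg B \<or> inseparable_extension mat_alg B) \<and>
    in_orbit_of_model C (vs.span {e, \<beta>, x, \<beta> \<cdot> x}) (plane_extension_model B)"
proof -
  define t n where "t = T \<beta>" and "n = N \<beta>"
  let ?h = "companion t n"
  define B where "B = generated_line mat_alg ?h"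
  obtain \<phi> where \<phi>: "split_identification C \<phi>" "\<phi> (0, p\<^sub>0) = x" "\<phi> (0, n\<^sub>0) = \<beta> \<cdot> x"
    "\<phi> ` plane_extension_model B = vs.span {e, \<beta>, x, \<beta> \<cdot> x}"
    using plane_identification[OF null] unfolding B_def t_def n_def by blast
  note D = identificationD[OF \<phi>(1)]
  note gens = companion_line_gens[of t n, folded B_def]
  \<comment> \<open>Such an \<open>a\<close> yields a vector of the quadratic radical in the matrix
    part, whereas the radical is contained in the plane spanned by \<open>x\<close> and
    \<open>\<beta> \<cdot> x\<close>, which lies in the \<open>w\<close>-part.\<close>
  have key: "a = 0" if a: "a \<in> B" "det a = 0" "polar mat_alg a (mat 1) = 0" "polar mat_alg a ?h = 0" for a
  proof -
    have perp: "polar mat_alg a c = 0" if cB: "c \<in> B" for c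
    proof -
      obtain s u where c: "c = mat_scal s (mat 1) + mat_scal u ?h"
        using cB unfolding B_def companion_line by blast
      have "polar mat_alg a c = s * polar mat_alg a (mat 1) + u * polar mat_alg a ?h"
        by (simp add: c polar_mat_alg mat2_simps algebra_simps)
      then show ?thesis using a by simp
    qed
    have plane0: "0 \<in> (p0_n0_plane :: 'f mat2 set)"
      unfolding p0_n0_plane_def by (rule CollectI, rule exI[of _ 0], rule exI[of _ 0]) (simp add: mat2_simps)
    have "\<phi> (a, 0) \<in> quadratic_radical C (vs.span {e, \<beta>, x, \<beta> \<cdot> x})"
    proof -
      have "\<phi> (a, 0) \<in> vs.span {e, \<beta>, x, \<beta> \<cdot> x}"
        using a(1) plane0 \<phi>(4) unfolding plane_extension_model_def by blast
      moreover have "N (\<phi> (a, 0)) = 0" unfolding D(5) using a(2) by (simp add: det_2)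
      moreover have "b (\<phi> (a, 0)) z = 0" if zA: "z \<in> vs.span {e, \<beta>, x, \<beta> \<cdot> x}" for z
      proof -
        obtain c k where z: "z = \<phi> (c, k)" "c \<in> B"
          using zA unfolding \<phi>(4)[symmetric] plane_extension_model_def by blast
        have "b (\<phi> (a, 0)) z = polar mat_alg a c"
          unfolding z(1) identification_T(1)[OF \<phi>(1)] by (simp add: polar_mat_alg)
        then show ?thesis using perp[OF z(2)] by simp
      qed
      ultimately show ?thesis by (simp add: quadratic_radical_def perp_def)
    qed
    then obtain r s where "\<phi> (a, 0) = r \<star> x + s \<star> (\<beta> \<cdot> x)" using Q span_coords(2) by blast
    also have "\<dots> = \<phi> (scal split_octonions r (0, p\<^sub>0) + scal split_octonions s (0, n\<^sub>0))"
      by (simp only: D(1,2) \<phi>(2,3))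
    finally have "(a, 0) = scal split_octonions r (0, p\<^sub>0) + scal split_octonions s (0, n\<^sub>0 :: 'f mat2)"
      using D(4) by (metis bij_is_inj injD)
    then show "a = 0" by (simp add: mat2_simps)
  qed
  have "composition_algebra mat_alg B \<or> inseparable_extension mat_alg B"
  proof (cases "4 * n = t\<^sup>2")
    case False
    then show ?thesis using composition_companion_line unfolding B_def by blast
  next
    case disc: True
    have two: "(2::'f) = 0"
    proof (rule ccontr)
      assume 2: "(2::'f) \<noteq> 0"
      have "(2::'f) * 2 \<noteq> 0" using 2 by (metis mult_eq_0_iff)
      then have 4: "(4::'f) \<noteq> 0" by simp
      have "(2::'f) * 4 \<noteq> 0" using 2 4 by (metis mult_eq_0_iff)
      then have 8: "(8::'f) \<noteq> 0" by simp
      have n: "n = t\<^sup>2 / 4" using disc 4 by (simp add: field_simps)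
      \<comment> \<open>\<open>h - t / 2\<close> spans the radical of the polar form on
        \<open>F + F h\<close> when the discriminant vanishes and \<open>2 \<noteq> 0\<close>; its
        determinant is then zero as well.\<close>
      let ?a = "mat_scal (- t / 2) (mat 1) + mat_scal 1 ?h"
      have "?a = 0"
      proof (rule key)
        show "?a \<in> B" unfolding B_def companion_line by blast
        show "det ?a = 0" "polar mat_alg ?a (mat 1) = 0" "polar mat_alg ?a ?h = 0"
          unfolding companion_line_nrm companion_line_polar using 2 4 8
          by (simp_all add: n field_simps power2_eq_square)
      qed
      then show False unfolding companion_line_zero by simp
    qed
    have "(4::'f) = 2 * 2" by simp
    then have t: "t = 0" using disc two by simp
    have "a = 0" if a: "a \<in> B" "det a = 0" for a
    proof -
      obtain s u where c: "a = mat_scal s (mat 1) + mat_scal u ?h"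
        using a(1) unfolding B_def companion_line by blast
      show ?thesis
        using a two t by (intro key) (simp_all only: c companion_line_polar, simp_all)
    qed
    then have "inseparable_extension mat_alg B"
      using inseparable_companion_line[OF two t] unfolding B_def by blast
    then show ?thesis ..
  qed
  moreover have "in_orbit_of_model C (vs.span {e, \<beta>, x, \<beta> \<cdot> x}) (plane_extension_model B)"
    using in_orbit_of_modelI[OF split_of_identification[OF \<phi>(1)] \<phi>(1,4)] .
  moreover have "alg_dim mat_alg B = 2" unfolding B_def by (rule dim_companion_line)
  ultimately show ?thesis by blast
qed

text \<open>\<open>dim_perp_le\<close> bounds the dimension of \<open>perp C A\<close> by four, so
  the inclusion is an equality. Characteristic 2 follows from \<open>T e = 2\<close>; vanishing of
  the polar form on \<open>A\<close> makes \<open>A\<close> commutative and puts the squares into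
  \<open>F\<close>.\<close>

lemma self_perp_of_anisotropic:
  assumes A: "subalgebra C A" "e \<in> A" and dim: "vs.dim A = 4"
    and aniso: "\<And>z. z \<in> A \<Longrightarrow> N z = 0 \<Longrightarrow> z = 0" and perp: "A \<subseteq> perp C A"
  shows "self_perp_inseparable_subfield C A"
proof -
  have "vs.dim (perp C A) \<le> vs.dim A" using dim_perp_le[of A] dim by simp
  then have eq: "A = perp C A"
    using fd.subspace_dim_equal[OF subalgebraD(7)[OF A(1)] subspace_perp perp] by simp
  have b0: "b x y = 0" if "x \<in> A" "y \<in> A" for x y using perp that by (auto simp: perp_def)
  have two: "(2::'f) = 0" using b0[OF A(2) A(2)] by (simp add: T_one)
  have minus: "- z = z" for z :: 'a
  proof -
    have "z + z = 2 \<star> z" using vs.scale_left_distrib[of 1 1 z] by simp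
    then have "z + z = 0" using two by simp
    then show ?thesis by (metis add_eq_0_iff)
  qed
  have comm: "x \<cdot> y = y \<cdot> x" if "x \<in> A" "y \<in> A" for x y
    using mul_commute[of y x] b0[OF that] b0[OF that(1) A(2)] b0[OF that(2) A(2)] minus by simp
  have "assoc_on C A" using associative_of_dim_le_four[OF A] dim by simp
  then have field: "field_extension C A" using field_extension_anisotropic[OF A aniso] comm by blast
  have "\<not> separable_element C x" if x: "x \<in> A - scalars C" for x
  proof -
    have "x \<notin> vs.span {e}" using x by (auto simp: scalars_def vs.span_singleton)
    then show ?thesis
      using quadratic_element.inseparable[OF quadratic_element two] b0[OF _ A(2), of x] x by blast
  qed
  moreover have "x \<cdot> x \<in> scalars C" if "x \<in> A" for x
  proof -
    have "x \<cdot> x = (- N x) \<star> e" using b0[OF that A(2)] by (simp add: quadratic)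
    then show ?thesis unfolding scalars_def by (metis rangeI)
  qed
  ultimately show ?thesis
    using eq field dim CHAR_eq_2[OF two]
    by (simp add: self_perp_inseparable_subfield_def totally_inseparable_extension_def
        exponent_one_def alg_dim_def)
qed

theorem dimension_four:
  assumes A: "subalgebra C A" "e \<in> A" and dim: "vs.dim A = 4"
  shows "quaternion_algebra C A \<or>
    (\<exists>B. alg_dim mat_alg B = 2 \<and> (composition_algebra mat_alg B \<or> inseparable_extension mat_alg B) \<and>
       in_orbit_of_model C A (plane_extension_model B)) \<or>
    (alg_dim C (quadratic_radical C A) = 3 \<and>
      alg_isomorphic C (quadratic_radical C A) (heisenberg_alg :: ('f, 'f \<times> 'f \<times> 'f) alg) UNIV \<and>
      in_orbit_of_model C A heisenberg_model) \<or>
    self_perp_inseparable_subfield C A"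
  using A dim
proof (cases rule: classification_four)
  case (quaternion p q)
  have "nonsingular_subalgebra C A"
    using quaternion(1) A by (auto simp: nonsingular_subalgebra_def bilinear_radical_def perp_def)
  then have "quaternion_algebra C A"
    using composition_of_nonsingular dim by (simp add: quaternion_algebra_def alg_dim_def)
  then show ?thesis ..
next
  case (plane \<beta> x)
  then show ?thesis using plane_in_orbit[OF plane(1)] by simp
next
  case (heisenberg x y)
  note Q = heisenberg_radical[OF heisenberg(1), folded heisenberg(2)]
  have "subalgebra C (quadratic_radical C A)"
    using subspace_quadratic_radical[OF A] quadratic_radical_ideal(1)[OF A] quadratic_radicalD(1)[OF A]
    by (simp add: subalgebra_def)
  then show ?thesis
    using heisenberg_radical_isomorphic[OF heisenberg(1)] heisenberg_in_orbit[OF heisenberg(1)] heisenberg(2) Q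
    by (simp add: alg_dim_def)
next
  case (anisotropic x y)
  then show ?thesis using self_perp_of_anisotropic[OF A dim] by blast
qed

theorem same_orbit_iff_isomorphic:
  assumes "subalgebra C A" "e \<in> A" "vs.dim A \<le> 4" "subalgebra C A'" "e \<in> A'"
  shows "same_orbit C A A' \<longleftrightarrow> alg_isomorphic C A C A'"
  using alg_isomorphic_of_same_orbit same_orbit_of_isomorphic assms unfolding alg_isomorphic_def by blast

lemma dimension_one:
  assumes "subalgebra C A" "e \<in> A" "vs.dim A = 1" shows "A = scalars C"
proof -
  have "A = vs.span {e}" using assms one_nonzero by (intro span_eq_of_dim subalgebraD(7)) auto
  then show ?thesis by (simp add: vs.span_singleton scalars_def)
qed

end

theorem mainTheorem3:
  fixes \<O> :: "('f::field, 'o::ab_group_add) normed_alg"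
    and A :: "'o set"
  assumes "octonion_algebra \<O>"
    and "subalgebra \<O> A"
    and "unity \<O> \<in> A"
  shows
    \<comment> \<open>a split octonion algebra can be written as \<open>\<H> + \<H> w\<close>\<close>
    "(split \<O> UNIV \<longrightarrow> (\<exists>\<phi>. split_identification \<O> \<phi>)) \<and>
    (alg_dim \<O> A = 1 \<longrightarrow> A = scalars \<O>) \<and>
    (alg_dim \<O> A = 2 \<longrightarrow>
       separable_extension \<O> A \<or>
       (inseparable_extension \<O> A \<and> CHAR('f) = 2) \<or>
       (alg_isomorphic \<O> A (quotient_alg [:0, - 1, 1 :: 'f:]) (remainders [:0, - 1, 1:]) \<and>
        alg_isomorphic (quotient_alg [:0, - 1, 1 :: 'f:]) (remainders [:0, - 1, 1:])
          (product_alg :: ('f, 'f \<times> 'f) alg) UNIV \<and>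
        composition_algebra \<O> A \<and> split \<O> A) \<or>
       (alg_isomorphic \<O> A (quotient_alg [:0, 0, 1 :: 'f:]) (remainders [:0, 0, 1:]) \<and>
        local_algebra \<O> A)) \<and>
    (alg_dim \<O> A = 3 \<longrightarrow>
       bilinear_radical \<O> A \<noteq> {0} \<and>
       ((alg_dim \<O> (bilinear_radical \<O> A) = 1 \<and>
         in_orbit_of_model \<O> A upper_triangular_model) \<or>
        (alg_dim \<O> (bilinear_radical \<O> A) \<ge> 2 \<and>
         in_orbit_of_model \<O> A (plane_extension_model (scalars mat_alg))))) \<and>
    (alg_dim \<O> A = 4 \<longrightarrow>
       quaternion_algebra \<O> A \<or>
       (\<exists>B. alg_dim mat_alg B = 2 \<and>
          (composition_algebra mat_alg B \<or> inseparable_extension mat_alg B) \<and>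
          in_orbit_of_model \<O> A (plane_extension_model B)) \<or>
       (alg_dim \<O> (quadratic_radical \<O> A) = 3 \<and>
        alg_isomorphic \<O> (quadratic_radical \<O> A)
          (heisenberg_alg :: ('f, 'f \<times> 'f \<times> 'f) alg) UNIV \<and>
        in_orbit_of_model \<O> A heisenberg_model) \<or>
       self_perp_inseparable_subfield \<O> A) \<and>
    \<comment> \<open>orbits and isomorphism types for totally inseparable subfields\<close>
    (self_perp_inseparable_subfield \<O> A \<longrightarrow>
       (\<forall>A'. subalgebra \<O> A' \<and> unity \<O> \<in> A' \<and> self_perp_inseparable_subfield \<O> A' \<longrightarrow>
          (same_orbit \<O> A A' \<longleftrightarrow> alg_isomorphic \<O> A \<O> A'))) \<and>
    \<comment> \<open>orbits and isomorphism types in all cases\<close>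
    (alg_dim \<O> A \<le> 4 \<longrightarrow>
       (\<forall>A'. subalgebra \<O> A' \<and> unity \<O> \<in> A' \<longrightarrow>
          (same_orbit \<O> A A' \<longleftrightarrow> alg_isomorphic \<O> A \<O> A'))) \<and>
    \<comment> \<open>associativity\<close>
    (alg_dim \<O> A \<le> 4 \<longrightarrow> assoc_on \<O> A)"
proof -
  interpret octonion \<O> by unfold_locales fact
  note A = assms(2,3)
  have dim: "alg_dim \<O> A = vs.dim A" for A by (simp add: alg_dim_def)
  show ?thesis
    unfolding dim
  proof (intro conjI impI)
    show "\<exists>\<phi>. split_identification \<O> \<phi>" if "split \<O> UNIV"
      using split_identification_exists[OF that] by blast
    show "A = scalars \<O>" if "vs.dim A = 1"
      using dimension_one[OF A that] .
    show "separable_extension \<O> A \<or>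
       (inseparable_extension \<O> A \<and> CHAR('f) = 2) \<or>
       (alg_isomorphic \<O> A (quotient_alg [:0, - 1, 1 :: 'f:]) (remainders [:0, - 1, 1:]) \<and>
        alg_isomorphic (quotient_alg [:0, - 1, 1 :: 'f:]) (remainders [:0, - 1, 1:])
          (product_alg :: ('f, 'f \<times> 'f) alg) UNIV \<and>
        composition_algebra \<O> A \<and> split \<O> A) \<or>
       (alg_isomorphic \<O> A (quotient_alg [:0, 0, 1 :: 'f:]) (remainders [:0, 0, 1:]) \<and>
        local_algebra \<O> A)" if "vs.dim A = 2"
      using classification_two[OF A that] quotient_isomorphic_product by blast
    assume "vs.dim A = 3"
    note three = dimension_three[OF A this]
    show "bilinear_radical \<O> A \<noteq> {0}" using three by blast
    show "(vs.dim (bilinear_radical \<O> A) = 1 \<and> in_orbit_of_model \<O> A upper_triangular_model) \<or>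
       (vs.dim (bilinear_radical \<O> A) \<ge> 2 \<and>
        in_orbit_of_model \<O> A (plane_extension_model (scalars mat_alg)))" using three by blast
  next
    assume "vs.dim A = 4"
    then show "quaternion_algebra \<O> A \<or>
       (\<exists>B. alg_dim mat_alg B = 2 \<and>
          (composition_algebra mat_alg B \<or> inseparable_extension mat_alg B) \<and>
          in_orbit_of_model \<O> A (plane_extension_model B)) \<or>
       (vs.dim (quadratic_radical \<O> A) = 3 \<and>
        alg_isomorphic \<O> (quadratic_radical \<O> A)
          (heisenberg_alg :: ('f, 'f \<times> 'f \<times> 'f) alg) UNIV \<and>
        in_orbit_of_model \<O> A heisenberg_model) \<or>
       self_perp_inseparable_subfield \<O> A"
      using dimension_four[OF A] unfolding dim by blast
  next
    assume "self_perp_inseparable_subfield \<O> A"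
    then have "vs.dim A \<le> 4" by (simp add: self_perp_inseparable_subfield_def dim)
    then show "\<forall>A'. subalgebra \<O> A' \<and> unity \<O> \<in> A' \<and> self_perp_inseparable_subfield \<O> A' \<longrightarrow>
          (same_orbit \<O> A A' \<longleftrightarrow> alg_isomorphic \<O> A \<O> A')"
      using same_orbit_iff_isomorphic[OF A] by blast
  next
    assume "vs.dim A \<le> 4"
    then show "\<forall>A'. subalgebra \<O> A' \<and> unity \<O> \<in> A' \<longrightarrow>
          (same_orbit \<O> A A' \<longleftrightarrow> alg_isomorphic \<O> A \<O> A')"
      using same_orbit_iff_isomorphic[OF A] by blast
  next
    assume "vs.dim A \<le> 4"
    then show "assoc_on \<O> A" by (rule associative_of_dim_le_four[OF A])
  qed
qed

end
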